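(* For every $p_0 > 0$, there exists an analytic self-map $\phi \colon \mathbb{D} \to \mathbb{D}$ such that the composition operator $C_\phi \colon H^2 \to H^2$ is in the Schatten class $S_p$ for every $p > p_0$, but not in $S_{p_0}$.
   Context: $\mathbb{D}$ is the open unit disc of $\mathbb{C}$ and $H^2$ the Hardy space on $\mathbb{D}$. For an analytic self-map $\phi\colon\mathbb{D}\to\mathbb{D}$, $C_\phi(f) = f\circ\phi$ is the (bounded) composition operator on $H^2$. For $p>0$, $S_p$ is the Schatten class of operators on $H^2$, i.e. the compact operators whose sequence of singular numbers is in $\ell^p$. *)

theory Defs
  imports "HOL-Complex_Analysis.Complex_Analysis"
begin

section \<open>The Hardy space of the unit disc\<close>

definition taylor_coeff :: "(complex \<Rightarrow> complex) \<Rightarrow> nat \<Rightarrow> complex" where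
  "taylor_coeff f n = (deriv ^^ n) f 0 / fact n"

(* The Hardy space: the functions f(z) = sum a_n z^n holomorphic on the open unit disc with
   sum |a_n|^2 finite.  HOL functions are total, so a function on the disc is represented by
   its extension by 0 to the complex plane; equality in the type is equality on the disc. *)
typedef hardy2 = "{f :: complex \<Rightarrow> complex. f holomorphic_on ball 0 1 \<and>
    (\<forall>z. z \<notin> ball 0 1 \<longrightarrow> f z = 0) \<and> summable (\<lambda>n. (cmod (taylor_coeff f n))\<^sup>2)}"
  morphisms hfun Abs_hardy2
proof
  have "(deriv ^^ n) (\<lambda>z::complex. 0::complex) = (\<lambda>z. 0)" for n
    by (induction n) auto
  then show "(\<lambda>z. 0) \<in> {f :: complex \<Rightarrow> complex. f holomorphic_on ball 0 1 \<and>
    (\<forall>z. z \<notin> ball 0 1 \<longrightarrow> f z = 0) \<and> summable (\<lambda>n. (cmod (taylor_coeff f n))\<^sup>2)}"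
    by (simp add: taylor_coeff_def)
qed

setup_lifting type_definition_hardy2

lemma taylor_coeff_zero [simp]: "taylor_coeff (\<lambda>z. 0) n = 0"
proof -
  have "(deriv ^^ n) (\<lambda>z::complex. 0::complex) = (\<lambda>z. 0)"
    by (induction n) auto
  then show ?thesis by (simp add: taylor_coeff_def)
qed

lemma taylor_coeff_add:
  assumes "f holomorphic_on ball 0 1" "g holomorphic_on ball 0 1"
  shows "taylor_coeff (\<lambda>z. f z + g z) n = taylor_coeff f n + taylor_coeff g n"
  using higher_deriv_add[OF assms, of 0 n] by (simp add: taylor_coeff_def add_divide_distrib)

lemma taylor_coeff_cmult:
  assumes "f holomorphic_on ball 0 1"
  shows "taylor_coeff (\<lambda>z. c * f z) n = c * taylor_coeff f n"
  using higher_deriv_cmult[OF assms, of 0 n c] by (simp add: taylor_coeff_def)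

lemma summable_sq_add:
  fixes a b :: "nat \<Rightarrow> complex"
  assumes "summable (\<lambda>n. (cmod (a n))\<^sup>2)" "summable (\<lambda>n. (cmod (b n))\<^sup>2)"
  shows "summable (\<lambda>n. (cmod (a n + b n))\<^sup>2)"
proof (rule summable_comparison_test')
  show "summable (\<lambda>n. 2 * (cmod (a n))\<^sup>2 + 2 * (cmod (b n))\<^sup>2)"
    using assms by (intro summable_add summable_mult)
  show "norm ((cmod (a n + b n))\<^sup>2) \<le> 2 * (cmod (a n))\<^sup>2 + 2 * (cmod (b n))\<^sup>2" for n
  proof -
    have "(cmod (a n + b n))\<^sup>2 \<le> (cmod (a n) + cmod (b n))\<^sup>2"
      by (intro power_mono norm_triangle_ineq) auto
    also have "\<dots> \<le> 2 * (cmod (a n))\<^sup>2 + 2 * (cmod (b n))\<^sup>2"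
      using sum_squares_bound[of "cmod (a n)" "cmod (b n)"] by (simp add: power2_sum)
    finally show ?thesis by simp
  qed
qed

lemma summable_mult_cnj:
  fixes a b :: "nat \<Rightarrow> complex"
  assumes "summable (\<lambda>n. (cmod (a n))\<^sup>2)" "summable (\<lambda>n. (cmod (b n))\<^sup>2)"
  shows "summable (\<lambda>n. a n * cnj (b n))"
proof (rule summable_comparison_test')
  show "summable (\<lambda>n. (cmod (a n))\<^sup>2 + (cmod (b n))\<^sup>2)"
    using assms by (intro summable_add)
  show "norm (a n * cnj (b n)) \<le> (cmod (a n))\<^sup>2 + (cmod (b n))\<^sup>2" for n
  proof -
    have "2 * (cmod (a n) * cmod (b n)) \<le> (cmod (a n))\<^sup>2 + (cmod (b n))\<^sup>2"
      using sum_squares_bound[of "cmod (a n)" "cmod (b n)"] by simp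
    moreover have "0 \<le> cmod (a n) * cmod (b n)" by simp
    ultimately show ?thesis by (simp only: norm_mult complex_mod_cnj)
  qed
qed

lift_definition hcoeff :: "hardy2 \<Rightarrow> nat \<Rightarrow> complex" is taylor_coeff .

lemma summable_hcoeff: "summable (\<lambda>n. (cmod (hcoeff f n))\<^sup>2)"
  by transfer auto

lemma hcoeff_inject:
  assumes "\<And>n. hcoeff f n = hcoeff g n"
  shows "f = g"
  using assms
proof transfer
  fix f g :: "complex \<Rightarrow> complex"
  assume f: "f holomorphic_on ball 0 1 \<and>
    (\<forall>z. z \<notin> ball 0 1 \<longrightarrow> f z = 0) \<and> summable (\<lambda>n. (cmod (taylor_coeff f n))\<^sup>2)"
  assume g: "g holomorphic_on ball 0 1 \<and>
    (\<forall>z. z \<notin> ball 0 1 \<longrightarrow> g z = 0) \<and> summable (\<lambda>n. (cmod (taylor_coeff g n))\<^sup>2)"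
  assume eq: "\<And>n. taylor_coeff f n = taylor_coeff g n"
  show "f = g"
  proof
    fix z
    show "f z = g z"
    proof (cases "z \<in> ball 0 1")
      case True
      have "(\<lambda>n. taylor_coeff f n * z ^ n) sums f z"
        using holomorphic_power_series[of f 0 1 z] f True by (simp add: taylor_coeff_def)
      moreover have "(\<lambda>n. taylor_coeff g n * z ^ n) sums g z"
        using holomorphic_power_series[of g 0 1 z] g True by (simp add: taylor_coeff_def)
      ultimately show ?thesis using eq sums_unique2 by simp
    qed (use f g in auto)
  qed
qed

lift_definition hscale :: "complex \<Rightarrow> hardy2 \<Rightarrow> hardy2" is "\<lambda>c f z. c * f z"
  by (auto simp: taylor_coeff_cmult norm_mult power_mult_distrib
      intro!: holomorphic_intros summable_mult)

instantiation hardy2 :: ab_group_add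
begin

lift_definition zero_hardy2 :: hardy2 is "\<lambda>z. 0"
  by simp

lift_definition plus_hardy2 :: "hardy2 \<Rightarrow> hardy2 \<Rightarrow> hardy2" is "\<lambda>f g z. f z + g z"
  by (auto simp: taylor_coeff_add intro!: holomorphic_intros summable_sq_add)

definition uminus_hardy2 :: "hardy2 \<Rightarrow> hardy2" where
  "uminus_hardy2 f = hscale (-1) f"

definition minus_hardy2 :: "hardy2 \<Rightarrow> hardy2 \<Rightarrow> hardy2" where
  "minus_hardy2 f g = f + hscale (-1) g"

instance
proof
  fix a b c :: hardy2
  show "a + b + c = a + (b + c)" by transfer (simp add: add.assoc)
  show "a + b = b + a" by transfer (simp add: add.commute)
  show "0 + a = a" by transfer simp
  show "- a + a = 0" unfolding uminus_hardy2_def by transfer simp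
  show "a - b = a + - b" unfolding uminus_hardy2_def minus_hardy2_def ..
qed

end

lemma hcoeff_zero [simp]: "hcoeff 0 n = 0"
  by transfer simp

lemma hcoeff_add [simp]: "hcoeff (f + g) n = hcoeff f n + hcoeff g n"
  by transfer (simp add: taylor_coeff_add)

lemma hcoeff_scale [simp]: "hcoeff (hscale c f) n = c * hcoeff f n"
  by transfer (simp add: taylor_coeff_cmult)

(* Linear algebra over the complex scalars; in particular hardy2.dim is complex dimension. *)
interpretation hardy2: vector_space hscale
  by unfold_locales (transfer; simp add: algebra_simps)+

definition hinner :: "hardy2 \<Rightarrow> hardy2 \<Rightarrow> complex" where
  "hinner f g = (\<Sum>n. hcoeff f n * cnj (hcoeff g n))"

lemma hinner_summable: "summable (\<lambda>n. hcoeff f n * cnj (hcoeff g n))"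
  by (intro summable_mult_cnj summable_hcoeff)

lemma hinner_self: "hinner f f = of_real (\<Sum>n. (cmod (hcoeff f n))\<^sup>2)"
  unfolding hinner_def complex_norm_square[symmetric]
  by (rule suminf_of_real[OF summable_hcoeff, symmetric])

(* The class real_inner provides the norm topology; its real inner product is Re of hinner,
   which induces the same norm. *)
instantiation hardy2 :: real_inner
begin

definition scaleR_hardy2 :: "real \<Rightarrow> hardy2 \<Rightarrow> hardy2" where
  "scaleR_hardy2 r f = hscale (of_real r) f"

definition inner_hardy2 :: "hardy2 \<Rightarrow> hardy2 \<Rightarrow> real" where
  "inner_hardy2 f g = Re (hinner f g)"

definition norm_hardy2 :: "hardy2 \<Rightarrow> real" where
  "norm_hardy2 f = sqrt (\<Sum>n. (cmod (hcoeff f n))\<^sup>2)"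

definition dist_hardy2 :: "hardy2 \<Rightarrow> hardy2 \<Rightarrow> real" where
  "dist_hardy2 f g = norm (f - g)"

definition sgn_hardy2 :: "hardy2 \<Rightarrow> hardy2" where
  "sgn_hardy2 f = scaleR (inverse (norm f)) f"

definition uniformity_hardy2 :: "(hardy2 \<times> hardy2) filter" where
  "uniformity_hardy2 = (INF e\<in>{0<..}. principal {(x, y). dist x y < e})"

definition open_hardy2 :: "hardy2 set \<Rightarrow> bool" where
  "open_hardy2 S = (\<forall>x\<in>S. \<forall>\<^sub>F (x', y) in uniformity. x' = x \<longrightarrow> y \<in> S)"

instance
proof
  fix x y z :: hardy2 and r s :: real and U :: "hardy2 set"
  show "r *\<^sub>R (x + y) = r *\<^sub>R x + r *\<^sub>R y"
    by (simp add: scaleR_hardy2_def hardy2.scale_right_distrib)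
  show "(r + s) *\<^sub>R x = r *\<^sub>R x + s *\<^sub>R x"
    by (simp add: scaleR_hardy2_def hardy2.scale_left_distrib)
  show "r *\<^sub>R s *\<^sub>R x = (r * s) *\<^sub>R x"
    by (simp add: scaleR_hardy2_def)
  show "1 *\<^sub>R x = x"
    by (simp add: scaleR_hardy2_def)
  show "sgn x = scaleR (inverse (norm x)) x"
    by (rule sgn_hardy2_def)
  show "dist x y = norm (x - y)"
    by (rule dist_hardy2_def)
  show "(uniformity :: (hardy2 \<times> hardy2) filter) =
      (INF e\<in>{0<..}. principal {(x, y). dist x y < e})"
    by (rule uniformity_hardy2_def)
  show "open U = (\<forall>x\<in>U. \<forall>\<^sub>F (x', y) in uniformity. x' = x \<longrightarrow> y \<in> U)"
    by (rule open_hardy2_def)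
  show "inner x y = inner y x"
  proof -
    have "cnj (hinner x y) = hinner y x"
      unfolding hinner_def bounded_linear.suminf[OF bounded_linear_cnj hinner_summable]
      by (simp add: mult.commute)
    then have "Re (hinner y x) = Re (hinner x y)" by (metis cnj.simps(1))
    then show ?thesis by (simp add: inner_hardy2_def)
  qed
  show "inner (x + y) z = inner x z + inner y z"
    using suminf_add[OF hinner_summable[of x z] hinner_summable[of y z], symmetric]
    by (simp add: inner_hardy2_def hinner_def ring_distribs)
  show "inner (r *\<^sub>R x) y = r * inner x y"
    using suminf_mult[OF hinner_summable[of x y], of "of_real r"]
    by (simp add: inner_hardy2_def hinner_def scaleR_hardy2_def mult.assoc)
  show "0 \<le> inner x x"
    by (simp add: inner_hardy2_def hinner_self suminf_nonneg summable_hcoeff)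
  show "inner x x = 0 \<longleftrightarrow> x = 0"
  proof
    assume "inner x x = 0"
    then have "(\<Sum>n. (cmod (hcoeff x n))\<^sup>2) = 0"
      by (simp add: inner_hardy2_def hinner_self)
    then have "\<forall>n. (cmod (hcoeff x n))\<^sup>2 = 0"
      using suminf_eq_zero_iff[OF summable_hcoeff] by simp
    then show "x = 0"
      by (intro hcoeff_inject) simp
  qed (simp add: inner_hardy2_def hinner_def)
  show "norm x = sqrt (inner x x)"
    by (simp add: norm_hardy2_def inner_hardy2_def hinner_self)
qed

end

section \<open>Compact operators, singular numbers and Schatten classes\<close>

abbreviation clinear_op :: "(hardy2 \<Rightarrow> hardy2) \<Rightarrow> bool" where
  "clinear_op T \<equiv> Vector_Spaces.linear hscale hscale T"

definition compact_op :: "(hardy2 \<Rightarrow> hardy2) \<Rightarrow> bool" where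
  "compact_op T \<longleftrightarrow> clinear_op T \<and> compact (closure (T ` cball 0 1))"

(* Meaningful for bounded complex-linear T, where existence and uniqueness are the Riesz theorem. *)
definition hadjoint :: "(hardy2 \<Rightarrow> hardy2) \<Rightarrow> hardy2 \<Rightarrow> hardy2" where
  "hadjoint T = (THE S. \<forall>f g. hinner (T f) g = hinner f (S g))"

(* s lists the singular numbers of the compact operator T, i.e. the square roots of the
   eigenvalues of (adjoint T) T, in nonincreasing order with multiplicity, followed by zeros if
   T has finite rank.  Convergence to 0 makes all level sets at positive heights finite, so
   that card is their true cardinality; for compact T the eigenspaces at nonzero eigenvalues
   are finite-dimensional, so that dim is their true dimension. *)
definition singular_numbers :: "(hardy2 \<Rightarrow> hardy2) \<Rightarrow> (nat \<Rightarrow> real) \<Rightarrow> bool" where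
  "singular_numbers T s \<longleftrightarrow> decseq s \<and> s \<longlonglongrightarrow> 0 \<and>
     (\<forall>\<sigma>>0. card {n. s n = \<sigma>} =
        hardy2.dim {f. hadjoint T (T f) = hscale (of_real (\<sigma>\<^sup>2)) f})"

definition schatten_class :: "real \<Rightarrow> (hardy2 \<Rightarrow> hardy2) set" where
  "schatten_class p = {T. compact_op T \<and> (\<exists>s. singular_numbers T s \<and> summable (\<lambda>n. s n powr p))}"

section \<open>Composition operators\<close>

(* By Littlewood's subordination theorem the function passed to Abs_hardy2 is in the Hardy space
   whenever phi is a holomorphic self-map of the disc. *)
definition comp_op :: "(complex \<Rightarrow> complex) \<Rightarrow> hardy2 \<Rightarrow> hardy2" where
  "comp_op \<phi> f = Abs_hardy2 (\<lambda>z. if z \<in> ball 0 1 then hfun f (\<phi> z) else 0)"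

end

theory Submission
  imports Defs "HOL-Real_Asymp.Real_Asymp"
begin

text \<open>
  The symbol is the Cayley transform of a function \<open>\<Psi>(1 - z)\<close>, up to a factor, where
  \<open>\<Psi>(\<zeta>) = \<Sum>l. \<rho>^l \<zeta> / (1 + \<zeta> / t l)\<close> maps the right half-plane to itself. The scales \<open>t l\<close> decrease so
  fast that \<open>\<Psi>(\<zeta>)\<close> is comparable to \<open>\<rho>^l \<zeta>\<close> for \<open>\<bar>\<zeta>\<bar>\<close> between \<open>t (l + 1)\<close> and \<open>t l\<close>, while on the imaginary
  axis its real part falls to about \<open>1 / N l\<close> of its modulus, with \<open>N l = sqrt (t l / t (l + 1))\<close>. Block \<open>l\<close> thus
  contributes, up to logarithms, \<open>N l \<approx> 2^l\<close> singular numbers of size about \<open>\<rho>^(-l/2)\<close>, and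
  \<open>\<rho> = 2^(2/p0)\<close> makes \<open>p0\<close> the critical exponent; the factor \<open>l + 1\<close> in \<open>N l\<close> compensates a logarithmic loss
  in the lower bound.

  Lower bound: the adjoint of the composition operator maps the reproducing kernel at \<open>a\<close> to the one at
  \<open>\<phi> a\<close>. For \<open>2^l + 1\<close> equally spaced points of block \<open>l\<close> both families of kernels are almost
  orthogonal, so the ratio of their norms bounds the singular number of index \<open>2^l\<close> from below.

  Upper bound: let \<open>f \<circ> \<phi>\<close> vanish to high order on a net of the circle away from \<open>1\<close>. Then
  \<open>f \<circ> \<phi>\<close> is negligible there, and its contribution near \<open>1\<close> is controlled by
  Littlewood's subordination principle with base point \<open>1 - t l\<close>.
\<close>

section \<open>Elementary properties of the Hardy space\<close>

text \<open>The two estimates tolerate different losses. For \<open>p > p0\<close> the block sums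
  decay geometrically, so the upper bound may count its conditions up to a polynomial in the block
  index: the size of the net is governed by \<open>N (i + 1)\<close> times the logarithm of
  \<open>1 / t i\<close>, the order of vanishing by the logarithm of
  \<open>N (i + 1) / t (i + 1)\<close>, and these logarithms grow only quadratically in
  \<open>i\<close>. At \<open>p0\<close> nothing may be lost: the singular number of index exactly
  \<open>2^i\<close> must stay above a fixed multiple of \<rho>^(-i/2). The net lies on the unit
  circle itself, so \<open>\<phi>\<close> has to continue across the circle, with modulus below 1,
  around each of its points. This is why the lower bound for the real part of \<open>\<Psi>\<close>
  is proved in a region that reaches slightly beyond the imaginary axis. Since
  \<open>schatten_class\<close> asks for some list of singular numbers, membership rests on a list
  constructed from eigenvectors, and non-membership on the uniqueness of that list.\<close>

lemma hinner_add_left: "hinner (f + g) h = hinner f h + hinner g h"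
  using suminf_add[OF hinner_summable[of f h] hinner_summable[of g h]]
  by (simp add: hinner_def ring_distribs)

lemma hinner_scale_left: "hinner (hscale c f) g = c * hinner f g"
  using suminf_mult[OF hinner_summable[of f g], of c] by (simp add: hinner_def mult.assoc)

lemma hinner_commute: "hinner g f = cnj (hinner f g)"
  unfolding hinner_def bounded_linear.suminf[OF bounded_linear_cnj hinner_summable]
  by (simp add: mult.commute)

lemma hinner_add_right: "hinner f (g + h) = hinner f g + hinner f h"
  by (metis complex_cnj_add hinner_add_left hinner_commute)

lemma hinner_scale_right: "hinner f (hscale c g) = cnj c * hinner f g"
  by (metis complex_cnj_mult hinner_commute hinner_scale_left)

lemma hinner_zero [simp]: "hinner 0 f = 0" "hinner f 0 = 0"
  by (simp_all add: hinner_def)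

lemma hardy2_diff_eq: "f - g = f + hscale (-1) g" for f g :: hardy2
  by (rule minus_hardy2_def)

lemma hcoeff_diff [simp]: "hcoeff (f - g) n = hcoeff f n - hcoeff g n"
  unfolding hardy2_diff_eq hcoeff_add hcoeff_scale by simp

lemma hinner_diff_left: "hinner (f - g) h = hinner f h - hinner g h"
  unfolding hardy2_diff_eq hinner_add_left hinner_scale_left by simp

lemma hinner_diff_right: "hinner f (g - h) = hinner f g - hinner f h"
  unfolding hardy2_diff_eq hinner_add_right hinner_scale_right by simp

lemma hinner_sum_left: "hinner (sum f A) g = (\<Sum>i\<in>A. hinner (f i) g)"
  by (induction A rule: infinite_finite_induct) (simp_all add: hinner_add_left)

lemma hinner_sum_right: "hinner f (sum g A) = (\<Sum>i\<in>A. hinner f (g i))"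
  by (induction A rule: infinite_finite_induct) (simp_all add: hinner_add_right)

lemma norm_hardy2_sq: "(norm f)\<^sup>2 = (\<Sum>n. (cmod (hcoeff f n))\<^sup>2)"
  by (simp add: norm_hardy2_def suminf_nonneg summable_hcoeff)

lemma hinner_self_norm: "hinner f f = of_real ((norm f)\<^sup>2)"
  by (simp add: norm_hardy2_sq hinner_self)

lemma norm_hscale: "norm (hscale c f) = cmod c * norm f"
proof -
  have "(norm (hscale c f))\<^sup>2 = (cmod c * norm f)\<^sup>2"
    using suminf_mult[OF summable_hcoeff[of f], of "(cmod c)\<^sup>2"]
    by (simp add: norm_hardy2_sq power_mult_distrib norm_mult)
  then show ?thesis by (simp add: power2_eq_iff_nonneg)
qed

text \<open>A unimodular factor makes a nonzero complex inner product real and positive; the real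
  Cauchy-Schwarz inequality of the class then applies.\<close>

lemma Cauchy_Schwarz_hinner: "cmod (hinner f g) \<le> norm f * norm g"
proof (cases "hinner f g = 0")
  case False
  define u where "u = cnj (sgn (hinner f g))"
  have u: "cmod u = 1" using False by (simp add: u_def norm_sgn)
  have "hinner (hscale u f) g = of_real (cmod (hinner f g))"
    using False by (simp add: hinner_scale_left u_def sgn_div_norm scaleR_conv_of_real
        complex_norm_square[symmetric] field_simps power2_eq_square)
  then have "cmod (hinner f g) = inner (hscale u f) g"
    by (simp add: inner_hardy2_def)
  also have "\<dots> \<le> norm (hscale u f) * norm g" by (rule norm_cauchy_schwarz)
  finally show ?thesis by (simp add: norm_hscale u)
qed auto

lemma hcoeff_norm_le: "cmod (hcoeff f n) \<le> norm f"
proof -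
  have "(cmod (hcoeff f n))\<^sup>2 \<le> (norm f)\<^sup>2"
    using sum_le_suminf[OF summable_hcoeff[of f], of "{n}"] by (simp add: norm_hardy2_sq)
  then show ?thesis by (simp add: power2_le_iff_abs_le)
qed

lemma norm_hardy2_le:
  assumes "\<And>M. (\<Sum>n<M. (cmod (hcoeff f n))\<^sup>2) \<le> C\<^sup>2" "0 \<le> C"
  shows "norm f \<le> C"
proof -
  have "(norm f)\<^sup>2 \<le> C\<^sup>2"
    unfolding norm_hardy2_sq by (rule suminf_le_const[OF summable_hcoeff]) (use assms in auto)
  then show ?thesis using assms(2) by (simp add: power2_le_iff_abs_le)
qed

section \<open>Realising square-summable sequences as functions on the disc\<close>

lemma summable_powser_of_l2:
  assumes "summable (\<lambda>n. (cmod (a n))\<^sup>2)" "cmod z < 1"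
  shows "summable (\<lambda>n. a n * z ^ n)"
proof -
  have "summable (\<lambda>n. (cmod (cnj (z ^ n)))\<^sup>2)"
    using assms(2) abs_square_less_1[of "cmod z"]
    by (simp add: norm_power power_mult[symmetric] mult.commute[of _ 2])
       (simp add: power_mult)
  from summable_mult_cnj[OF assms(1) this] show ?thesis by simp
qed

lemma conv_radius_of_l2:
  assumes "summable (\<lambda>n. (cmod (a n))\<^sup>2)"
  shows "conv_radius (a :: nat \<Rightarrow> complex) \<ge> 1"
proof (rule conv_radius_geI_ex)
  fix r :: real assume "0 < r" "ereal r < 1"
  then show "\<exists>z. norm z = r \<and> summable (\<lambda>n. a n * z ^ n)"
    by (intro exI[of _ "of_real r"] conjI summable_powser_of_l2 assms) auto
qed

lemma hfun_sums: "cmod z < 1 \<Longrightarrow> (\<lambda>n. hcoeff f n * z ^ n) sums hfun f z"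
proof transfer
  fix f z
  assume *: "f holomorphic_on ball 0 1 \<and>
    (\<forall>z. z \<notin> ball 0 1 \<longrightarrow> f z = 0) \<and> summable (\<lambda>n. (cmod (taylor_coeff f n))\<^sup>2)"
    and "cmod z < 1"
  then show "(\<lambda>n. taylor_coeff f n * z ^ n) sums f z"
    using holomorphic_power_series[of f 0 1 z] by (simp add: taylor_coeff_def)
qed

lemma hfun_holomorphic: "hfun f holomorphic_on ball 0 1"
  using hfun[of f] by auto

text \<open>Riesz-Fischer for the coefficient map: vectors may be specified by their coefficients.
  Monomials, kernels, adjoint vectors and the limit in the compactness proof all arise in this
  way.\<close>

lemma hardy2_of_seq:
  assumes "summable (\<lambda>n. (cmod (a n))\<^sup>2)"
  shows "\<exists>f. hcoeff f = a"
proof -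
  define F where "F = Abs_fps a"
  have rad: "fps_conv_radius F \<ge> 1"
    using conv_radius_of_l2[OF assms] by (simp add: F_def fps_conv_radius_def)
  then have sub: "ball 0 1 \<subseteq> eball 0 (fps_conv_radius F)"
    by (auto simp: in_eball_iff) (metis ereal_less(3) less_le_trans)
  \<comment> \<open>Elements of the type vanish off the disc, so the power series is cut off there;
    near 0 nothing changes, and the derivatives at 0 agree.\<close>
  define g where "g = (\<lambda>z. if z \<in> ball 0 1 then eval_fps F z else 0)"
  have hol: "g holomorphic_on ball 0 1"
    using holomorphic_on_eval_fps[OF sub] by (rule holomorphic_transform) (simp add: g_def)
  have coeff: "taylor_coeff g n = a n" for n
  proof -
    have "(deriv ^^ n) g 0 = (deriv ^^ n) (eval_fps F) 0"
      by (rule higher_deriv_cong_ev)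
         (auto simp: g_def eventually_nhds intro!: exI[of _ "ball 0 1"])
    moreover have "fps_nth F n = (deriv ^^ n) (eval_fps F) 0 / fact n"
      by (rule fps_nth_conv_deriv) (use rad in \<open>auto intro: less_le_trans[of 0 1]\<close>)
    ultimately show ?thesis by (simp add: taylor_coeff_def F_def)
  qed
  have "hfun (Abs_hardy2 g) = g"
    by (rule Abs_hardy2_inverse) (use hol coeff assms in \<open>auto simp: g_def\<close>)
  then have "hcoeff (Abs_hardy2 g) = a"
    using coeff by (auto simp: hcoeff.rep_eq)
  then show ?thesis ..
qed

definition hmon :: "nat \<Rightarrow> hardy2" where
  "hmon k = (SOME f. hcoeff f = (\<lambda>n. if n = k then 1 else 0))"

lemma hcoeff_hmon [simp]: "hcoeff (hmon k) n = (if n = k then 1 else 0)"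
proof -
  have "summable (\<lambda>n. (cmod (if n = k then 1 else 0))\<^sup>2)"
    by (rule summable_finite[of "{k}"]) auto
  from someI_ex[OF hardy2_of_seq[OF this]] show ?thesis
    by (simp add: hmon_def)
qed

lemma hinner_hmon: "hinner f (hmon k) = hcoeff f k"
proof -
  have "hinner f (hmon k) = (\<Sum>n\<in>{k}. hcoeff f n * cnj (hcoeff (hmon k) n))"
    unfolding hinner_def by (rule suminf_finite) auto
  then show ?thesis by simp
qed

text \<open>The Szego kernel at \<open>a\<close>, which reproduces point evaluation by
  \<open>hinner_hker\<close>. Given by its coefficients, it is meaningful for
  \<open>cmod a < 1\<close>, where these are square-summable.\<close>

definition hker :: "complex \<Rightarrow> hardy2" where
  "hker a = (SOME f. hcoeff f = (\<lambda>n. cnj a ^ n))"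

lemma hcoeff_hker:
  assumes "cmod a < 1"
  shows "hcoeff (hker a) n = cnj a ^ n"
proof -
  have "summable (\<lambda>n. (cmod (cnj a ^ n))\<^sup>2)"
    using assms abs_square_less_1[of "cmod a"]
    by (simp add: norm_power power_mult[symmetric] mult.commute[of _ 2])
       (simp add: power_mult)
  from someI_ex[OF hardy2_of_seq[OF this]] show ?thesis
    by (simp add: hker_def)
qed

lemma hinner_hker:
  assumes "cmod a < 1"
  shows "hinner f (hker a) = hfun f a"
  using hfun_sums[OF assms, of f] by (simp add: hinner_def hcoeff_hker[OF assms] sums_iff)

lemma hfun_hker:
  assumes "cmod a < 1" "cmod z < 1"
  shows "hfun (hker a) z = 1 / (1 - cnj a * z)"
proof -
  have "(\<lambda>n. (cnj a * z) ^ n) sums (1 / (1 - cnj a * z))"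
    using assms mult_strict_mono[of "cmod a" 1 "cmod z" 1]
    by (intro geometric_sums) (simp add: norm_mult)
  moreover have "(\<lambda>n. (cnj a * z) ^ n) sums hfun (hker a) z"
    using hfun_sums[OF assms(2), of "hker a"] assms(1)
    by (simp add: hcoeff_hker power_mult_distrib)
  ultimately show ?thesis by (rule sums_unique2[symmetric])
qed

lemma norm_hker_sq:
  assumes "cmod a < 1"
  shows "(norm (hker a))\<^sup>2 = 1 / (1 - (cmod a)\<^sup>2)"
proof -
  have "complex_of_real ((norm (hker a))\<^sup>2) = hfun (hker a) a"
    by (simp only: hinner_self_norm[symmetric] hinner_hker[OF assms])
  also have "\<dots> = of_real (1 / (1 - (cmod a)\<^sup>2))"
    using complex_norm_square[of a] by (simp add: hfun_hker[OF assms assms] mult.commute)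
  finally show ?thesis by (simp only: of_real_eq_iff)
qed

text \<open>Cauchy-Schwarz against the reproducing kernel. Applied at \<open>\<phi> z\<close>, it
  turns a lower bound for 1 - |\<phi> z|^2 into a bound for
  \<open>hfun f (\<phi> z)\<close>.\<close>

lemma hfun_norm_le:
  assumes "cmod z < 1"
  shows "(cmod (hfun f z))\<^sup>2 \<le> (norm f)\<^sup>2 / (1 - (cmod z)\<^sup>2)"
proof -
  have "(cmod (hfun f z))\<^sup>2 \<le> (norm f * norm (hker z))\<^sup>2"
    using Cauchy_Schwarz_hinner[of f "hker z"] hinner_hker[OF assms, of f]
    by (intro power_mono) auto
  then show ?thesis by (simp add: power_mult_distrib norm_hker_sq[OF assms])
qed

text \<open>Gaussian elimination, by induction on the number of equations. If no equation involves
  the last unknown, the last unit vector is a solution; otherwise that unknown is eliminated with a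
  pivot row. This is the dimension count behind both min-max estimates.\<close>

lemma homogeneous_system_nontrivial:
  fixes v :: "nat \<Rightarrow> nat \<Rightarrow> complex"
  shows "\<exists>c. (\<exists>j\<le>k. c j \<noteq> 0) \<and> (\<forall>i<k. (\<Sum>j\<le>k. c j * v i j) = 0)"
proof (induction k arbitrary: v)
  case 0
  show ?case by (rule exI[of _ "\<lambda>_. 1"]) simp
next
  case (Suc k)
  show ?case
  proof (cases "\<exists>i\<le>k. v i (Suc k) \<noteq> 0")
    case True
    then obtain p where p: "p \<le> k" "v p (Suc k) \<noteq> 0" by blast
    \<comment> \<open>\<open>\<sigma>\<close> enumerates the rows other than the pivot
      \<open>p\<close>, and \<open>m\<close> is the system that remains after eliminating the last
      unknown.\<close>
    define \<sigma> where "\<sigma> i = (if i < p then i else Suc i)" for i :: nat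
    define m where "m i j = v (\<sigma> i) j - v (\<sigma> i) (Suc k) / v p (Suc k) * v p j" for i j
    from Suc[of m] obtain c where c: "\<exists>j\<le>k. c j \<noteq> 0" "\<forall>i<k. (\<Sum>j\<le>k. c j * m i j) = 0" by blast
    \<comment> \<open>The value that the pivot row forces on the eliminated unknown.\<close>
    define z where "z = - (\<Sum>j\<le>k. c j * v p j) / v p (Suc k)"
    define d where "d = c(Suc k := z)"
    have dsum: "(\<Sum>j\<le>Suc k. d j * v i j) = (\<Sum>j\<le>k. c j * v i j) + z * v i (Suc k)" for i
      by (simp add: d_def)
    have "(\<Sum>j\<le>Suc k. d j * v i j) = 0" if "i < Suc k" for i
    proof (cases "i = p")
      case True
      then show ?thesis using p unfolding dsum by (simp add: z_def)
    next
      case False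
      define i' where "i' = (if i < p then i else i - 1)"
      have i': "i' < k" "\<sigma> i' = i" using False p that by (auto simp: i'_def \<sigma>_def)
      have "0 = (\<Sum>j\<le>k. c j * m i' j)" using c i' by auto
      also have "\<dots> = (\<Sum>j\<le>k. c j * v i j) - v i (Suc k) / v p (Suc k) * (\<Sum>j\<le>k. c j * v p j)"
        by (simp add: m_def i' right_diff_distrib sum_subtractf sum_distrib_left mult.left_commute)
      finally have "0 = (\<Sum>j\<le>k. c j * v i j) + - (v i (Suc k) / v p (Suc k) * (\<Sum>j\<le>k. c j * v p j))"
        by (simp only: diff_conv_add_uminus)
      moreover have "z * v i (Suc k) = - (v i (Suc k) / v p (Suc k) * (\<Sum>j\<le>k. c j * v p j))"
        by (simp add: z_def)
      ultimately show ?thesis unfolding dsum by (simp only:)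
    qed
    moreover from c(1) obtain j where "j \<le> k" "c j \<noteq> 0" by blast
    then have "j \<le> Suc k \<and> d j \<noteq> 0" by (simp add: d_def)
    ultimately show ?thesis by blast
  next
    case False
    then show ?thesis
      by (intro exI[of _ "\<lambda>j. if j = Suc k then 1 else 0"]) auto
  qed
qed

abbreviation htrunc :: "nat \<Rightarrow> hardy2 \<Rightarrow> hardy2" where
  "htrunc M f \<equiv> (\<Sum>n<M. hscale (hcoeff f n) (hmon n))"

lemma hcoeff_sum: "hcoeff (sum f A) n = (\<Sum>i\<in>A. hcoeff (f i) n)"
  by (induction A rule: infinite_finite_induct) simp_all

lemma hcoeff_comb_hmon:
  "hcoeff (\<Sum>n<M. hscale (c n) (hmon n)) k = (if k < M then c k else 0)"
  by (simp add: hcoeff_sum if_distrib sum.delta cong: if_cong)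

lemma norm_comb_hmon:
  "(norm (\<Sum>n<M. hscale (c n) (hmon n)))\<^sup>2 = (\<Sum>n<M. (cmod (c n))\<^sup>2)"
proof -
  have "(norm (\<Sum>n<M. hscale (c n) (hmon n)))\<^sup>2 = (\<Sum>k\<in>{..<M}. (cmod (if k < M then c k else 0))\<^sup>2)"
    unfolding norm_hardy2_sq hcoeff_comb_hmon by (rule suminf_finite) auto
  then show ?thesis by simp
qed

lemma htrunc_tendsto: "(\<lambda>M. norm (f - htrunc M f)) \<longlonglongrightarrow> 0"
proof -
  have "(norm (f - htrunc M f))\<^sup>2 = (norm f)\<^sup>2 - (\<Sum>n<M. (cmod (hcoeff f n))\<^sup>2)" for M
  proof -
    have *: "hcoeff (f - htrunc M f) k = (if k < M then 0 else hcoeff f k)" for k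
      by (simp only: hcoeff_diff hcoeff_comb_hmon) simp
    have "(\<Sum>n. (cmod (hcoeff (f - htrunc M f) n))\<^sup>2) =
        (\<Sum>n. (cmod (hcoeff (f - htrunc M f) (n + M)))\<^sup>2) + (\<Sum>n<M. (cmod (hcoeff (f - htrunc M f) n))\<^sup>2)"
      by (rule suminf_split_initial_segment[OF summable_hcoeff])
    also have "\<dots> = (\<Sum>n. (cmod (hcoeff f (n + M)))\<^sup>2)" unfolding * by simp
    finally show ?thesis
      unfolding norm_hardy2_sq suminf_split_initial_segment[OF summable_hcoeff[of f], of M] by simp
  qed
  moreover have "(\<lambda>M. (norm f)\<^sup>2 - (\<Sum>n<M. (cmod (hcoeff f n))\<^sup>2)) \<longlonglongrightarrow> (norm f)\<^sup>2 - (norm f)\<^sup>2"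
    unfolding norm_hardy2_sq by (intro tendsto_diff tendsto_const summable_LIMSEQ summable_hcoeff)
  ultimately have "(\<lambda>M. sqrt ((norm (f - htrunc M f))\<^sup>2)) \<longlonglongrightarrow> sqrt 0"
    by (intro tendsto_real_sqrt) simp
  then show ?thesis by simp
qed

lemma clinear_op_simps:
  assumes "clinear_op T"
  shows "T (f + g) = T f + T g" "T (hscale c f) = hscale c (T f)" "T 0 = 0"
    "T (f - g) = T f - T g" "T (sum h A) = (\<Sum>i\<in>A. T (h i))"
proof -
  interpret Vector_Spaces.linear hscale hscale T by fact
  show "T (f + g) = T f + T g" "T (hscale c f) = hscale c (T f)" "T 0 = 0"
    "T (f - g) = T f - T g" "T (sum h A) = (\<Sum>i\<in>A. T (h i))"
    by (rule add scale zero diff sum)+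
qed

lemma compact_op_bounded:
  assumes "compact_op T"
  shows "\<exists>C\<ge>0. \<forall>f. norm (T f) \<le> C * norm f"
proof -
  have lin: "clinear_op T" using assms by (simp add: compact_op_def)
  have "bounded (T ` cball 0 1)"
    using assms compact_imp_bounded bounded_subset closure_subset unfolding compact_op_def by blast
  then obtain C where "\<forall>g\<in>T ` cball 0 1. norm g \<le> C"
    unfolding bounded_iff by blast
  then have C: "norm (T f) \<le> C" if "norm f \<le> 1" for f
    using that by simp
  have "norm (T f) \<le> C * norm f" for f
  proof (cases "f = 0")
    case False
    define z where "z = hscale (of_real (inverse (norm f))) f"
    have "norm z \<le> 1"
      using False by (simp add: z_def norm_hscale del: of_real_inverse)
    moreover have "norm (T z) = inverse (norm f) * norm (T f)"
      unfolding z_def clinear_op_simps[OF lin] norm_hscale by (simp del: of_real_inverse)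
    ultimately have "inverse (norm f) * norm (T f) \<le> C" using C by metis
    then show ?thesis using False by (simp add: field_simps)
  qed (simp add: clinear_op_simps(3)[OF lin])
  moreover have "0 \<le> C" using order_trans[OF norm_ge_zero C[of 0]] by simp
  ultimately show ?thesis by blast
qed

section \<open>Adjoints of bounded operators\<close>

locale bounded_hop =
  fixes T :: "hardy2 \<Rightarrow> hardy2" and C :: real
  assumes lin: "clinear_op T" and C_nonneg: "0 \<le> C" and bound: "norm (T f) \<le> C * norm f"
begin

lemmas T_simps = clinear_op_simps[OF lin]

text \<open>Riesz representation in coordinates: the n-th coefficient of the representing vector has
  to be \<open>hinner g (T (hmon n))\<close>. Boundedness of \<open>T\<close> makes this sequence
  square-summable, and the identity passes from truncations to all \<open>f\<close> by
  continuity.\<close>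

lemma ex_adjoint: "\<exists>S. \<forall>f g. hinner (T f) g = hinner f (S g)"
proof -
  have "\<exists>h. \<forall>f. hinner (T f) g = hinner f h" for g
  proof -
    define a where "a n = hinner g (T (hmon n))" for n
    have comb: "hinner (T (\<Sum>n<M. hscale (c n) (hmon n))) g = (\<Sum>n<M. c n * cnj (a n))" for M c
      by (simp add: T_simps hinner_sum_left hinner_scale_left a_def hinner_commute[symmetric])
    have sum_le: "(\<Sum>n<M. (cmod (a n))\<^sup>2) \<le> (C * norm g)\<^sup>2" for M
    proof -
      \<comment> \<open>Self-testing: \<open>hinner (T h) g\<close> equals the sum that is to be
        bounded, which is also the squared norm of \<open>h\<close>.\<close>
      define h where "h = (\<Sum>n<M. hscale (a n) (hmon n))"
      have h: "(norm h)\<^sup>2 = (\<Sum>n<M. (cmod (a n))\<^sup>2)"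
        unfolding h_def by (rule norm_comb_hmon)
      have "of_real ((norm h)\<^sup>2) = hinner (T h) g"
        unfolding h unfolding h_def comb complex_norm_square[symmetric] by simp
      then have "(norm h)\<^sup>2 \<le> cmod (hinner (T h) g)"
        by (metis abs_ge_self norm_of_real)
      also have "\<dots> \<le> norm (T h) * norm g" by (rule Cauchy_Schwarz_hinner)
      also have "\<dots> \<le> C * norm h * norm g" by (intro mult_right_mono bound) simp
      finally have "norm h * norm h \<le> norm h * (C * norm g)" by (simp add: power2_eq_square mult_ac)
      then have "norm h \<le> C * norm g"
        using C_nonneg by (cases "norm h = 0") (auto simp: mult_le_cancel_left)
      then have "(norm h)\<^sup>2 \<le> (C * norm g)\<^sup>2" by (intro power_mono) auto
      then show ?thesis by (simp add: h)
    qed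
    have "summable (\<lambda>n. (cmod (a n))\<^sup>2)"
      by (rule summableI_nonneg_bounded[OF _ sum_le]) simp
    from hardy2_of_seq[OF this] obtain h where h: "hcoeff h = a" by blast
    have "hinner (T f) g = hinner f h" for f
    proof -
      have "(\<lambda>M. hinner (T (htrunc M f)) g) \<longlonglongrightarrow> hinner f h"
        unfolding comb hinner_def[of f h] h[symmetric] by (intro summable_LIMSEQ hinner_summable)
      moreover have "(\<lambda>M. hinner (T (htrunc M f)) g) \<longlonglongrightarrow> hinner (T f) g"
      proof (rule Lim_transform_bound[where g = "\<lambda>M. C * norm (f - htrunc M f) * norm g", THEN Lim_null[THEN iffD2], rotated])
        show "\<forall>\<^sub>F M in sequentially. norm (hinner (T (htrunc M f)) g - hinner (T f) g)
          \<le> norm (C * norm (f - htrunc M f) * norm g)"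
        proof (intro always_eventually allI)
          fix M
          have "norm (hinner (T (htrunc M f)) g - hinner (T f) g) = cmod (hinner (T (f - htrunc M f)) g)"
            unfolding T_simps(4) hinner_diff_left by (rule norm_minus_commute)
          also have "\<dots> \<le> norm (T (f - htrunc M f)) * norm g" by (rule Cauchy_Schwarz_hinner)
          also have "\<dots> \<le> C * norm (f - htrunc M f) * norm g" by (intro mult_right_mono bound) simp
          finally show "norm (hinner (T (htrunc M f)) g - hinner (T f) g)
            \<le> norm (C * norm (f - htrunc M f) * norm g)" by simp
        qed
        show "(\<lambda>M. C * norm (f - htrunc M f) * norm g) \<longlonglongrightarrow> 0"
          using tendsto_mult[OF tendsto_mult[OF tendsto_const[of C] htrunc_tendsto[of f]] tendsto_const[of "norm g"]]
          by simp
      qed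
      ultimately show ?thesis by (metis LIMSEQ_unique)
    qed
    then show ?thesis by blast
  qed
  then show ?thesis by (metis (full_types))
qed

lemma hinner_eqI: "(\<And>f. hinner f g = hinner f h) \<Longrightarrow> g = h"
  by (metis (no_types, opaque_lifting) hcoeff_inject hinner_commute hinner_hmon)

text \<open>\<open>hadjoint\<close> is a definite description; existence and uniqueness together
  give access to it.\<close>

lemma hinner_adjoint: "hinner (T f) g = hinner f (hadjoint T g)"
proof -
  obtain S where S: "\<forall>f g. hinner (T f) g = hinner f (S g)" using ex_adjoint by blast
  have "hadjoint T = S" unfolding hadjoint_def
  proof (rule the_equality)
    fix S' assume "\<forall>f g. hinner (T f) g = hinner f (S' g)"
    with S show "S' = S" by (intro ext hinner_eqI) metis
  qed (use S in blast)
  with S show ?thesis by blast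
qed

lemma adjoint_linear:
  "hadjoint T (f + g) = hadjoint T f + hadjoint T g"
  "hadjoint T (f - g) = hadjoint T f - hadjoint T g"
  "hadjoint T (hscale c f) = hscale c (hadjoint T f)"
  by (rule hinner_eqI; simp only: hinner_adjoint[symmetric] hinner_add_right hinner_diff_right hinner_scale_right)+

lemma adjoint_zero [simp]: "hadjoint T 0 = 0"
  by (rule hinner_eqI) (simp add: hinner_adjoint[symmetric])

lemma norm_adjoint_le: "norm (hadjoint T g) \<le> C * norm g"
proof -
  let ?h = "hadjoint T g"
  have "(norm ?h)\<^sup>2 = cmod (hinner ?h ?h)" by (simp add: hinner_self_norm norm_power)
  also have "\<dots> = cmod (hinner (T ?h) g)" by (simp add: hinner_adjoint)
  also have "\<dots> \<le> norm (T ?h) * norm g" by (rule Cauchy_Schwarz_hinner)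
  also have "\<dots> \<le> C * norm ?h * norm g" by (intro mult_right_mono bound) simp
  finally have "norm ?h * norm ?h \<le> norm ?h * (C * norm g)" by (simp add: power2_eq_square mult_ac)
  then show ?thesis
    using C_nonneg by (cases "norm ?h = 0") (auto simp: mult_le_cancel_left)
qed

lemma norm_T_sq: "hinner f (hadjoint T (T f)) = of_real ((norm (T f))\<^sup>2)"
  by (simp add: hinner_adjoint[symmetric] hinner_self_norm)

end

text \<open>\<open>v i j\<close> stands for the value of the i-th linear condition on
  \<open>e j\<close>; k conditions leave a unit vector among k + 1 orthonormal directions.\<close>

lemma homogeneous_system_orthonormal:
  fixes v :: "nat \<Rightarrow> nat \<Rightarrow> complex"
  assumes orth: "\<And>i j. i \<le> k \<Longrightarrow> j \<le> k \<Longrightarrow> hinner (e i) (e j) = (if i = j then 1 else 0)"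
  shows "\<exists>c f. f = (\<Sum>j\<le>k. hscale (c j) (e j)) \<and> norm f = 1 \<and> (\<Sum>j\<le>k. (cmod (c j))\<^sup>2) = 1 \<and>
    (\<forall>i<k. (\<Sum>j\<le>k. c j * v i j) = 0)"
proof -
  obtain c where c: "\<exists>j\<le>k. c j \<noteq> 0" "\<forall>i<k. (\<Sum>j\<le>k. c j * v i j) = 0"
    using homogeneous_system_nontrivial by blast
  define S where "S = sqrt (\<Sum>j\<le>k. (cmod (c j))\<^sup>2)"
  from c(1) obtain j where "j \<le> k" "c j \<noteq> 0" by blast
  then have "0 < (\<Sum>j\<le>k. (cmod (c j))\<^sup>2)"
    by (intro sum_pos2[of _ j]) auto
  then have S: "S > 0" "S\<^sup>2 = (\<Sum>j\<le>k. (cmod (c j))\<^sup>2)" by (simp_all add: S_def)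
  define d where "d j = c j / of_real S" for j
  have d: "(\<Sum>j\<le>k. (cmod (d j))\<^sup>2) = 1"
    using S(1) by (simp add: d_def norm_divide power_divide sum_divide_distrib[symmetric] flip: S(2))
  define f where "f = (\<Sum>j\<le>k. hscale (d j) (e j))"
  have "hinner f (e j) = d j" if "j \<le> k" for j
  proof -
    have "hinner f (e j) = (\<Sum>i\<le>k. d i * hinner (e i) (e j))"
      by (simp add: f_def hinner_sum_left hinner_scale_left)
    also have "\<dots> = (\<Sum>i\<le>k. if i = j then d i else 0)"
      using that by (intro sum.cong) (auto simp: orth)
    finally show ?thesis using that by simp
  qed
  moreover have "hinner f f = (\<Sum>j\<le>k. cnj (d j) * hinner f (e j))"
    by (subst (2) f_def) (simp add: hinner_sum_right hinner_scale_right)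
  ultimately have "hinner f f = of_real (\<Sum>j\<le>k. (cmod (d j))\<^sup>2)"
    by (simp add: complex_norm_square mult.commute del: of_real_power)
  then have "(norm f)\<^sup>2 = 1"
    unfolding hinner_self_norm of_real_eq_iff d .
  then have "norm f = 1" by (metis abs_norm_cancel real_sqrt_abs real_sqrt_one)
  moreover have "(\<Sum>j\<le>k. d j * v i j) = 0" if "i < k" for i
    using c(2) that by (simp add: d_def sum_divide_distrib[symmetric])
  ultimately show ?thesis using d f_def by blast
qed

lemma hinner_hmon_hmon: "hinner (hmon i) (hmon j) = (if i = j then 1 else 0)"
  by (simp add: hinner_hmon)

text \<open>Infinite dimension enters here, through the first n + 1 monomials; it keeps the
  recursive choice of eigenvectors going forever.\<close>

lemma exists_unit_orthogonal: fixes n :: nat shows "\<exists>x. norm x = 1 \<and> (\<forall>j<n. hinner x (e j) = 0)"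
proof -
  obtain c :: "nat \<Rightarrow> complex" and f where "f = (\<Sum>j\<le>n. hscale (c j) (hmon j))" "norm f = 1"
    "\<forall>i<n. (\<Sum>j\<le>n. c j * hinner (hmon j) (e i)) = 0"
    using homogeneous_system_orthonormal[of n hmon "\<lambda>i j. hinner (hmon j) (e i)"] hinner_hmon_hmon by blast
  then show ?thesis
    by (intro exI[of _ f]) (simp add: hinner_sum_left hinner_scale_left)
qed

section \<open>Eigenvectors by maximisation\<close>

context bounded_hop begin

lemma bounded_linear_T: "bounded_linear T"
  by (rule bounded_linear_intro[of _ C])
     (simp_all add: T_simps scaleR_hardy2_def bound mult.commute)

lemma bounded_linear_adjoint: "bounded_linear (hadjoint T)"
  by (rule bounded_linear_intro[of _ C])
     (simp_all add: adjoint_linear scaleR_hardy2_def norm_adjoint_le mult.commute)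

lemma hinner_adjoint_T: "hinner (hadjoint T (T f)) g = hinner f (hadjoint T (T g))"
  by (metis hinner_adjoint hinner_commute)

text \<open>The orthogonal complement of the earlier eigenvectors is invariant under the
  self-adjoint operator \<open>hadjoint T\<close> after \<open>T\<close>, and a unit vector
  maximising the norm of \<open>T\<close> on it is again an eigenvector. Compactness of
  \<open>T\<close> makes a subsequence of a maximising sequence converge in norm.\<close>

lemma maximizing_eigenvector:
  fixes n :: nat
  assumes comp: "compact (closure (T ` cball 0 1))"
    and eig: "\<And>j. j < n \<Longrightarrow> hadjoint T (T (e j)) = hscale (l j) (e j)"
  shows "\<exists>x. norm x = 1 \<and> (\<forall>j<n. hinner x (e j) = 0) \<and>
    hadjoint T (T x) = hscale (of_real ((norm (T x))\<^sup>2)) x \<and>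
    (\<forall>y. (\<forall>j<n. hinner y (e j) = 0) \<longrightarrow> norm (T y) \<le> norm (T x) * norm y)"
proof -
  define M where "M = {y. \<forall>j<n. hinner y (e j) = 0}"
  define S where "S = (\<lambda>y. norm (T y)) ` {y \<in> M. norm y = 1}"
  define \<sigma> where "\<sigma> = Sup S"
  obtain x0 where x0: "norm x0 = 1" "x0 \<in> M"
    using exists_unit_orthogonal[of n e] by (auto simp: M_def)
  have S_ne: "S \<noteq> {}" using x0 by (auto simp: S_def)
  have "norm (T y) \<le> C" if "norm y = 1" for y
    using bound[of y] that by simp
  then have bdd: "bdd_above S"
    unfolding S_def by (intro bdd_aboveI2[where M = C]) auto
  have sc: "hscale c y \<in> M" if "y \<in> M" for c y
    using that by (simp add: M_def hinner_scale_left)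
  have \<sigma>: "norm (T y) \<le> \<sigma> * norm y" if "y \<in> M" for y
  proof (cases "y = 0")
    case False
    define z where "z = hscale (of_real (inverse (norm y))) y"
    have "norm z = 1" using False by (simp add: z_def norm_hscale del: of_real_inverse)
    moreover have "z \<in> M" unfolding z_def by (rule sc[OF that])
    ultimately have "norm (T z) \<le> \<sigma>"
      unfolding \<sigma>_def by (intro cSup_upper bdd) (auto simp: S_def)
    moreover have "norm (T z) = inverse (norm y) * norm (T y)"
      unfolding z_def T_simps norm_hscale by (simp del: of_real_inverse)
    ultimately show ?thesis using False by (simp add: field_simps)
  qed (simp add: T_simps)
  have \<sigma>_nonneg: "0 \<le> \<sigma>" using order_trans[OF norm_ge_zero \<sigma>[OF x0(2)]] x0(1) by simp
  define A where "A = (\<lambda>f. hadjoint T (T f))"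
  have A_M: "A x \<in> M" if "x \<in> M" for x
    using that eig by (simp add: M_def A_def hinner_adjoint_T hinner_scale_right)
  have A_le: "norm (A x) \<le> \<sigma>\<^sup>2 * norm x" if "x \<in> M" for x
  proof -
    have "(norm (A x))\<^sup>2 = cmod (hinner (A x) (A x))" by (simp add: hinner_self_norm norm_power)
    also have "\<dots> = cmod (hinner (T (A x)) (T x))" by (simp add: A_def hinner_adjoint)
    also have "\<dots> \<le> norm (T (A x)) * norm (T x)" by (rule Cauchy_Schwarz_hinner)
    also have "\<dots> \<le> (\<sigma> * norm (A x)) * (\<sigma> * norm x)"
      using \<sigma>_nonneg by (intro mult_mono \<sigma> A_M that) auto
    finally have "norm (A x) * norm (A x) \<le> norm (A x) * (\<sigma>\<^sup>2 * norm x)"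
      by (simp add: power2_eq_square mult_ac)
    then show ?thesis
      using \<sigma>_nonneg by (cases "norm (A x) = 0") (auto simp: mult_le_cancel_left)
  qed
  show ?thesis
  proof (cases "\<sigma> = 0")
    \<comment> \<open>Here \<open>T\<close> vanishes on the complement and any unit vector of it
      serves; in this way the list continues when \<open>T\<close> has finite rank.\<close>
    case True
    with \<sigma>[OF x0(2)] have "T x0 = 0" by simp
    moreover have "T y = 0" if "y \<in> M" for y using \<sigma>[OF that] True by simp
    ultimately show ?thesis
      using x0 by (intro exI[of _ x0]) (auto simp: M_def T_simps)
  next
    case False
    with \<sigma>_nonneg have \<sigma>_pos: "0 < \<sigma>" by simp
    have "\<exists>x\<in>M. norm x = 1 \<and> \<sigma> - 1 / Suc k < norm (T x)" for k
    proof -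
      have "\<sigma> - 1 / Suc k < Sup S" by (simp add: \<sigma>_def)
      then obtain u where "u \<in> S" "\<sigma> - 1 / Suc k < u" using less_cSupD[OF S_ne] by blast
      then show ?thesis by (auto simp: S_def)
    qed
    then obtain x where x: "\<And>k. x k \<in> M" "\<And>k. norm (x k) = 1" "\<And>k. \<sigma> - 1 / Suc k < norm (T (x k))"
      by metis
    have "(\<lambda>k. norm (T (x k))) \<longlonglongrightarrow> \<sigma>"
    proof (rule tendsto_sandwich)
      show "\<forall>\<^sub>F k in sequentially. \<sigma> - 1 / Suc k \<le> norm (T (x k))"
        using x(3) less_imp_le by (intro always_eventually) blast
      show "\<forall>\<^sub>F k in sequentially. norm (T (x k)) \<le> \<sigma>"
        using \<sigma>[OF x(1)] x(2) by (intro always_eventually) simp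
      show "(\<lambda>k. \<sigma> - 1 / real (Suc k)) \<longlonglongrightarrow> \<sigma>"
        using tendsto_diff[OF tendsto_const[of \<sigma>] LIMSEQ_inverse_real_of_nat]
        by (simp add: inverse_eq_divide)
    qed simp
    have mem: "\<forall>k. T (x k) \<in> closure (T ` cball 0 1)"
      using x(2) by (intro allI subsetD[OF closure_subset] imageI) simp
    obtain y r where r: "strict_mono r" "((\<lambda>k. T (x k)) \<circ> r) \<longlonglongrightarrow> y"
      using comp[unfolded compact_def, rule_format, of "\<lambda>k. T (x k)"] mem by blast
    define z where "z = x \<circ> r"
    have z: "z k \<in> M" "norm (z k) = 1" for k by (simp_all add: z_def x)
    have Tz: "(\<lambda>k. norm (T (z k))) \<longlonglongrightarrow> \<sigma>"
      using LIMSEQ_subseq_LIMSEQ[OF \<open>(\<lambda>k. norm (T (x k))) \<longlonglongrightarrow> \<sigma>\<close> r(1)] by (simp add: z_def o_def)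
    have Az: "(\<lambda>k. A (z k)) \<longlonglongrightarrow> hadjoint T y"
      using bounded_linear.tendsto[OF bounded_linear_adjoint r(2)] by (simp add: A_def z_def o_def)
    \<comment> \<open>Expand the square and use |A z| <= \<sigma>^2 for unit vectors of the
      complement: the defect in the eigenvalue equation is controlled by how far \<open>z k\<close>
      is from maximising.\<close>
    have dz: "(norm (A (z k) - \<sigma>\<^sup>2 *\<^sub>R z k))\<^sup>2 \<le> 2 * \<sigma> ^ 4 - 2 * \<sigma>\<^sup>2 * (norm (T (z k)))\<^sup>2" for k
    proof -
      have "hinner (A (z k)) (z k) = of_real ((norm (T (z k)))\<^sup>2)"
        unfolding A_def hinner_adjoint_T norm_T_sq ..
      then have "inner (A (z k)) (z k) = (norm (T (z k)))\<^sup>2"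
        by (simp only: inner_hardy2_def Re_complex_of_real)
      then have "inner (A (z k)) (\<sigma>\<^sup>2 *\<^sub>R z k) = \<sigma>\<^sup>2 * (norm (T (z k)))\<^sup>2"
        by simp
      then have "(norm (A (z k) - \<sigma>\<^sup>2 *\<^sub>R z k))\<^sup>2 =
          (norm (A (z k)))\<^sup>2 + (norm (\<sigma>\<^sup>2 *\<^sub>R z k))\<^sup>2 - 2 * (\<sigma>\<^sup>2 * (norm (T (z k)))\<^sup>2)"
        unfolding dot_norm_neg by simp
      moreover have "(norm (A (z k)))\<^sup>2 \<le> (\<sigma>\<^sup>2)\<^sup>2"
        using A_le[OF z(1)[of k]] z(2) by (intro power_mono) auto
      ultimately show ?thesis by (simp add: z(2))
    qed
    have "(\<lambda>k. 2 * \<sigma> ^ 4 - 2 * \<sigma>\<^sup>2 * (norm (T (z k)))\<^sup>2) \<longlonglongrightarrow> 2 * \<sigma> ^ 4 - 2 * \<sigma>\<^sup>2 * \<sigma>\<^sup>2"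
      by (intro tendsto_intros Tz)
    then have "(\<lambda>k. 2 * \<sigma> ^ 4 - 2 * \<sigma>\<^sup>2 * (norm (T (z k)))\<^sup>2) \<longlonglongrightarrow> 0"
      by (simp add: mult.assoc flip: power_add)
    then have "(\<lambda>k. (norm (A (z k) - \<sigma>\<^sup>2 *\<^sub>R z k))\<^sup>2) \<longlonglongrightarrow> 0"
      by (rule tendsto_sandwich[OF _ _ tendsto_const, rotated 2]) (auto intro!: always_eventually dz)
    from tendsto_real_sqrt[OF this] have D: "(\<lambda>k. A (z k) - \<sigma>\<^sup>2 *\<^sub>R z k) \<longlonglongrightarrow> 0"
      by (simp add: tendsto_norm_zero_iff)
    \<comment> \<open>\<open>T (z k)\<close> converges, hence so does \<open>A (z k)\<close>; as the
      defect vanishes, \<open>z k\<close> itself converges to \<open>w\<close>.\<close>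
    define w where "w = (1 / \<sigma>\<^sup>2) *\<^sub>R (hadjoint T y - 0)"
    have "(\<lambda>k. (1 / \<sigma>\<^sup>2) *\<^sub>R (A (z k) - (A (z k) - \<sigma>\<^sup>2 *\<^sub>R z k))) \<longlonglongrightarrow> w"
      unfolding w_def by (intro tendsto_intros Az D)
    then have zw: "z \<longlonglongrightarrow> w" using \<sigma>_pos by simp
    have "norm w = 1"
      using tendsto_norm[OF zw] z(2) by (simp add: LIMSEQ_const_iff)
    moreover have "hinner w (e j) = 0" if "j < n" for j
    proof -
      have "cmod (hinner w (e j)) \<le> norm (z k - w) * norm (e j)" for k
      proof -
        have "hinner w (e j) = hinner (w - z k) (e j)"
          using z(1)[of k] that by (simp add: hinner_diff_left M_def)
        then show ?thesis by (metis Cauchy_Schwarz_hinner norm_minus_commute)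
      qed
      moreover have "(\<lambda>k. norm (z k - w) * norm (e j)) \<longlonglongrightarrow> 0 * norm (e j)"
        using zw by (intro tendsto_mult tendsto_const) (simp add: LIM_zero tendsto_norm_zero)
      ultimately have "cmod (hinner w (e j)) \<le> 0 * norm (e j)"
        by (intro LIMSEQ_le_const) auto
      then show ?thesis by simp
    qed
    moreover have Tw: "norm (T w) = \<sigma>"
      using tendsto_norm[OF bounded_linear.tendsto[OF bounded_linear_T zw]] Tz by (rule LIMSEQ_unique)
    moreover have "hadjoint T (T w) = hscale (of_real (\<sigma>\<^sup>2)) w"
    proof -
      have "(\<lambda>k. A (z k) - \<sigma>\<^sup>2 *\<^sub>R z k) \<longlonglongrightarrow> A w - \<sigma>\<^sup>2 *\<^sub>R w"
        unfolding A_def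
        by (intro tendsto_intros zw bounded_linear.tendsto[OF bounded_linear_adjoint]
            bounded_linear.tendsto[OF bounded_linear_T])
      with D have "A w - \<sigma>\<^sup>2 *\<^sub>R w = 0" by (metis LIMSEQ_unique)
      then show ?thesis by (simp add: A_def scaleR_hardy2_def)
    qed
    ultimately show ?thesis
      using \<sigma> by (intro exI[of _ w]) (auto simp: M_def)
  qed
qed

end

section \<open>Singular systems of compact operators\<close>

text \<open>\<open>e\<close> is an orthonormal sequence of right singular vectors, indexed by all
  naturals even when \<open>T\<close> has finite rank. \<open>maximal\<close> is the extremal
  property from which both min-max estimates follow.\<close>

locale singular_system = bounded_hop +
  fixes e :: "nat \<Rightarrow> hardy2"
  assumes comp: "compact (closure (T ` cball 0 1))"
    and norm_e: "norm (e n) = 1"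
    and orth: "j < n \<Longrightarrow> hinner (e n) (e j) = 0"
    and eig: "hadjoint T (T (e n)) = hscale (of_real ((norm (T (e n)))\<^sup>2)) (e n)"
    and maximal: "(\<And>j. j < n \<Longrightarrow> hinner y (e j) = 0) \<Longrightarrow> norm (T y) \<le> norm (T (e n)) * norm y"

lemma compact_op_singular_system:
  assumes "compact_op T"
  shows "\<exists>C e. singular_system T C e"
proof -
  obtain C where C: "C \<ge> 0" "\<And>f. norm (T f) \<le> C * norm f"
    using compact_op_bounded[OF assms] by blast
  have comp: "compact (closure (T ` cball 0 1))" using assms by (simp add: compact_op_def)
  interpret bounded_hop T C
    by (rule bounded_hop.intro) (use assms C in \<open>auto simp: compact_op_def\<close>)
  define P where "P e n x \<longleftrightarrow> norm x = 1 \<and> (\<forall>j<n. hinner x (e j) = 0) \<and>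
    hadjoint T (T x) = hscale (of_real ((norm (T x))\<^sup>2)) x \<and>
    (\<forall>y. (\<forall>j<n. hinner y (e j) = 0) \<longrightarrow> norm (T y) \<le> norm (T x) * norm y)"
    for e :: "nat \<Rightarrow> hardy2" and n :: nat and x
  have "\<exists>e. \<forall>n. P e n (e n)"
  proof (rule dependent_wellorder_choice)
    fix r and f g :: "nat \<Rightarrow> hardy2" and n :: nat
    assume "\<And>j. j < n \<Longrightarrow> f j = g j"
    then show "P f n r = P g n r" by (simp add: P_def cong: conj_cong)
  next
    fix n and f :: "nat \<Rightarrow> hardy2"
    assume "\<And>j. j < n \<Longrightarrow> P f j (f j)"
    then show "\<exists>x. P f n x"
      unfolding P_def by (intro maximizing_eigenvector[OF comp]) blast
  qed
  then obtain e where e: "\<And>n. P e n (e n)" by blast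
  have "singular_system T C e"
    by (intro singular_system.intro bounded_hop_axioms singular_system_axioms.intro)
       (use e comp in \<open>auto simp: P_def\<close>)
  then show ?thesis by blast
qed

section \<open>Eigenspaces and min-max estimates\<close>

context singular_system begin

definition s :: "nat \<Rightarrow> real" where "s n = norm (T (e n))"

lemma s_nonneg [simp]: "0 \<le> s n" by (simp add: s_def)

lemma eig_s: "hadjoint T (T (e n)) = hscale (of_real ((s n)\<^sup>2)) (e n)"
  unfolding s_def by (rule eig)

lemma hinner_e: "hinner (e m) (e n) = (if m = n then 1 else 0)"
proof (cases m n rule: linorder_cases)
  case less
  then show ?thesis using orth[OF less] hinner_commute[of "e m" "e n"] by simp
qed (simp_all add: hinner_self_norm norm_e orth)

lemma decseq_s: "decseq s"
proof (rule decseq_SucI)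
  show "s (Suc n) \<le> s n" for n
    using maximal[of n "e (Suc n)"] orth[of _ "Suc n"] norm_e[of "Suc n"] by (simp add: s_def)
qed

lemma hinner_Te: "hinner (T (e m)) (T (e n)) = (if m = n then of_real ((s n)\<^sup>2) else 0)"
  by (simp add: hinner_adjoint eig_s hinner_scale_right hinner_e)

text \<open>The vectors \<open>T (e n)\<close> are orthogonal. If their norms stayed above some
  \<open>L > 0\<close>, they would be pairwise at distance at least \<open>L\<close>, against
  compactness.\<close>

lemma s_tendsto_0: "s \<longlonglongrightarrow> 0"
proof -
  obtain L where L: "s \<longlonglongrightarrow> L" "\<And>n. L \<le> s n"
    using decseq_convergent[OF decseq_s, of 0] by auto
  have "L = 0"
  proof (rule ccontr)
    assume "L \<noteq> 0"
    moreover have "0 \<le> L" using L(1) by (rule LIMSEQ_le_const) simp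
    ultimately have "0 < L" by simp
    have far: "L \<le> norm (T (e m) - T (e n))" if "m \<noteq> n" for m n
    proof -
      have "inner (T (e m)) (T (e n)) = 0" using that by (simp add: inner_hardy2_def hinner_Te)
      then have "(norm (T (e m) - T (e n)))\<^sup>2 = (s m)\<^sup>2 + (s n)\<^sup>2"
        unfolding dot_norm_neg by (simp add: s_def)
      moreover have "L\<^sup>2 \<le> (s m)\<^sup>2" using L(2) \<open>0 < L\<close> by (intro power_mono) auto
      ultimately have "L\<^sup>2 \<le> (norm (T (e m) - T (e n)))\<^sup>2"
        using zero_le_power2[of "s n"] by linarith
      then show ?thesis by (simp add: power2_le_iff_abs_le)
    qed
    have "\<forall>k. T (e k) \<in> closure (T ` cball 0 1)"
      using norm_e by (intro allI subsetD[OF closure_subset] imageI) simp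
    then obtain y r where r: "strict_mono r" "((\<lambda>k. T (e k)) \<circ> r) \<longlonglongrightarrow> y"
      using comp[unfolded compact_def, rule_format, of "\<lambda>k. T (e k)"] by blast
    have "Cauchy ((\<lambda>k. T (e k)) \<circ> r)" using r(2) by (rule LIMSEQ_imp_Cauchy)
    from CauchyD[OF this \<open>0 < L\<close>] obtain M where
      "\<forall>m\<ge>M. \<forall>n\<ge>M. norm (((\<lambda>k. T (e k)) \<circ> r) m - ((\<lambda>k. T (e k)) \<circ> r) n) < L" by blast
    from this[rule_format, of M "Suc M"] have "norm (T (e (r M)) - T (e (r (Suc M)))) < L" by simp
    moreover have "r M \<noteq> r (Suc M)" using r(1) by (auto simp: strict_mono_eq)
    ultimately show False using far[of "r M" "r (Suc M)"] by linarith
  qed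
  with L show ?thesis by simp
qed

text \<open>Maximality bounds the norm of \<open>T f\<close> by \<open>s n * norm f\<close> for
  every n. This does the work of completeness of the system \<open>e\<close>.\<close>

lemma T_eq_0:
  assumes "\<And>n. hinner f (e n) = 0"
  shows "T f = 0"
proof -
  have "norm (T f) \<le> s n * norm f" for n
    unfolding s_def using assms by (intro maximal)
  moreover have "(\<lambda>n. s n * norm f) \<longlonglongrightarrow> 0 * norm f"
    by (intro tendsto_mult s_tendsto_0 tendsto_const)
  ultimately have "norm (T f) \<le> 0 * norm f"
    by (intro LIMSEQ_le_const) auto
  then show ?thesis by simp
qed

lemma inj_e: "inj e"
  by (rule injI) (metis hinner_e zero_neq_one)

lemma finite_level: "\<sigma> > 0 \<Longrightarrow> finite {n. \<sigma> \<le> s n}"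
  using order_tendstoD(2)[OF s_tendsto_0, of \<sigma>]
  by (auto simp: eventually_sequentially not_le intro!: finite_subset[of _ "{..<_}"])

text \<open>Subtract from an eigenvector its projection on the \<open>e n\<close> with
  \<open>s n = \<sigma>\<close>. The remainder is orthogonal to every \<open>e m\<close>, for
  \<open>s m \<noteq> \<sigma>\<close> because eigenspaces of a self-adjoint operator are
  orthogonal. So \<open>T\<close> annihilates it, while it still belongs to the eigenvalue
  \<sigma>^2 > 0; hence it is zero.\<close>

lemma dim_eigenspace:
  assumes "\<sigma> > 0"
  shows "hardy2.dim {f. hadjoint T (T f) = hscale (of_real (\<sigma>\<^sup>2)) f} = card {n. s n = \<sigma>}"
proof -
  define N where "N = {n. s n = \<sigma>}"
  define V where "V = {f. hadjoint T (T f) = hscale (of_real (\<sigma>\<^sup>2)) f}"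
  have fin: "finite N"
    by (rule finite_subset[OF _ finite_level[OF assms]]) (auto simp: N_def)
  have "hardy2.dim V = card (e ` N)"
  proof (rule hardy2.dim_unique)
    show "e ` N \<subseteq> V" by (auto simp: N_def V_def eig_s)
    show "hardy2.independent (e ` N)"
      unfolding hardy2.independent_explicit_module
    proof (intro allI impI)
      fix A u x assume *: "finite A" "A \<subseteq> e ` N" "(\<Sum>v\<in>A. hscale (u v) v) = 0" "x \<in> A"
      have "0 = hinner (\<Sum>v\<in>A. hscale (u v) v) x" using * by simp
      also have "\<dots> = (\<Sum>v\<in>A. u v * hinner v x)" by (simp add: hinner_sum_left hinner_scale_left)
      also have "\<dots> = (\<Sum>v\<in>A. if v = x then u v else 0)"
      proof (intro sum.cong refl)
        fix v assume "v \<in> A"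
        with *(2,4) obtain i j where "v = e i" "x = e j" by blast
        then show "u v * hinner v x = (if v = x then u v else 0)"
          using inj_e by (simp add: hinner_e inj_eq)
      qed
      finally show "u x = 0" using *(1,4) by simp
    qed
    show "V \<subseteq> hardy2.span (e ` N)"
    proof
      fix f assume f: "f \<in> V"
      define g where "g = f - (\<Sum>n\<in>N. hscale (hinner f (e n)) (e n))"
      have "hinner g (e m) = 0" for m
      proof (cases "m \<in> N")
        case True
        have "(\<Sum>n\<in>N. hinner f (e n) * hinner (e n) (e m)) = (\<Sum>n\<in>N. if n = m then hinner f (e n) else 0)"
          by (intro sum.cong refl) (auto simp: hinner_e)
        then show ?thesis
          using True fin by (simp add: g_def hinner_diff_left hinner_sum_left hinner_scale_left)
      next
        case False
        have "of_real (\<sigma>\<^sup>2) * hinner f (e m) = of_real ((s m)\<^sup>2) * hinner f (e m)"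
          using f hinner_adjoint_T[of f "e m"]
          unfolding V_def eig_s hinner_scale_right by (simp add: hinner_scale_left)
        moreover have "\<sigma>\<^sup>2 \<noteq> (s m)\<^sup>2"
          using False assms by (auto simp: N_def power2_eq_iff_nonneg)
        ultimately have "hinner f (e m) = 0"
          by (metis mult_cancel_right of_real_eq_iff)
        moreover have "(\<Sum>n\<in>N. hinner f (e n) * hinner (e n) (e m)) = 0"
          using False by (intro sum.neutral) (auto simp: hinner_e)
        ultimately show ?thesis
          by (simp add: g_def hinner_diff_left hinner_sum_left hinner_scale_left)
      qed
      then have "T g = 0" by (rule T_eq_0)
      moreover have "hardy2.subspace V"
        unfolding V_def by (rule hardy2.subspaceI)
          (simp_all add: T_simps adjoint_linear hardy2.scale_right_distrib mult.commute)
      then have "g \<in> V" unfolding g_def using f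
        by (intro hardy2.subspace_diff hardy2.subspace_sum hardy2.subspace_scale)
           (auto simp: N_def V_def eig_s)
      ultimately have "hscale (of_real (\<sigma>\<^sup>2)) g = 0" by (simp add: V_def)
      then have "g = 0" using assms by simp
      then have "f = (\<Sum>n\<in>N. hscale (hinner f (e n)) (e n))" by (simp add: g_def)
      then show "f \<in> hardy2.span (e ` N)"
        by (metis (no_types, lifting) hardy2.span_base hardy2.span_scale hardy2.span_sum imageI)
    qed
  qed simp
  then show ?thesis
    using inj_e by (simp add: N_def V_def card_image inj_on_subset[OF inj_e])
qed

lemma singular_numbers_s: "singular_numbers T s"
  unfolding singular_numbers_def
proof (intro conjI allI impI)
  show "decseq s" by (rule decseq_s)
  show "s \<longlonglongrightarrow> 0" by (rule s_tendsto_0)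
  fix \<sigma> :: real assume "0 < \<sigma>"
  from dim_eigenspace[OF this, symmetric]
  show "card {n. s n = \<sigma>} = hardy2.dim {f. hadjoint T (T f) = hscale (of_real (\<sigma>\<^sup>2)) f}" .
qed

text \<open>One half of Courant-Fischer: some unit combination f of \<open>e 0\<close>, ...,
  \<open>e k\<close> satisfies the k conditions, and there |T f| >= s k. Linearity is asked on such
  combinations, which suits the later conditions: derivatives of
  \<open>hfun f \<circ> \<phi>\<close> at boundary points.\<close>

lemma s_le:
  fixes v :: "nat \<Rightarrow> hardy2 \<Rightarrow> complex" and D :: real
  assumes "D \<ge> 0"
    and lin: "\<And>i (c :: nat \<Rightarrow> complex). i < k \<Longrightarrow> v i (\<Sum>j\<le>k. hscale (c j) (e j)) = (\<Sum>j\<le>k. c j * v i (e j))"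
    and le: "\<And>f. (\<And>i. i < k \<Longrightarrow> v i f = 0) \<Longrightarrow> norm (T f) \<le> D * norm f"
  shows "s k \<le> D"
proof -
  obtain c :: "nat \<Rightarrow> complex" and f where f: "f = (\<Sum>j\<le>k. hscale (c j) (e j))" "norm f = 1"
    "(\<Sum>j\<le>k. (cmod (c j))\<^sup>2) = 1" "\<And>i. i < k \<Longrightarrow> (\<Sum>j\<le>k. c j * v i (e j)) = 0"
    using homogeneous_system_orthonormal[of k e "\<lambda>i j. v i (e j)", OF hinner_e] by blast
  have "norm (T f) \<le> D" using le[of f] lin f by simp
  have "hinner (T f) (T (e j)) = c j * of_real ((s j)\<^sup>2)" if "j \<le> k" for j
  proof -
    have "hinner (T f) (T (e j)) = (\<Sum>i\<le>k. c i * hinner (T (e i)) (T (e j)))"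
      by (simp add: f(1) T_simps hinner_sum_left hinner_scale_left)
    also have "\<dots> = (\<Sum>i\<le>k. if i = j then c i * of_real ((s j)\<^sup>2) else 0)"
      by (intro sum.cong refl) (auto simp: hinner_Te)
    finally show ?thesis using that by simp
  qed
  moreover have "hinner (T f) (T f) = (\<Sum>j\<le>k. cnj (c j) * hinner (T f) (T (e j)))"
    by (subst (2) f(1)) (simp add: T_simps hinner_sum_right hinner_scale_right)
  ultimately have "complex_of_real ((norm (T f))\<^sup>2) = of_real (\<Sum>j\<le>k. (cmod (c j))\<^sup>2 * (s j)\<^sup>2)"
    unfolding hinner_self_norm by (simp add: complex_norm_square mult_ac del: of_real_power)
  then have "(norm (T f))\<^sup>2 = (\<Sum>j\<le>k. (cmod (c j))\<^sup>2 * (s j)\<^sup>2)" by (simp only: of_real_eq_iff)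
  also have "\<dots> \<ge> (\<Sum>j\<le>k. (cmod (c j))\<^sup>2 * (s k)\<^sup>2)"
    using decseqD[OF decseq_s] by (intro sum_mono mult_left_mono power_mono) auto
  also have "(\<Sum>j\<le>k. (cmod (c j))\<^sup>2 * (s k)\<^sup>2) = (s k)\<^sup>2"
    using f(3) by (simp add: sum_distrib_right[symmetric])
  finally have "s k \<le> norm (T f)" by (simp add: power2_le_iff_abs_le)
  with \<open>norm (T f) \<le> D\<close> show ?thesis by simp
qed

text \<open>The other half, phrased with the adjoint because that is the operator which acts simply
  on kernels. Some nonzero \<open>h\<close> in the span has \<open>f = hadjoint T h\<close>
  orthogonal to the first n vectors \<open>e i\<close>; then |T f| <= s n |f|, and |f|^2 = <T f, h>
  compares |f| with |h|.\<close>

lemma s_ge: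
  fixes g :: "nat \<Rightarrow> hardy2" and D :: real
  assumes nz: "\<And>c :: nat \<Rightarrow> complex. (\<exists>j\<le>n. c j \<noteq> 0) \<Longrightarrow> (\<Sum>j\<le>n. hscale (c j) (g j)) \<noteq> 0"
    and ge: "\<And>c. D * norm (\<Sum>j\<le>n. hscale (c j) (g j)) \<le> norm (hadjoint T (\<Sum>j\<le>n. hscale (c j) (g j)))"
  shows "D \<le> s n"
proof -
  obtain c where c: "\<exists>j\<le>n. c j \<noteq> 0" "\<forall>i<n. (\<Sum>j\<le>n. c j * hinner (g j) (T (e i))) = 0"
    using homogeneous_system_nontrivial[of n "\<lambda>i j. hinner (g j) (T (e i))"] by blast
  define h where "h = (\<Sum>j\<le>n. hscale (c j) (g j))"
  have "h \<noteq> 0" unfolding h_def by (rule nz[OF c(1)])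
  define f where "f = hadjoint T h"
  have "hinner f (e i) = 0" if "i < n" for i
  proof -
    have "hinner (e i) f = hinner (T (e i)) h" by (simp add: f_def hinner_adjoint)
    also have "\<dots> = cnj (\<Sum>j\<le>n. c j * hinner (g j) (T (e i)))"
      unfolding h_def
      by (simp add: hinner_sum_right hinner_scale_right hinner_commute[symmetric] cong: sum.cong)
    finally show ?thesis using c(2) that hinner_commute[of "e i" f] by simp
  qed
  then have "norm (T f) \<le> s n * norm f" unfolding s_def by (intro maximal)
  have "(norm f)\<^sup>2 = cmod (hinner f f)" by (simp add: hinner_self_norm norm_power)
  also have "\<dots> = cmod (hinner (T f) h)" by (simp add: f_def hinner_adjoint)
  also have "\<dots> \<le> norm (T f) * norm h" by (rule Cauchy_Schwarz_hinner)
  also have "\<dots> \<le> (s n * norm f) * norm h" by (intro mult_right_mono) (use \<open>norm (T f) \<le> _\<close> in auto)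
  finally have "norm f * norm f \<le> norm f * (s n * norm h)" by (simp add: power2_eq_square mult_ac)
  then have "norm f \<le> s n * norm h" by (cases "norm f = 0") (auto simp: mult_le_cancel_left)
  with ge[of c] have "D * norm h \<le> s n * norm h" by (simp add: f_def h_def)
  then show ?thesis using \<open>h \<noteq> 0\<close> by simp
qed

end

section \<open>Uniqueness of the list of singular numbers\<close>

lemma decseq_tendsto_0_level:
  fixes s :: "nat \<Rightarrow> real"
  assumes "decseq s" "s \<longlonglongrightarrow> 0" "\<sigma> > 0"
  shows "finite {n. \<sigma> \<le> s n}" "\<sigma> \<le> s n \<longleftrightarrow> n < card {n. \<sigma> \<le> s n}"
proof -
  obtain M where M: "\<And>n. n \<ge> M \<Longrightarrow> s n < \<sigma>"
    using order_tendstoD(2)[OF assms(2,3)] by (auto simp: eventually_sequentially)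
  define m where "m = (LEAST n. s n < \<sigma>)"
  have "s m < \<sigma>" unfolding m_def by (rule LeastI[of _ M]) (simp add: M)
  then have "s n < \<sigma>" if "m \<le> n" for n
    using decseqD[OF assms(1) that] by linarith
  moreover have "\<sigma> \<le> s n" if "n < m" for n
    using not_less_Least[of n "\<lambda>n. s n < \<sigma>"] that by (simp add: m_def)
  ultimately have *: "\<sigma> \<le> s n \<longleftrightarrow> n < m" for n
    by (meson not_le)
  then have eq: "{n. \<sigma> \<le> s n} = {..<m}" by auto
  show "finite {n. \<sigma> \<le> s n}" "\<sigma> \<le> s n \<longleftrightarrow> n < card {n. \<sigma> \<le> s n}"
    unfolding eq by (simp_all add: *)
qed

text \<open>A nonincreasing null sequence is determined by the sizes of its superlevel sets at
  positive heights, and each such size is a finite sum of eigenspace dimensions, which depend on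
  \<open>T\<close> alone.\<close>

lemma singular_numbers_unique:
  assumes s: "singular_numbers T s" and s': "singular_numbers T s'"
  shows "s = s'"
proof -
  have card_le: "card {n. \<sigma> \<le> s n} = card {n. \<sigma> \<le> s' n}" if "\<sigma> > 0" for \<sigma>
  proof -
    have fin: "finite {n. \<sigma> \<le> s n}" "finite {n. \<sigma> \<le> s' n}"
      using s s' that by (auto simp: singular_numbers_def intro!: decseq_tendsto_0_level)
    \<comment> \<open>All values at least \<sigma> of either sequence, so that both counts become
      sums over the same index set.\<close>
    define V where "V = s ` {n. \<sigma> \<le> s n} \<union> s' ` {n. \<sigma> \<le> s' n}"
    have V: "finite V" "\<And>\<tau>. \<tau> \<in> V \<Longrightarrow> \<sigma> \<le> \<tau>" using fin by (auto simp: V_def)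
    have card_sum: "card {n. \<sigma> \<le> u n} = (\<Sum>\<tau>\<in>V. card {n. u n = \<tau>})"
      if "finite {n. \<sigma> \<le> u n}" "u ` {n. \<sigma> \<le> u n} \<subseteq> V" for u :: "nat \<Rightarrow> real"
    proof -
      have "{n. \<sigma> \<le> u n} = (\<Union>\<tau>\<in>V. {n. u n = \<tau>})" using that V(2) by auto
      moreover have "finite {n. u n = \<tau>}" if "\<tau> \<in> V" for \<tau>
        by (rule finite_subset[OF _ \<open>finite {n. \<sigma> \<le> u n}\<close>]) (use V(2) that in auto)
      ultimately show ?thesis using V(1) by (simp, subst card_UN_disjoint) auto
    qed
    have "card {n. s n = \<tau>} = card {n. s' n = \<tau>}" if "\<tau> \<in> V" for \<tau>
    proof -
      have "\<tau> > 0" using V(2)[OF that] \<open>\<sigma> > 0\<close> by linarith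
      with s s' show ?thesis unfolding singular_numbers_def by (elim conjE allE[of _ \<tau>]) simp
    qed
    then have "(\<Sum>\<tau>\<in>V. card {n. s n = \<tau>}) = (\<Sum>\<tau>\<in>V. card {n. s' n = \<tau>})"
      by (rule sum.cong[OF refl])
    moreover have "s ` {n. \<sigma> \<le> s n} \<subseteq> V" "s' ` {n. \<sigma> \<le> s' n} \<subseteq> V"
      by (auto simp: V_def)
    ultimately show ?thesis using card_sum[OF fin(1)] card_sum[OF fin(2)] by metis
  qed
  have le: "u n \<le> u' n" if u: "decseq u" "u \<longlonglongrightarrow> 0" "decseq u'" "u' \<longlonglongrightarrow> 0"
    and eq: "\<And>\<sigma>. \<sigma> > 0 \<Longrightarrow> card {n. \<sigma> \<le> u n} = card {n. \<sigma> \<le> u' n}" for u u' :: "nat \<Rightarrow> real" and n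
  proof (cases "u n > 0")
    case True
    have "n < card {k. u n \<le> u k}"
      by (rule iffD1[OF decseq_tendsto_0_level(2)[OF u(1,2) True] order_refl])
    then show ?thesis
      unfolding eq[OF True] by (rule iffD2[OF decseq_tendsto_0_level(2)[OF u(3,4) True]])
  next
    case False
    moreover have "0 \<le> u' n"
      using decseqD[OF u(3)] by (intro LIMSEQ_le_const2[OF u(4)]) auto
    ultimately show ?thesis by simp
  qed
  have "decseq s" "s \<longlonglongrightarrow> 0" "decseq s'" "s' \<longlonglongrightarrow> 0"
    using s s' by (simp_all add: singular_numbers_def)
  then have "s n \<le> s' n" "s' n \<le> s n" for n
    using le[of s s' n] le[of s' s n] card_le by simp_all
  then show ?thesis by (intro ext antisym)
qed

section \<open>Means over circles\<close>

definition circ_mean :: "real \<Rightarrow> (complex \<Rightarrow> 'a :: euclidean_space) \<Rightarrow> 'a" where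
  "circ_mean r u = integral {0..1} (\<lambda>t. u (circlepath 0 r t))"

lemma norm_circlepath: "0 \<le> r \<Longrightarrow> cmod (circlepath 0 r t) = r"
  by (simp add: circlepath norm_mult)

lemma continuous_on_circlepath [continuous_intros]: "continuous_on X (circlepath z r)"
  unfolding circlepath by (intro continuous_intros)

lemma circ_integrable:
  fixes u :: "complex \<Rightarrow> 'a :: euclidean_space"
  assumes "continuous_on (sphere 0 r) u" "0 \<le> r"
  shows "(\<lambda>t. u (circlepath 0 r t)) integrable_on {0..1}"
proof (rule integrable_continuous_interval)
  show "continuous_on {0..1} (\<lambda>t. u (circlepath 0 r t))"
    by (rule continuous_on_compose2[OF assms(1) continuous_on_circlepath])
       (use assms(2) in \<open>auto simp: norm_circlepath\<close>)
qed

lemma circ_mean_mono: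
  fixes u v :: "complex \<Rightarrow> real"
  assumes "continuous_on (sphere 0 r) u" "continuous_on (sphere 0 r) v" "0 \<le> r"
    and "\<And>z. cmod z = r \<Longrightarrow> u z \<le> v z"
  shows "circ_mean r u \<le> circ_mean r v"
  unfolding circ_mean_def
  by (intro integral_le circ_integrable assms) (use assms(3) in \<open>simp add: norm_circlepath\<close>)

lemma circ_mean_add:
  assumes "continuous_on (sphere 0 r) u" "continuous_on (sphere 0 r) v" "0 \<le> r"
  shows "circ_mean r (\<lambda>z. u z + v z) = circ_mean r u + circ_mean r v"
  unfolding circ_mean_def by (intro integral_add circ_integrable assms)

lemma circ_mean_const [simp]: "circ_mean r (\<lambda>_. c) = c"
  by (simp add: circ_mean_def)

lemma circ_mean_cmult: "circ_mean r (\<lambda>z. c * u z) = c * circ_mean r u" for c :: real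
  by (simp add: circ_mean_def)

lemma circ_mean_mult_complex: "circ_mean r (\<lambda>z. c * u z) = c * circ_mean r u" for c :: complex
  by (simp add: circ_mean_def)

lemma Re_circ_mean:
  assumes "continuous_on (sphere 0 r) u" "0 \<le> r"
  shows "Re (circ_mean r u) = circ_mean r (\<lambda>z. Re (u z))"
proof -
  have "((\<lambda>t. u (circlepath 0 r t)) has_integral circ_mean r u) {0..1}"
    unfolding circ_mean_def by (intro integrable_integral circ_integrable assms)
  from has_integral_linear[OF this bounded_linear_Re] show ?thesis
    by (simp add: circ_mean_def o_def integral_unique)
qed

text \<open>\<open>u\<close> has to agree with \<open>G\<close> on the circle only, which admits
  integrands containing \<open>cnj z\<close>.\<close>

lemma circ_mean_eqI:
  assumes "((\<lambda>z. G z / z) has_contour_integral (2 * of_real pi * \<i> * m)) (circlepath 0 r)" "r > 0"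
    and "\<And>z. cmod z = r \<Longrightarrow> u z = G z"
  shows "circ_mean r u = m"
proof -
  have "((\<lambda>x. G (circlepath 0 r x) / circlepath 0 r x * vector_derivative (circlepath 0 r) (at x))
      has_integral 2 * of_real pi * \<i> * m) {0..1}"
    using assms(1) unfolding has_contour_integral .
  moreover have "G (circlepath 0 r x) / circlepath 0 r x * vector_derivative (circlepath 0 r) (at x) =
      (2 * of_real pi * \<i>) * u (circlepath 0 r x)" for x
    using assms(2) assms(3)[of "circlepath 0 r x"] norm_circlepath[of r x]
    by (simp add: vector_derivative_circlepath) (simp add: circlepath)
  ultimately have "((\<lambda>x. (2 * of_real pi * \<i>) * u (circlepath 0 r x)) has_integral 2 * of_real pi * \<i> * m) {0..1}"
    by simp
  from has_integral_mult_right[OF this, of "1 / (2 * of_real pi * \<i>)"]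
  have "((\<lambda>x. u (circlepath 0 r x)) has_integral m) {0..1}" by simp
  then show ?thesis by (simp add: circ_mean_def integral_unique)
qed

lemma cnj_on_circle: "cmod z = r \<Longrightarrow> r > 0 \<Longrightarrow> cnj z = of_real (r\<^sup>2) / z"
  using complex_norm_square[of z] by (auto simp: field_simps)

text \<open>On the circle, \<open>1 / (1 - a * cnj z) = z / (z - a * r\<^sup>2)\<close>, which turns the mean into a Cauchy integral.\<close>

lemma circ_mean_Cauchy:
  assumes "F holomorphic_on ball 0 1" "0 < r" "r < 1" "0 \<le> a" "a \<le> 1"
  shows "circ_mean r (\<lambda>z. F z / (1 - of_real a * cnj z)) = F (of_real (a * r\<^sup>2))"
proof (rule circ_mean_eqI[where G = "\<lambda>z. F z * (z / (z - of_real (a * r\<^sup>2)))"])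
  let ?w = "of_real (a * r\<^sup>2) :: complex"
  have ar: "a * r\<^sup>2 < r"
  proof -
    have "a * r\<^sup>2 \<le> 1 * r\<^sup>2" using assms by (intro mult_right_mono) auto
    also have "\<dots> < r" using assms by (simp add: power2_eq_square)
    finally show ?thesis .
  qed
  have w: "cmod ?w < r" using ar assms by (simp only: norm_of_real) simp
  have sub: "cball 0 r \<subseteq> ball (0::complex) 1" using assms by auto
  have "((\<lambda>z. F z / (z - ?w)) has_contour_integral (2 * of_real pi * \<i> * F ?w)) (circlepath 0 r)"
    using sub w ball_subset_cball[of 0 r]
    by (intro Cauchy_integral_circlepath holomorphic_on_imp_continuous_on holomorphic_on_subset[OF assms(1)]) auto
  then show "((\<lambda>z. F z * (z / (z - ?w)) / z) has_contour_integral (2 * of_real pi * \<i> * F ?w)) (circlepath 0 r)"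
    by (rule has_contour_integral_eq) (use assms in auto)
  show "r > 0" by fact
  fix z :: complex assume z: "cmod z = r"
  then have "z \<noteq> 0" using assms by auto
  moreover have "z \<noteq> ?w" using w z by auto
  ultimately show "F z / (1 - of_real a * cnj z) = F z * (z / (z - ?w))"
    unfolding cnj_on_circle[OF z \<open>r > 0\<close>] by (simp add: field_simps)
qed

text \<open>On the circle \<open>cnj z ^ n = r ^ (2 * n) / z ^ n\<close>, so this is Cauchy's
  formula for the n-th derivative.\<close>

lemma circ_mean_coeff:
  assumes "g holomorphic_on ball 0 1" "0 < r" "r < 1"
  shows "circ_mean r (\<lambda>z. g z * cnj z ^ n) = of_real (r ^ (2 * n)) * taylor_coeff g n"
proof (rule circ_mean_eqI[where G = "\<lambda>z. of_real (r ^ (2 * n)) * (g z / z ^ n)"])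
  have sub: "cball 0 r \<subseteq> ball (0::complex) 1" using assms by auto
  have "((\<lambda>u. g u / (u - 0) ^ (Suc n)) has_contour_integral ((2 * pi * \<i>) / (fact n) * (deriv ^^ n) g 0))
           (circlepath 0 r)"
    using assms(2) sub ball_subset_cball[of 0 r]
    by (intro Cauchy_has_contour_integral_higher_derivative_circlepath holomorphic_on_imp_continuous_on
        holomorphic_on_subset[OF assms(1)]) auto
  from has_contour_integral_lmul[OF this, of "of_real (r ^ (2 * n))"]
  show "((\<lambda>z. of_real (r ^ (2 * n)) * (g z / z ^ n) / z) has_contour_integral
      (2 * of_real pi * \<i> * (of_real (r ^ (2 * n)) * taylor_coeff g n))) (circlepath 0 r)"
    by (simp add: taylor_coeff_def mult_ac)
  show "r > 0" by fact
  show "g z * cnj z ^ n = of_real (r ^ (2 * n)) * (g z / z ^ n)" if "cmod z = r" for z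
    unfolding cnj_on_circle[OF that \<open>r > 0\<close>] by (simp add: power_divide power_mult)
qed

text \<open>Take the mean of |g - h|^2 >= 0, where \<open>h\<close> consists of the first M Taylor
  terms of \<open>g\<close>: the mixed mean and the mean of |h|^2 both equal the left-hand
  sum.\<close>

lemma Bessel_circ_mean:
  assumes g: "g holomorphic_on ball 0 1" and r: "0 < r" "r < 1"
  shows "(\<Sum>n<M. (cmod (taylor_coeff g n))\<^sup>2 * r ^ (2 * n)) \<le> circ_mean r (\<lambda>z. (cmod (g z))\<^sup>2)"
proof -
  define h where "h = (\<Sum>n<M. hscale (taylor_coeff g n) (hmon n))"
  define S where "S = (\<Sum>n<M. (cmod (taylor_coeff g n))\<^sup>2 * r ^ (2 * n))"
  have hc: "hcoeff h n = (if n < M then taylor_coeff g n else 0)" for n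
    unfolding h_def by (rule hcoeff_comb_hmon)
  have hh: "hfun h holomorphic_on ball 0 1" by (rule hfun_holomorphic)
  have hz: "hfun h z = (\<Sum>n<M. taylor_coeff g n * z ^ n)" if "cmod z < 1" for z
  proof -
    have "hfun h z = (\<Sum>n. hcoeff h n * z ^ n)" using hfun_sums[OF that] by (simp add: sums_iff)
    also have "\<dots> = (\<Sum>n<M. hcoeff h n * z ^ n)"
      by (rule suminf_finite) (auto simp: hc)
    finally show ?thesis by (simp add: hc)
  qed
  have cont: "continuous_on (sphere 0 r) u" if "u holomorphic_on ball 0 1" for u :: "complex \<Rightarrow> complex"
    by (rule continuous_on_subset[OF holomorphic_on_imp_continuous_on[OF that]]) (use r in auto)
  note [continuous_intros] = cont[OF g] cont[OF hh]
  have mean: "circ_mean r (\<lambda>z. u z * cnj (hfun h z)) = of_real S"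
    if u: "u holomorphic_on ball 0 1" "\<And>n. n < M \<Longrightarrow> taylor_coeff u n = taylor_coeff g n" for u
  proof -
    have "circ_mean r (\<lambda>z. u z * cnj (hfun h z)) =
        circ_mean r (\<lambda>z. \<Sum>n<M. cnj (taylor_coeff g n) * (u z * cnj z ^ n))"
      unfolding circ_mean_def
      by (intro integral_cong) (use r in \<open>simp add: hz norm_circlepath sum_distrib_left mult_ac\<close>)
    also have "\<dots> = (\<Sum>n<M. circ_mean r (\<lambda>z. cnj (taylor_coeff g n) * (u z * cnj z ^ n)))"
      unfolding circ_mean_def
      by (intro integral_sum circ_integrable continuous_intros cont u) (use r in auto)
    also have "\<dots> = (\<Sum>n<M. cnj (taylor_coeff g n) * (of_real (r ^ (2 * n)) * taylor_coeff g n))"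
      by (intro sum.cong refl) (simp add: circ_mean_mult_complex circ_mean_coeff[OF u(1) r] u(2))
    also have "\<dots> = of_real S"
      unfolding S_def of_real_sum
      by (intro sum.cong refl) (simp add: complex_norm_square mult_ac del: of_real_power)
    finally show ?thesis .
  qed
  have "taylor_coeff (hfun h) n = taylor_coeff g n" if "n < M" for n
    using hc[of n] that by (simp add: hcoeff.rep_eq)
  then have hm: "circ_mean r (\<lambda>z. hfun h z * cnj (hfun h z)) = of_real S"
    by (intro mean hh)
  have gm: "circ_mean r (\<lambda>z. g z * cnj (hfun h z)) = of_real S" by (intro mean g refl)
  have "2 * S + - S = circ_mean r (\<lambda>z. 2 * Re (g z * cnj (hfun h z))) + circ_mean r (\<lambda>z. - 1 * Re (hfun h z * cnj (hfun h z)))"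
    unfolding circ_mean_cmult using Re_circ_mean[of r "\<lambda>z. g z * cnj (hfun h z)"] gm
      Re_circ_mean[of r "\<lambda>z. hfun h z * cnj (hfun h z)"] hm r
    by (simp add: continuous_intros del: times_complex.sel)
  also have "\<dots> = circ_mean r (\<lambda>z. 2 * Re (g z * cnj (hfun h z)) + - 1 * Re (hfun h z * cnj (hfun h z)))"
    by (intro circ_mean_add[symmetric] continuous_intros) (use r in auto)
  also have "\<dots> \<le> circ_mean r (\<lambda>z. (cmod (g z))\<^sup>2)"
  proof (intro circ_mean_mono continuous_intros)
    fix z
    have "0 \<le> (cmod (g z - hfun h z))\<^sup>2" by simp
    then show "2 * Re (g z * cnj (hfun h z)) + - 1 * Re (hfun h z * cnj (hfun h z)) \<le> (cmod (g z))\<^sup>2"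
      unfolding cmod_power2 by (simp add: power2_eq_square algebra_simps)
  qed (use r in auto)
  finally show ?thesis by (simp add: S_def)
qed

text \<open>The value at \<open>w\<close> of the Herglotz integral of \<open>\<bar>f\<bar>\<^sup>2\<close>, where \<open>f\<close> is the polynomial with coefficient list \<open>cs\<close>;
  its real part is the least harmonic majorant of \<open>\<bar>f\<bar>\<^sup>2\<close> in the disc.\<close>

fun herglotz :: "complex list \<Rightarrow> complex \<Rightarrow> complex" where
  "herglotz [] w = 0"
| "herglotz (c # cs) w = of_real ((cmod c)\<^sup>2) + 2 * cnj c * w * horner_sum (\<lambda>a. a) w cs + herglotz cs w"

lemma herglotz_holomorphic: "herglotz cs holomorphic_on A"
  and horner_sum_holomorphic: "(\<lambda>w. horner_sum (\<lambda>a. a) w cs) holomorphic_on A" for cs :: "complex list"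
proof (induction cs)
  case (Cons c cs)
  {
    case 1
    have "herglotz (c # cs) = (\<lambda>w. of_real ((cmod c)\<^sup>2) + 2 * cnj c * w * horner_sum (\<lambda>a. a) w cs + herglotz cs w)"
      by (rule ext) simp
    then show ?case using Cons by (simp del: herglotz.simps) (intro holomorphic_intros)
  next
    case 2
    show ?case using Cons by (simp) (intro holomorphic_intros)
  }
qed (simp_all add: fun_eq_iff cong: holomorphic_cong)

text \<open>The recursion of the squared modulus differs from that of \<open>herglotz\<close> only
  by a factor |w|^2 <= 1 in its last term; on the unit circle the two agree.\<close>

lemma herglotz_ge:
  assumes "cmod w \<le> 1"
  shows "(cmod (horner_sum (\<lambda>a. a) w cs))\<^sup>2 \<le> Re (herglotz cs w)"
proof (induction cs)
  case (Cons c cs)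
  let ?e = "horner_sum (\<lambda>a. a) w cs"
  have "(cmod (c + w * ?e))\<^sup>2 = (cmod c)\<^sup>2 + 2 * Re (cnj c * w * ?e) + (cmod w)\<^sup>2 * (cmod ?e)\<^sup>2"
    unfolding cmod_power2 by (simp add: power2_eq_square algebra_simps)
  moreover have "(cmod w)\<^sup>2 * (cmod ?e)\<^sup>2 \<le> 1 * (cmod ?e)\<^sup>2"
    using assms by (intro mult_right_mono power_le_one) auto
  ultimately show ?case using Cons by (simp add: mult.assoc)
qed simp

text \<open>Harnack's inequality; the subtracted term makes the induction work.\<close>

lemma herglotz_le:
  assumes "cmod w < 1"
  shows "Re (herglotz cs w) \<le>
    (1 + cmod w) / (1 - cmod w) * (\<Sum>c\<leftarrow>cs. (cmod c)\<^sup>2) - cmod w * (cmod (horner_sum (\<lambda>a. a) w cs))\<^sup>2"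
proof (induction cs)
  case (Cons c cs)
  let ?e = "horner_sum (\<lambda>a. a) w cs" and ?q = "cmod w"
  let ?E = "cmod ?e" and ?S = "\<Sum>c\<leftarrow>cs. (cmod c)\<^sup>2" and ?K = "(1 + ?q) / (1 - ?q)"
  have "cmod (c + w * ?e) \<le> cmod c + ?q * ?E"
    by (metis norm_mult norm_triangle_ineq)
  then have 1: "?q * (cmod (c + w * ?e))\<^sup>2 \<le> ?q * (cmod c + ?q * ?E)\<^sup>2"
    by (intro mult_left_mono power_mono) auto
  have "Re (2 * cnj c * w * ?e) \<le> cmod (2 * cnj c * w * ?e)" by (rule complex_Re_le_cmod)
  then have 2: "Re (2 * cnj c * w * ?e) \<le> 2 * cmod c * ?q * ?E" by (simp add: norm_mult)
  \<comment> \<open>What remains of the induction step is a nonnegative multiple of a perfect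
    square.\<close>
  have 3: "?K * (cmod c)\<^sup>2 - ?q * (cmod c + ?q * ?E)\<^sup>2 - (cmod c)\<^sup>2 - 2 * cmod c * ?q * ?E + ?q * ?E\<^sup>2
      = ?q * (1 + ?q) / (1 - ?q) * (cmod c - (1 - ?q) * ?E)\<^sup>2"
    using assms by (simp add: field_simps power2_eq_square)
  have "0 \<le> ?q * (1 + ?q) / (1 - ?q) * (cmod c - (1 - ?q) * ?E)\<^sup>2"
    using assms by (intro mult_nonneg_nonneg divide_nonneg_nonneg) auto
  with 1 2 3 Cons have "(cmod c)\<^sup>2 + Re (2 * cnj c * w * ?e) + Re (herglotz cs w) \<le>
      ?K * (cmod c)\<^sup>2 + ?K * ?S - ?q * (cmod (c + w * ?e))\<^sup>2" by linarith
  then show ?case by (simp add: ring_distribs del: times_complex.sel)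
qed simp

section \<open>Composition operators and subordination\<close>

lemma horner_sum_hcoeff:
  "horner_sum (\<lambda>a. a) w (map (hcoeff f) [0..<M]) = (\<Sum>n<M. hcoeff f n * w ^ n)"
  by (simp add: horner_sum_eq_sum atLeast0LessThan)

locale disc_self_map =
  fixes \<phi> :: "complex \<Rightarrow> complex"
  assumes hol: "\<phi> holomorphic_on ball 0 1" and self_map: "cmod z < 1 \<Longrightarrow> cmod (\<phi> z) < 1"
begin

lemma hfun_comp_holomorphic: "(\<lambda>z. hfun f (\<phi> z)) holomorphic_on ball 0 1"
proof -
  have "\<phi> ` ball 0 1 \<subseteq> ball 0 1" using self_map by auto
  from holomorphic_on_compose_gen[OF hol hfun_holomorphic this, of f] show ?thesis
    by (simp add: o_def)
qed

lemma one_minus_neq_0: "1 - of_real a * z \<noteq> 0" if "cmod z < 1" "0 \<le> a" "a \<le> 1" for z :: complex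
proof
  assume "1 - of_real a * z = 0"
  then have "1 = cmod (of_real a * z)" by simp
  also have "\<dots> \<le> 1 * cmod z" using that by (simp add: norm_mult mult_left_le_one_le)
  finally show False using that by simp
qed

text \<open>Littlewood's argument with the weight 1/|1 - a z|^2, on the circle a multiple of a
  Poisson kernel, which concentrates near 1 as a tends to 1. Split as 1/(1 - a z) times 1/(1 - a cnj
  z), the weight lets Cauchy's formula integrate the harmonic majorant; the result is its value at a
  r^2, which Harnack's inequality bounds.\<close>

lemma subordination_poly:
  assumes r: "0 < r" "r < 1" and a: "0 \<le> a" "a \<le> 1"
  shows "circ_mean r (\<lambda>z. (cmod (horner_sum (\<lambda>a. a) (\<phi> z) cs))\<^sup>2 / (cmod (1 - of_real a * z))\<^sup>2)
    \<le> (1 + cmod (\<phi> (of_real (a * r\<^sup>2)))) / (1 - cmod (\<phi> (of_real (a * r\<^sup>2)))) / (1 - a\<^sup>2 * r\<^sup>2)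
       * (\<Sum>c\<leftarrow>cs. (cmod c)\<^sup>2)"
proof -
  define G where "G z = herglotz cs (\<phi> z)" for z
  define F where "F z = G z / (1 - of_real a * z)" for z
  let ?z = "of_real (a * r\<^sup>2) :: complex"
  have ar: "a * r\<^sup>2 < 1" "a\<^sup>2 * r\<^sup>2 < 1"
  proof -
    have "r\<^sup>2 < 1" using r by (simp add: power_less_one_iff)
    moreover have "a * r\<^sup>2 \<le> 1 * r\<^sup>2" "a\<^sup>2 * r\<^sup>2 \<le> 1 * r\<^sup>2"
      using a by (intro mult_right_mono power_le_one; simp)+
    ultimately show "a * r\<^sup>2 < 1" "a\<^sup>2 * r\<^sup>2 < 1" by linarith+
  qed
  have zb: "cmod ?z < 1" using ar a by (simp only: norm_of_real) simp
  have "\<phi> ` ball 0 1 \<subseteq> ball 0 1" using self_map by auto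
  then have G: "G holomorphic_on ball 0 1"
    and p: "(\<lambda>z. horner_sum (\<lambda>a. a) (\<phi> z) cs) holomorphic_on ball 0 1"
    using holomorphic_on_compose_gen[OF hol herglotz_holomorphic[of cs "ball 0 1"]]
      holomorphic_on_compose_gen[OF hol horner_sum_holomorphic[of cs "ball 0 1"]]
    by (auto simp: o_def G_def[abs_def])
  have F: "F holomorphic_on ball 0 1"
    unfolding F_def[abs_def] using G one_minus_neq_0 a by (intro holomorphic_intros) auto
  have cont: "continuous_on (sphere 0 r) u" if "u holomorphic_on ball 0 1" for u :: "complex \<Rightarrow> complex"
    by (rule continuous_on_subset[OF holomorphic_on_imp_continuous_on[OF that]]) (use r in auto)
  note [continuous_intros] = cont[OF F] cont[OF p]
  have nz: "1 - of_real a * cnj z \<noteq> 0" "1 - of_real a * z \<noteq> 0" if "cmod z = r" for z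
    using one_minus_neq_0[of "cnj z" a] one_minus_neq_0[of z a] that r a by auto
  have "circ_mean r (\<lambda>z. (cmod (horner_sum (\<lambda>a. a) (\<phi> z) cs))\<^sup>2 / (cmod (1 - of_real a * z))\<^sup>2)
      \<le> circ_mean r (\<lambda>z. Re (F z / (1 - of_real a * cnj z)))"
  proof (intro circ_mean_mono continuous_intros)
    fix z :: complex assume z: "cmod z = r"
    have "F z / (1 - of_real a * cnj z) = G z / ((1 - of_real a * z) * cnj (1 - of_real a * z))"
      by (simp add: F_def)
    also have "\<dots> = G z / of_real ((cmod (1 - of_real a * z))\<^sup>2)"
      by (simp only: complex_norm_square)
    finally have "Re (F z / (1 - of_real a * cnj z)) = Re (G z) / (cmod (1 - of_real a * z))\<^sup>2"
      by (simp only: Re_divide_of_real)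
    moreover have "(cmod (horner_sum (\<lambda>a. a) (\<phi> z) cs))\<^sup>2 \<le> Re (G z)"
      unfolding G_def using self_map[of z] z r by (intro herglotz_ge) auto
    ultimately show "(cmod (horner_sum (\<lambda>a. a) (\<phi> z) cs))\<^sup>2 / (cmod (1 - of_real a * z))\<^sup>2
        \<le> Re (F z / (1 - of_real a * cnj z))"
      by (simp add: divide_right_mono)
  qed (use r nz in auto)
  also have "\<dots> = Re (circ_mean r (\<lambda>z. F z / (1 - of_real a * cnj z)))"
    by (intro Re_circ_mean[symmetric] continuous_intros) (use r nz in auto)
  also have "\<dots> = Re (F ?z)" by (simp only: circ_mean_Cauchy[OF F r a])
  also have "F ?z = G ?z / of_real (1 - a\<^sup>2 * r\<^sup>2)"
    by (simp add: F_def power2_eq_square mult_ac)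
  also have "Re \<dots> = Re (G ?z) / (1 - a\<^sup>2 * r\<^sup>2)" by (rule Re_divide_of_real)
  also have "\<dots> \<le> ((1 + cmod (\<phi> ?z)) / (1 - cmod (\<phi> ?z)) * (\<Sum>c\<leftarrow>cs. (cmod c)\<^sup>2)) / (1 - a\<^sup>2 * r\<^sup>2)"
  proof (intro divide_right_mono)
    have "Re (G ?z) \<le> (1 + cmod (\<phi> ?z)) / (1 - cmod (\<phi> ?z)) * (\<Sum>c\<leftarrow>cs. (cmod c)\<^sup>2)
        - cmod (\<phi> ?z) * (cmod (horner_sum (\<lambda>a. a) (\<phi> ?z) cs))\<^sup>2"
      unfolding G_def by (intro herglotz_le self_map zb)
    then show "Re (G ?z) \<le> (1 + cmod (\<phi> ?z)) / (1 - cmod (\<phi> ?z)) * (\<Sum>c\<leftarrow>cs. (cmod c)\<^sup>2)"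
      by (rule order_trans) simp
  qed (use ar in simp)
  finally show ?thesis by simp
qed

lemma compact_circle_bound:
  assumes "0 \<le> r" "r < 1"
  obtains \<rho> where "\<rho> < 1" "0 \<le> \<rho>" "\<And>z. cmod z = r \<Longrightarrow> cmod (\<phi> z) \<le> \<rho>"
proof -
  have "continuous_on (sphere 0 r) (\<lambda>z. cmod (\<phi> z))"
    by (intro continuous_on_norm continuous_on_subset[OF holomorphic_on_imp_continuous_on[OF hol]])
       (use assms in auto)
  moreover have "of_real r \<in> sphere (0::complex) r" using assms by simp
  ultimately obtain z0 where "z0 \<in> sphere 0 r" "\<forall>z\<in>sphere 0 r. cmod (\<phi> z) \<le> cmod (\<phi> z0)"
    using continuous_attains_sup[OF compact_sphere, of 0 r "\<lambda>z. cmod (\<phi> z)"] by blast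
  then show ?thesis using self_map[of z0] assms by (intro that[of "cmod (\<phi> z0)"]) auto
qed

text \<open>On the circle \<open>\<phi>\<close> stays in a smaller disc, where the Taylor
  polynomials of \<open>hfun f\<close> are uniformly bounded, so dominated convergence applies. The
  case \<open>a = 0\<close> is the classical subordination principle.\<close>

lemma subordination:
  assumes r: "0 < r" "r < 1" and a: "0 \<le> a" "a \<le> 1"
  shows "circ_mean r (\<lambda>z. (cmod (hfun f (\<phi> z)))\<^sup>2 / (cmod (1 - of_real a * z))\<^sup>2)
    \<le> (1 + cmod (\<phi> (of_real (a * r\<^sup>2)))) / (1 - cmod (\<phi> (of_real (a * r\<^sup>2)))) / (1 - a\<^sup>2 * r\<^sup>2) * (norm f)\<^sup>2"
    (is "circ_mean r ?u \<le> ?K * _")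
proof -
  define cs where "cs M = map (hcoeff f) [0..<M]" for M
  define p where "p M w = horner_sum (\<lambda>a. a) w (cs M)" for M w
  have p_eq: "p M w = (\<Sum>n<M. hcoeff f n * w ^ n)" for M w
    by (simp add: p_def cs_def horner_sum_hcoeff)
  obtain \<rho> where \<rho>: "\<rho> < 1" "0 \<le> \<rho>" "\<And>z. cmod z = r \<Longrightarrow> cmod (\<phi> z) \<le> \<rho>"
    using compact_circle_bound[of r] r by auto
  have nz: "0 < cmod (1 - of_real a * z)" "1 - r \<le> cmod (1 - of_real a * z)" if "cmod z = r" for z
  proof -
    have "cmod (of_real a * z) \<le> 1 * r" using that a r by (simp add: norm_mult mult_left_le_one_le)
    then show "1 - r \<le> cmod (1 - of_real a * z)"
      using norm_triangle_ineq2[of 1 "of_real a * z"] by simp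
    then show "0 < cmod (1 - of_real a * z)" using r by linarith
  qed
  have pb: "cmod (p M w) \<le> norm f / (1 - \<rho>)" if "cmod w \<le> \<rho>" for M w
  proof -
    have "cmod (p M w) \<le> (\<Sum>n<M. cmod (hcoeff f n * w ^ n))" unfolding p_eq by (rule norm_sum)
    also have "\<dots> \<le> (\<Sum>n<M. norm f * \<rho> ^ n)"
      using that \<rho> by (intro sum_mono) (auto simp: norm_mult norm_power intro!: mult_mono power_mono hcoeff_norm_le)
    also have "\<dots> \<le> (\<Sum>n. norm f * \<rho> ^ n)"
      using \<rho> by (intro sum_le_suminf summable_mult summable_geometric) auto
    also have "\<dots> = norm f / (1 - \<rho>)"
      using \<rho> by (simp add: suminf_mult suminf_geometric)
    finally show ?thesis .
  qed
  have pcont: "continuous_on (sphere 0 r) (\<lambda>z. p M (\<phi> z))" for M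
    unfolding p_eq by (intro continuous_intros continuous_on_subset[OF holomorphic_on_imp_continuous_on[OF hol]])
      (use r in auto)
  have "(\<lambda>M. circ_mean r (\<lambda>z. (cmod (p M (\<phi> z)))\<^sup>2 / (cmod (1 - of_real a * z))\<^sup>2)) \<longlonglongrightarrow> circ_mean r ?u"
    unfolding circ_mean_def
  proof (rule dominated_convergence(2)[where h = "\<lambda>_. (norm f / (1 - \<rho>))\<^sup>2 / (1 - r)\<^sup>2"])
    show "(\<lambda>t. (cmod (p M (\<phi> (circlepath 0 r t))))\<^sup>2 / (cmod (1 - of_real a * circlepath 0 r t))\<^sup>2)
        integrable_on {0..1}" for M
      by (rule circ_integrable[where u = "\<lambda>z. (cmod (p M (\<phi> z)))\<^sup>2 / (cmod (1 - of_real a * z))\<^sup>2"],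
          intro continuous_intros pcont) (use r nz(1) in auto)
  next
    fix M and t :: real
    let ?z = "circlepath 0 r t"
    have z: "cmod ?z = r" using r by (simp add: norm_circlepath)
    have "(cmod (p M (\<phi> ?z)))\<^sup>2 / (cmod (1 - of_real a * ?z))\<^sup>2 \<le> (norm f / (1 - \<rho>))\<^sup>2 / (1 - r)\<^sup>2"
      using r z by (intro frac_le power_mono pb \<rho> nz(2)) auto
    then show "norm ((cmod (p M (\<phi> ?z)))\<^sup>2 / (cmod (1 - of_real a * ?z))\<^sup>2) \<le> (norm f / (1 - \<rho>))\<^sup>2 / (1 - r)\<^sup>2"
      by simp
    have "cmod (\<phi> ?z) < 1" using z r by (intro self_map) simp
    from hfun_sums[OF this, of f] have "(\<lambda>M. p M (\<phi> ?z)) \<longlonglongrightarrow> hfun f (\<phi> ?z)"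
      by (simp add: sums_def p_eq)
    then show "(\<lambda>M. (cmod (p M (\<phi> ?z)))\<^sup>2 / (cmod (1 - of_real a * ?z))\<^sup>2)
        \<longlonglongrightarrow> (cmod (hfun f (\<phi> ?z)))\<^sup>2 / (cmod (1 - of_real a * ?z))\<^sup>2"
      using nz(1)[OF z] by (intro tendsto_intros) auto
  qed auto
  moreover have "circ_mean r (\<lambda>z. (cmod (p M (\<phi> z)))\<^sup>2 / (cmod (1 - of_real a * z))\<^sup>2) \<le> ?K * (norm f)\<^sup>2" for M
  proof -
    have K: "0 \<le> ?K"
    proof -
      have "a\<^sup>2 * r\<^sup>2 \<le> 1 * r\<^sup>2" using a by (intro mult_right_mono power_le_one) auto
      moreover have "r\<^sup>2 < 1" using r by (simp add: power_less_one_iff)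
      moreover have "cmod (of_real (a * r\<^sup>2) :: complex) < 1"
      proof -
        have "a * r\<^sup>2 \<le> 1 * r\<^sup>2" using a by (intro mult_right_mono) auto
        with \<open>r\<^sup>2 < 1\<close> show ?thesis using a by (simp only: norm_of_real) simp
      qed
      ultimately show ?thesis using self_map[of "of_real (a * r\<^sup>2)"]
        by (intro divide_nonneg_nonneg) auto
    qed
    have "(\<Sum>c\<leftarrow>cs M. (cmod c)\<^sup>2) = (\<Sum>n<M. (cmod (hcoeff f n))\<^sup>2)"
      by (simp add: cs_def o_def interv_sum_list_conv_sum_set_nat atLeast0LessThan)
    also have "\<dots> \<le> (norm f)\<^sup>2"
      unfolding norm_hardy2_sq by (intro sum_le_suminf summable_hcoeff) auto
    finally show ?thesis
      unfolding p_def by (intro order_trans[OF subordination_poly[OF r a]] mult_left_mono K)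
  qed
  ultimately show ?thesis by (intro LIMSEQ_le_const2) auto
qed

text \<open>The bound is allowed to vary with \<open>r\<close> because \<open>subordination\<close>
  evaluates \<open>\<phi>\<close> at \<open>a * r\<^sup>2\<close>; the conclusion takes its limit at
  radius 1.\<close>

lemma partial_sums_le_of_circ_mean:
  assumes g: "g holomorphic_on ball 0 1" and r0: "r0 < 1"
    and le: "\<And>r. r0 < r \<Longrightarrow> 0 < r \<Longrightarrow> r < 1 \<Longrightarrow> circ_mean r (\<lambda>z. (cmod (g z))\<^sup>2) \<le> B r"
    and lim: "(B \<longlongrightarrow> L) (at_left 1)"
  shows "(\<Sum>n<M. (cmod (taylor_coeff g n))\<^sup>2) \<le> L"
proof (rule tendsto_le[OF _ lim])
  show "((\<lambda>r. \<Sum>n<M. (cmod (taylor_coeff g n))\<^sup>2 * r ^ (2 * n)) \<longlongrightarrow> (\<Sum>n<M. (cmod (taylor_coeff g n))\<^sup>2)) (at_left 1)"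
    by (auto intro!: tendsto_eq_intros)
  show "\<forall>\<^sub>F r in at_left 1. (\<Sum>n<M. (cmod (taylor_coeff g n))\<^sup>2 * r ^ (2 * n)) \<le> B r"
    using eventually_at_left_real[of "max r0 0" 1] r0
    by (auto elim!: eventually_mono intro!: order_trans[OF Bessel_circ_mean[OF g]] le)
qed simp

lemma phi_tendsto:
  assumes "cmod w < 1"
  shows "((\<lambda>r. \<phi> (w * of_real (r\<^sup>2))) \<longlongrightarrow> \<phi> w) (at_left (1::real))"
proof -
  have "isCont \<phi> w"
    using holomorphic_on_imp_continuous_on[OF hol] assms by (simp add: continuous_on_eq_continuous_at)
  moreover have "((\<lambda>r. w * of_real (r\<^sup>2)) \<longlongrightarrow> w) (at_left (1::real))"
    by (auto intro!: tendsto_eq_intros)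
  ultimately show ?thesis by (rule isCont_tendsto_compose)
qed

text \<open>The case \<open>a = 0\<close> of \<open>subordination\<close> yields square-summability
  of the coefficients, which is what it takes to see through \<open>Abs_hardy2\<close> in
  \<open>comp_op\<close>.\<close>

lemma comp_op_props:
  shows hfun_comp_op: "hfun (comp_op \<phi> f) = (\<lambda>z. if z \<in> ball 0 1 then hfun f (\<phi> z) else 0)"
    and hcoeff_comp_op: "hcoeff (comp_op \<phi> f) n = taylor_coeff (\<lambda>z. hfun f (\<phi> z)) n"
proof -
  define u where "u z = hfun f (\<phi> z)" for z
  define g where "g = (\<lambda>z. if z \<in> ball 0 1 then u z else 0)"
  define K where "K = (1 + cmod (\<phi> 0)) / (1 - cmod (\<phi> 0)) * (norm f)\<^sup>2"
  have u: "u holomorphic_on ball 0 1" unfolding u_def[abs_def] by (rule hfun_comp_holomorphic)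
  have tc: "taylor_coeff g n = taylor_coeff u n" for n
  proof -
    have "(deriv ^^ n) g 0 = (deriv ^^ n) u 0"
      by (rule higher_deriv_cong_ev)
         (auto simp: g_def eventually_nhds intro!: exI[of _ "ball 0 1"])
    then show ?thesis by (simp add: taylor_coeff_def)
  qed
  have "(\<Sum>n<M. (cmod (taylor_coeff u n))\<^sup>2) \<le> K" for M
  proof (rule partial_sums_le_of_circ_mean[OF u, of 0 "\<lambda>_. K"])
    show "circ_mean r (\<lambda>z. (cmod (u z))\<^sup>2) \<le> K" if "0 < r" "r < 1" for r
      using subordination[OF that, of 0 f] by (simp add: u_def K_def)
  qed auto
  then have "summable (\<lambda>n. (cmod (taylor_coeff u n))\<^sup>2)"
    by (intro summableI_nonneg_bounded[of _ K]) auto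
  moreover have "g holomorphic_on ball 0 1"
    by (rule holomorphic_transform[OF u]) (simp add: g_def)
  moreover have "\<forall>z. z \<notin> ball 0 1 \<longrightarrow> g z = 0" by (simp add: g_def)
  ultimately have *: "hfun (Abs_hardy2 g) = g"
    by (intro Abs_hardy2_inverse) (simp add: tc)
  have co: "comp_op \<phi> f = Abs_hardy2 g" unfolding comp_op_def g_def u_def ..
  show "hfun (comp_op \<phi> f) = (\<lambda>z. if z \<in> ball 0 1 then hfun f (\<phi> z) else 0)"
    unfolding co * unfolding g_def u_def ..
  show "hcoeff (comp_op \<phi> f) n = taylor_coeff (\<lambda>z. hfun f (\<phi> z)) n"
    unfolding hcoeff.rep_eq co * tc by (simp add: u_def[abs_def])
qed

lemma clinear_comp_op: "clinear_op (comp_op \<phi>)"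
proof -
  have "comp_op \<phi> (f + g) = comp_op \<phi> f + comp_op \<phi> g" for f g
    by (rule hfun_inject[THEN iffD1]) (auto simp: hfun_comp_op plus_hardy2.rep_eq)
  moreover have "comp_op \<phi> (hscale c f) = hscale c (comp_op \<phi> f)" for c f
    by (rule hfun_inject[THEN iffD1]) (auto simp: hfun_comp_op hscale.rep_eq)
  ultimately show ?thesis
    by (intro Vector_Spaces.linear_iff[THEN iffD2] conjI allI hardy2.vector_space_axioms)
qed

text \<open>With \<open>a = 1 - \<tau>\<close>, points of the disc at distance less than \<tau> from
  1 satisfy |1 - a z| <= 2 \<tau>, so the factor 4 \<tau>^2 compensates the weight there. Since 1 -
  a^2 >= \<tau>, one factor \<tau> survives.\<close>

lemma norm_comp_op_le_near_1:
  assumes \<tau>: "0 < \<tau>" "\<tau> \<le> 1" and \<epsilon>: "0 \<le> \<epsilon>" and r0: "r0 < 1"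
    and away: "\<And>z. r0 < cmod z \<Longrightarrow> cmod z < 1 \<Longrightarrow> \<tau> \<le> cmod (1 - z) \<Longrightarrow> (cmod (hfun f (\<phi> z)))\<^sup>2 \<le> \<epsilon>"
  shows "(norm (comp_op \<phi> f))\<^sup>2 \<le> \<epsilon> + 8 * \<tau> / (1 - cmod (\<phi> (of_real (1 - \<tau>)))) * (norm f)\<^sup>2"
proof -
  define a where "a = 1 - \<tau>"
  have a: "0 \<le> a" "a < 1" "a \<le> 1" using \<tau> by (auto simp: a_def)
  define u where "u z = hfun f (\<phi> z)" for z
  have u: "u holomorphic_on ball 0 1" unfolding u_def[abs_def] by (rule hfun_comp_holomorphic)
  define B where "B r = \<epsilon> + 4 * \<tau>\<^sup>2 * ((1 + cmod (\<phi> (of_real (a * r\<^sup>2)))) / (1 - cmod (\<phi> (of_real (a * r\<^sup>2))))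
    / (1 - a\<^sup>2 * r\<^sup>2) * (norm f)\<^sup>2)" for r
  define b where "b = cmod (\<phi> (of_real a))"
  define L where "L = \<epsilon> + 4 * \<tau>\<^sup>2 * ((1 + b) / (1 - b) / (1 - a\<^sup>2) * (norm f)\<^sup>2)"
  have b: "b < 1" "0 \<le> b" using self_map[of "of_real a"] a by (auto simp: b_def)
  have a2: "\<tau> \<le> 1 - a\<^sup>2" using \<tau> mult_left_mono[of \<tau> 1 \<tau>] by (simp add: a_def power2_eq_square algebra_simps)
  have "(B \<longlongrightarrow> L) (at_left 1)"
  proof -
    have "((\<lambda>r. \<phi> (of_real (a * r\<^sup>2))) \<longlongrightarrow> \<phi> (of_real a)) (at_left (1::real))"
      using phi_tendsto[of "of_real a"] a by simp
    then show ?thesis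
      unfolding B_def[abs_def] L_def b_def using b a2 \<tau>
      by (auto intro!: tendsto_eq_intros simp: b_def)
  qed
  moreover have "circ_mean r (\<lambda>z. (cmod (u z))\<^sup>2) \<le> B r" if r: "r0 < r" "0 < r" "r < 1" for r
  proof -
    have [continuous_intros]: "continuous_on (sphere 0 r) u"
      by (rule continuous_on_subset[OF holomorphic_on_imp_continuous_on[OF u]]) (use r in auto)
    have nz: "1 - of_real a * z \<noteq> 0" if "cmod z = r" for z
      using one_minus_neq_0[of z a] that a r by auto
    define v where "v z = (cmod (u z))\<^sup>2 / (cmod (1 - of_real a * z))\<^sup>2" for z
    have [continuous_intros]: "continuous_on (sphere 0 r) v"
      unfolding v_def[abs_def] by (intro continuous_intros) (use nz in auto)
    have "circ_mean r (\<lambda>z. (cmod (u z))\<^sup>2) \<le> circ_mean r (\<lambda>z. \<epsilon> + 4 * \<tau>\<^sup>2 * v z)"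
    proof (intro circ_mean_mono continuous_intros)
      fix z assume z: "cmod z = r"
      show "(cmod (u z))\<^sup>2 \<le> \<epsilon> + 4 * \<tau>\<^sup>2 * v z"
      proof (cases "\<tau> \<le> cmod (1 - z)")
        case True
        then have "(cmod (u z))\<^sup>2 \<le> \<epsilon>" using away[of z] z r by (simp add: u_def)
        moreover have "0 \<le> 4 * \<tau>\<^sup>2 * v z" by (simp add: v_def)
        ultimately show ?thesis by linarith
      next
        case False
        have eq: "1 - of_real a * z = (1 - z) + of_real \<tau> * z" by (simp add: a_def algebra_simps)
        have "cmod (1 - of_real a * z) \<le> cmod (1 - z) + \<tau> * cmod z"
          unfolding eq using norm_triangle_ineq[of "1 - z" "of_real \<tau> * z"] \<tau> by (simp add: norm_mult)
        also have "\<dots> \<le> \<tau> + \<tau> * 1" using False \<tau> z r by (intro add_mono mult_left_mono) auto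
        finally have "(cmod (1 - of_real a * z))\<^sup>2 \<le> (2 * \<tau>)\<^sup>2" by (intro power_mono) auto
        then have "(cmod (u z))\<^sup>2 * (cmod (1 - of_real a * z))\<^sup>2 \<le> (cmod (u z))\<^sup>2 * (4 * \<tau>\<^sup>2)"
          by (intro mult_left_mono) (auto simp: power_mult_distrib)
        then have "(cmod (u z))\<^sup>2 \<le> 4 * \<tau>\<^sup>2 * v z"
          using nz[OF z] by (simp add: v_def field_simps)
        then show ?thesis using \<epsilon> by linarith
      qed
    qed (use r in auto)
    also have "\<dots> = \<epsilon> + 4 * \<tau>\<^sup>2 * circ_mean r v"
      using r by (subst circ_mean_add) (auto intro!: continuous_intros simp: circ_mean_cmult)
    also have "\<dots> \<le> B r"
      using subordination[OF r(2,3) a(1,3), of f]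
      unfolding B_def v_def[abs_def] u_def by (intro add_left_mono mult_left_mono) auto
    finally show ?thesis .
  qed
  ultimately have "(\<Sum>n<M. (cmod (taylor_coeff u n))\<^sup>2) \<le> L" for M
    by (rule partial_sums_le_of_circ_mean[OF u r0, rotated])
  then have "(norm (comp_op \<phi> f))\<^sup>2 \<le> L"
    unfolding norm_hardy2_sq
    by (intro suminf_le_const summable_hcoeff) (simp add: hcoeff_comp_op u_def[abs_def])
  also have "L \<le> \<epsilon> + 4 * \<tau>\<^sup>2 * (2 / (1 - b) / \<tau> * (norm f)\<^sup>2)"
    unfolding L_def using b a2 \<tau> by (intro add_left_mono mult_left_mono mult_right_mono frac_le) auto
  also have "\<dots> = \<epsilon> + 8 * \<tau> / (1 - b) * (norm f)\<^sup>2"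
  proof -
    have "4 * \<tau>\<^sup>2 * (2 / x / \<tau> * y) = 8 * \<tau> / x * y" for x y
      using \<tau> by (simp add: power2_eq_square)
    then show ?thesis by metis
  qed
  finally show ?thesis by (simp only: b_def a_def)
qed

text \<open>Montel's theorem gives locally uniform convergence of a subsequence. Away from 1 this is
  uniform after composition, because \<open>\<phi>\<close> stays in a smaller disc there; near 1 the
  previous estimate takes over.\<close>

lemma compact_comp_op:
  assumes small: "\<And>\<eta>. \<eta> > 0 \<Longrightarrow> \<exists>\<tau> \<rho>. 0 < \<tau> \<and> \<tau> \<le> 1 \<and> 8 * \<tau> / (1 - cmod (\<phi> (of_real (1 - \<tau>)))) \<le> \<eta> \<and>
    \<rho> < 1 \<and> (\<forall>z. cmod z < 1 \<longrightarrow> \<tau> \<le> cmod (1 - z) \<longrightarrow> cmod (\<phi> z) \<le> \<rho>)"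
  shows "compact_op (comp_op \<phi>)"
proof -
  have "compact (comp_op \<phi> ` cball 0 1)"
    unfolding compact_def
  proof (intro allI impI)
    fix G :: "nat \<Rightarrow> hardy2" assume "\<forall>n. G n \<in> comp_op \<phi> ` cball 0 1"
    then have "\<forall>n. \<exists>f. norm f \<le> 1 \<and> G n = comp_op \<phi> f" by (metis imageE mem_cball_0)
    then obtain F where F: "\<And>n. norm (F n) \<le> 1" "\<And>n. G n = comp_op \<phi> (F n)" by metis
    have F_le: "cmod (hfun (F n) z) \<le> sqrt (1 / (1 - \<rho>\<^sup>2))" if "cmod z \<le> \<rho>" "\<rho> < 1" for n z \<rho>
    proof -
      have "0 \<le> \<rho>" using that(1) norm_ge_zero order_trans by blast
      then have \<rho>2: "\<rho>\<^sup>2 < 1" using that by (simp add: power_less_one_iff)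
      have z2: "(cmod z)\<^sup>2 \<le> \<rho>\<^sup>2" using that by (intro power_mono) auto
      have "(cmod (hfun (F n) z))\<^sup>2 \<le> (norm (F n))\<^sup>2 / (1 - (cmod z)\<^sup>2)"
        using that by (intro hfun_norm_le) simp
      also have "\<dots> \<le> 1 / (1 - \<rho>\<^sup>2)"
        using z2 \<rho>2 F(1)[of n] by (intro frac_le) (auto intro: power_le_one)
      finally show ?thesis by (intro real_le_rsqrt)
    qed
    obtain g r where g: "g holomorphic_on ball 0 1" "strict_mono (r :: nat \<Rightarrow> nat)"
      "\<And>K. compact K \<Longrightarrow> K \<subseteq> ball 0 1 \<Longrightarrow> uniform_limit K ((\<lambda>n. hfun (F n)) \<circ> r) g sequentially"
    proof (rule Montel[where \<F> = "\<lambda>n. hfun (F n)" and \<H> = "range (\<lambda>n. hfun (F n))" and S = "ball 0 1"])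
      fix K :: "complex set" assume K: "compact K" "K \<subseteq> ball 0 1"
      show "\<exists>B. \<forall>h\<in>range (\<lambda>n. hfun (F n)). \<forall>z\<in>K. cmod (h z) \<le> B"
      proof (cases "K = {}")
        case False
        then obtain z0 where "z0 \<in> K" "\<forall>z\<in>K. cmod z \<le> cmod z0"
          using continuous_attains_sup[OF K(1), of cmod] by (auto intro: continuous_intros)
        then show ?thesis using K(2)
          by (intro exI[of _ "sqrt (1 / (1 - (cmod z0)\<^sup>2))"]) (auto intro!: F_le)
      qed auto
    qed (auto simp: hfun_holomorphic)
    have coeff: "(\<lambda>n. hcoeff (F (r n)) k) \<longlonglongrightarrow> taylor_coeff g k" for k
    proof -
      have "uniform_limit (ball 0 (1/2)) ((\<lambda>n. hfun (F n)) \<circ> r) g sequentially"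
        by (rule uniform_limit_on_subset[OF g(3)[of "cball 0 (1/2)"]]) auto
      then have "(\<lambda>n. (deriv ^^ k) (((\<lambda>n. hfun (F n)) \<circ> r) n) 0) \<longlonglongrightarrow> (deriv ^^ k) g 0"
        by (rule higher_deriv_complex_uniform_limit)
           (auto intro!: always_eventually holomorphic_on_subset[OF hfun_holomorphic])
      then show ?thesis
        unfolding hcoeff.rep_eq taylor_coeff_def by (intro tendsto_divide tendsto_const) auto
    qed
    \<comment> \<open>Coefficientwise limits keep the bound 1, so the limit again lies in the unit
      ball.\<close>
    have sum_le: "(\<Sum>k<M. (cmod (taylor_coeff g k))\<^sup>2) \<le> 1" for M
    proof (rule LIMSEQ_le_const2)
      show "(\<lambda>n. \<Sum>k<M. (cmod (hcoeff (F (r n)) k))\<^sup>2) \<longlonglongrightarrow> (\<Sum>k<M. (cmod (taylor_coeff g k))\<^sup>2)"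
        by (intro tendsto_intros coeff)
      have "(\<Sum>k<M. (cmod (hcoeff f k))\<^sup>2) \<le> 1" if "norm f \<le> 1" for f
      proof -
        have "(\<Sum>k<M. (cmod (hcoeff f k))\<^sup>2) \<le> (norm f)\<^sup>2"
          unfolding norm_hardy2_sq by (intro sum_le_suminf summable_hcoeff) auto
        also have "\<dots> \<le> 1" using that by (intro power_le_one) auto
        finally show ?thesis .
      qed
      then show "\<exists>N. \<forall>n\<ge>N. (\<Sum>k<M. (cmod (hcoeff (F (r n)) k))\<^sup>2) \<le> 1" using F(1) by blast
    qed
    have "summable (\<lambda>k. (cmod (taylor_coeff g k))\<^sup>2)"
      by (rule summableI_nonneg_bounded[OF _ sum_le]) simp
    from hardy2_of_seq[OF this] obtain f where f: "hcoeff f = taylor_coeff g" by blast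
    have f1: "norm f \<le> 1" using sum_le by (intro norm_hardy2_le) (auto simp: f)
    have fg: "hfun f z = g z" if "cmod z < 1" for z
    proof -
      have "(\<lambda>n. taylor_coeff g n * z ^ n) sums g z"
        using holomorphic_power_series[OF g(1), of z] that by (simp add: taylor_coeff_def)
      with hfun_sums[OF that, of f] f show ?thesis by (metis sums_unique2)
    qed
    have "(G \<circ> r) \<longlonglongrightarrow> comp_op \<phi> f"
    proof (rule metric_LIMSEQ_I)
      fix \<delta> :: real assume "\<delta> > 0"
      \<comment> \<open>The share \<delta>^2 / 8 will be multiplied by |h|^2 <= 4; with
        (\<delta>/2)^2 this gives 3/4 \<delta>^2.\<close>
      then have "\<delta>\<^sup>2 / 8 > 0" by simp
      from small[OF this] obtain \<tau> \<rho> where \<tau>: "0 < \<tau>" "\<tau> \<le> 1"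
        "8 * \<tau> / (1 - cmod (\<phi> (of_real (1 - \<tau>)))) \<le> \<delta>\<^sup>2 / 8" and \<rho>: "\<rho> < 1"
        "\<And>z. cmod z < 1 \<Longrightarrow> \<tau> \<le> cmod (1 - z) \<Longrightarrow> cmod (\<phi> z) \<le> \<rho>" by blast
      have "uniform_limit (cball 0 \<rho>) ((\<lambda>n. hfun (F n)) \<circ> r) g sequentially"
        using \<rho>(1) by (intro g(3)) auto
      from uniform_limitD[OF this, of "\<delta> / 2"] \<open>\<delta> > 0\<close>
      obtain N where "\<forall>n\<ge>N. \<forall>w\<in>cball 0 \<rho>. dist (((\<lambda>n. hfun (F n)) \<circ> r) n w) (g w) < \<delta> / 2"
        unfolding eventually_sequentially by auto
      then have N: "dist (hfun (F (r n)) w) (g w) < \<delta> / 2" if "n \<ge> N" "cmod w \<le> \<rho>" for n w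
        using that by simp
      have "dist ((G \<circ> r) n) (comp_op \<phi> f) < \<delta>" if "n \<ge> N" for n
      proof -
        define h where "h = F (r n) - f"
        have "norm h \<le> 2"
          unfolding h_def using norm_triangle_ineq4[of "F (r n)" f] F(1)[of "r n"] f1 by linarith
        then have "(norm h)\<^sup>2 \<le> 2\<^sup>2" by (intro power_mono) auto
        have hw: "hfun h w = hfun (F (r n)) w - hfun f w" if "cmod w < 1" for w
          using hinner_hker[OF that] by (metis h_def hinner_diff_left)
        have "(norm (comp_op \<phi> h))\<^sup>2 \<le> (\<delta> / 2)\<^sup>2 + 8 * \<tau> / (1 - cmod (\<phi> (of_real (1 - \<tau>)))) * (norm h)\<^sup>2"
        proof (rule norm_comp_op_le_near_1[OF \<tau>(1,2), of _ 0])
          fix z assume z: "cmod z < 1" "\<tau> \<le> cmod (1 - z)"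
          have "cmod (hfun h (\<phi> z)) = dist (hfun (F (r n)) (\<phi> z)) (g (\<phi> z))"
            using self_map[OF z(1)] by (simp add: hw fg dist_norm)
          also have "\<dots> \<le> \<delta> / 2" using N[OF \<open>n \<ge> N\<close> \<rho>(2)[OF z]] by simp
          finally show "(cmod (hfun h (\<phi> z)))\<^sup>2 \<le> (\<delta> / 2)\<^sup>2" by (intro power_mono) auto
        qed auto
        also have "\<dots> \<le> (\<delta> / 2)\<^sup>2 + (\<delta>\<^sup>2 / 8) * 2\<^sup>2"
          using \<tau> \<open>(norm h)\<^sup>2 \<le> 2\<^sup>2\<close> by (intro add_left_mono mult_mono) auto
        also have "\<dots> < \<delta>\<^sup>2" using \<open>\<delta> > 0\<close> by (simp add: power2_eq_square field_simps)
        finally have "norm (comp_op \<phi> h) < \<delta>"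
          using \<open>\<delta> > 0\<close> by (simp add: power_less_imp_less_base)
        moreover have "comp_op \<phi> h = (G \<circ> r) n - comp_op \<phi> f"
          by (simp add: h_def F(2) clinear_op_simps(4)[OF clinear_comp_op])
        ultimately show ?thesis by (simp add: dist_norm)
      qed
      then show "\<exists>N. \<forall>n\<ge>N. dist ((G \<circ> r) n) (comp_op \<phi> f) < \<delta>" by blast
    qed
    then show "\<exists>l\<in>comp_op \<phi> ` cball 0 1. \<exists>r. strict_mono r \<and> (G \<circ> r) \<longlonglongrightarrow> l"
      using f1 g(2) by (intro bexI[of _ "comp_op \<phi> f"]) auto
  qed
  then show ?thesis
    using clinear_comp_op by (simp add: compact_op_def closure_closed[OF compact_imp_closed])
qed

end

section \<open>The lacunary symbol\<close>

locale lacunary_symbol =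
  fixes \<rho> :: real
  assumes \<rho>: "\<rho> > 1"
begin

text \<open>The constant of \<open>Re_\<Psi>_le\<close>: the first summand comes from the geometric
  sum of the terms up to the block, the second from the terms beyond it.\<close>

definition A :: real where "A = 6 * \<rho> / (\<rho> - 1) + 4 * \<rho>"
text \<open>The 256 stems from the separation of the image points in
  \<open>kernels_\<phi>_ge\<close>; with it the off-diagonal Gram sums there come out as half of the
  diagonal bound.\<close>

definition K :: real where "K = 256 * A"
definition N :: "nat \<Rightarrow> real" where "N l = K * real (l + 1) * 2 ^ l"

text \<open>The start 4 leaves room for \<zeta> = 1 - z with z in the unit disc or in one of the
  discs around the net points.\<close>

fun t :: "nat \<Rightarrow> real" where
  "t 0 = 4"
| "t (Suc l) = t l / (N l)\<^sup>2"

text \<open>In the coordinate 1/\<zeta> this is the translation by 1 / t l, up to scaling: about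
  \<rho>^l \<zeta> for |\<zeta>| far below \<open>t l\<close>, saturating near \<rho>^l t l far
  above it. Such translations preserve the right half-plane.\<close>

definition g :: "nat \<Rightarrow> complex \<Rightarrow> complex" where
  "g l \<zeta> = of_real (\<rho> ^ l) * (\<zeta> / (1 + \<zeta> / of_real (t l)))"

definition \<Psi> :: "complex \<Rightarrow> complex" where
  "\<Psi> \<zeta> = (\<Sum>l. g l \<zeta>)"

text \<open>The divisor 16 is the bound of \<open>norm_\<Psi>_le\<close> and secures |W| <=
  1.\<close>

definition W :: "complex \<Rightarrow> complex" where
  "W z = \<Psi> (1 - z) / 16"

definition \<phi> :: "complex \<Rightarrow> complex" where
  "\<phi> z = (1 - W z) / (1 + W z)"

section \<open>Decay of the scales\<close>

lemma A_ge: "A \<ge> 10" "A \<ge> 4 * \<rho>" "A \<ge> 6 * \<rho> / (\<rho> - 1)" "A > 0"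
proof -
  have "6 * \<rho> / (\<rho> - 1) \<ge> 6" using \<rho> by (simp add: le_divide_eq)
  then show "A \<ge> 10" "A \<ge> 4 * \<rho>" "A \<ge> 6 * \<rho> / (\<rho> - 1)" "A > 0" using \<rho> unfolding A_def by linarith+
qed

lemma K_ge: "K \<ge> 2560" "K \<ge> 1024 * \<rho>" "K > 0"
  using A_ge by (auto simp: K_def)

lemma N_ge: "N l \<ge> K" "N l \<ge> 2560" "N l > 0"
proof -
  have "1 * 1 \<le> real (l + 1) * 2 ^ l" by (intro mult_mono) auto
  then have "K * 1 \<le> K * (real (l + 1) * 2 ^ l)" using K_ge by (intro mult_left_mono) auto
  then show "N l \<ge> K" by (simp add: N_def mult.assoc)
  then show "N l \<ge> 2560" "N l > 0" using K_ge by auto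
qed

lemma N_mono: "l \<le> m \<Longrightarrow> N l \<le> N m"
  unfolding N_def using K_ge by (intro mult_mono mult_left_mono power_increasing) auto

lemma N_sq_ge: "(N l)\<^sup>2 \<ge> 1024 * \<rho>" "(N l)\<^sup>2 \<ge> 64"
proof -
  have "N l * 1 \<le> N l * N l" using N_ge[of l] by (intro mult_left_mono) auto
  then have "N l \<le> (N l)\<^sup>2" by (simp add: power2_eq_square)
  then show "(N l)\<^sup>2 \<ge> 1024 * \<rho>" "(N l)\<^sup>2 \<ge> 64" using N_ge[of l] K_ge by auto
qed

lemma t_pos [simp]: "t l > 0"
  by (induction l) (use N_ge in \<open>auto simp: zero_less_divide_iff order_less_le\<close>)

lemma t_nonneg [simp]: "0 \<le> t l" and t_nz [simp]: "t l \<noteq> 0"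
  using t_pos[of l] by linarith+

lemma t_Suc_le: "t (Suc l) \<le> t l / 64"
  unfolding t.simps(2) using N_sq_ge[of l] less_imp_le[OF t_pos[of l]] by (intro divide_left_mono mult_pos_pos) auto

declare t.simps(2) [simp del]

lemma t_decseq: "decseq t"
proof (rule decseq_SucI)
  show "t (Suc l) \<le> t l" for l using t_Suc_le[of l] t_pos[of l] by linarith
qed

lemma t_antimono: "l \<le> m \<Longrightarrow> t m \<le> t l"
  using t_decseq by (rule decseqD)

lemma t_1_le: "i \<ge> 1 \<Longrightarrow> t i \<le> 1 / 16"
  using t_antimono[of 1 i] t_Suc_le[of 0] by simp

text \<open>The saturation levels of the terms at least halve, since (N l)^2 >= 1024 \<rho>; the sum
  of all levels from some index on is therefore comparable with the first.\<close>

lemma b_t_Suc_le: "\<rho> ^ Suc l * t (Suc l) \<le> \<rho> ^ l * t l / 2"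
proof -
  have "\<rho> * t (Suc l) \<le> t l / 2"
    using N_sq_ge[of l] N_ge[of l] \<rho> t_pos[of l]
    by (simp add: t.simps(2) divide_simps)
  then have "\<rho> ^ l * (\<rho> * t (Suc l)) \<le> \<rho> ^ l * (t l / 2)"
    using \<rho> by (intro mult_left_mono) auto
  then show ?thesis by (simp add: mult_ac)
qed

lemma b_t_le: "\<rho> ^ (i + k) * t (i + k) \<le> \<rho> ^ i * t i * (1/2) ^ k"
proof (induction k)
  case (Suc k)
  then show ?case using b_t_Suc_le[of "i + k"] by simp
qed simp

lemma b_t_summable: "summable (\<lambda>k. \<rho> ^ (i + k) * t (i + k))"
  by (rule summable_comparison_test'[where g = "\<lambda>k. \<rho> ^ i * t i * (1/2) ^ k" and N = 0])
     (use b_t_le[of i] \<rho> in \<open>auto intro!: summable_mult simp: abs_mult less_imp_le\<close>)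

lemma b_t_suminf_le: "(\<Sum>k. \<rho> ^ (i + k) * t (i + k)) \<le> 2 * (\<rho> ^ i * t i)"
proof -
  have "(\<Sum>k. \<rho> ^ (i + k) * t (i + k)) \<le> (\<Sum>k. \<rho> ^ i * t i * (1/2) ^ k)"
    by (intro suminf_le b_t_le b_t_summable summable_mult summable_geometric) auto
  also have "\<dots> = 2 * (\<rho> ^ i * t i)"
    by (subst suminf_mult) (auto simp: suminf_geometric)
  finally show ?thesis .
qed

section \<open>Convergence of the series on a sector\<close>

lemma norm_sq_1_plus:
  assumes "\<tau> > 0"
  shows "(cmod (1 + \<zeta> / of_real \<tau>))\<^sup>2 = 1 + 2 * Re \<zeta> / \<tau> + (cmod \<zeta>)\<^sup>2 / \<tau>\<^sup>2"
  using assms unfolding cmod_power2 by (simp add: power2_eq_square field_simps)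

text \<open>With u = |\<zeta>| / \<tau> the cross term is at least -u/2, and 2 u <= u^2 + 1.\<close>

lemma norm_sq_1_plus_ge:
  assumes "\<tau> > 0" "Re \<zeta> \<ge> - cmod \<zeta> / 4"
  shows "3/4 * (1 + (cmod \<zeta>)\<^sup>2 / \<tau>\<^sup>2) \<le> (cmod (1 + \<zeta> / of_real \<tau>))\<^sup>2"
proof -
  define u where "u = cmod \<zeta> / \<tau>"
  have "- cmod \<zeta> / 4 * (2 / \<tau>) \<le> Re \<zeta> * (2 / \<tau>)" using assms by (intro mult_right_mono) auto
  then have "- u / 2 \<le> 2 * Re \<zeta> / \<tau>" by (simp add: u_def field_simps)
  moreover have "0 \<le> (u - 1)\<^sup>2" by simp
  then have "2 * u \<le> u\<^sup>2 + 1" by (simp add: power2_diff)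
  ultimately have "3/4 * (1 + u\<^sup>2) \<le> 1 + 2 * Re \<zeta> / \<tau> + u\<^sup>2" by argo
  then show ?thesis unfolding norm_sq_1_plus[OF assms(1)] by (simp add: u_def power_divide)
qed

lemma norm_sq_1_plus_le:
  assumes "\<tau> > 0"
  shows "(cmod (1 + \<zeta> / of_real \<tau>))\<^sup>2 \<le> 2 * (1 + (cmod \<zeta>)\<^sup>2 / \<tau>\<^sup>2)"
proof -
  define u where "u = cmod \<zeta> / \<tau>"
  have "cmod (1 + \<zeta> / of_real \<tau>) \<le> 1 + u"
    using norm_triangle_ineq[of 1 "\<zeta> / of_real \<tau>"] assms by (simp add: u_def norm_divide)
  then have "(cmod (1 + \<zeta> / of_real \<tau>))\<^sup>2 \<le> (1 + u)\<^sup>2" by (intro power_mono) auto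
  also have "\<dots> \<le> 2 * (1 + u\<^sup>2)"
    using sum_squares_bound[of 1 u] by (simp add: power2_sum)
  finally show ?thesis by (simp add: u_def power_divide)
qed

text \<open>Contains the closed right half-plane except 0, with room beyond it, so that
  \<open>\<Psi> (1 - z)\<close> continues across the unit circle away from 1. The slope 1/4 is that
  of \<open>norm_sq_1_plus_ge\<close>.\<close>

definition sector :: "complex set" where
  "sector = {\<zeta>. Re \<zeta> > - cmod \<zeta> / 4}"

lemma open_sector: "open sector"
  unfolding sector_def by (intro open_Collect_less continuous_intros) auto

lemma Re_pos_sector: "Re \<zeta> > 0 \<Longrightarrow> \<zeta> \<in> sector"
  by (auto simp: sector_def intro: le_less_trans[of _ 0])

lemma sector_nz:
  assumes "\<zeta> \<in> sector" "\<tau> > 0"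
  shows "1 + \<zeta> / of_real \<tau> \<noteq> 0"
proof -
  have "0 < 3/4 * (1 + (cmod \<zeta>)\<^sup>2 / \<tau>\<^sup>2)" by (intro mult_pos_pos add_pos_nonneg) auto
  also have "\<dots> \<le> (cmod (1 + \<zeta> / of_real \<tau>))\<^sup>2"
    using assms by (intro norm_sq_1_plus_ge) (auto simp: sector_def)
  finally show ?thesis by auto
qed

text \<open>Saturation: on the whole sector |1 + \<zeta> / t l| is at least half of |\<zeta>| / t
  l.\<close>

lemma norm_g_le:
  assumes "\<zeta> \<in> sector"
  shows "cmod (g l \<zeta>) \<le> 2 * (\<rho> ^ l * t l)"
proof -
  define u where "u = cmod \<zeta> / t l"
  have nz: "1 + \<zeta> / of_real (t l) \<noteq> 0" by (rule sector_nz[OF assms t_pos])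
  have "3/4 * (1 + u\<^sup>2) \<le> (cmod (1 + \<zeta> / of_real (t l)))\<^sup>2"
    using norm_sq_1_plus_ge[of "t l" \<zeta>] assms by (simp add: u_def power_divide sector_def)
  moreover have "0 \<le> (cmod (1 + \<zeta> / of_real (t l)))\<^sup>2" by simp
  ultimately have "u\<^sup>2 \<le> 4 * (cmod (1 + \<zeta> / of_real (t l)))\<^sup>2" by argo
  then have "u\<^sup>2 \<le> (2 * cmod (1 + \<zeta> / of_real (t l)))\<^sup>2" by (simp add: power_mult_distrib)
  then have "u \<le> 2 * cmod (1 + \<zeta> / of_real (t l))" by (rule power2_le_imp_le) simp
  then have "cmod \<zeta> \<le> 2 * t l * cmod (1 + \<zeta> / of_real (t l))" by (simp add: u_def field_simps)
  then have "cmod (\<zeta> / (1 + \<zeta> / of_real (t l))) \<le> 2 * t l"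
    using nz by (simp add: norm_divide divide_le_eq)
  then have "\<rho> ^ l * cmod (\<zeta> / (1 + \<zeta> / of_real (t l))) \<le> \<rho> ^ l * (2 * t l)"
    using \<rho> by (intro mult_left_mono) auto
  moreover have "cmod (g l \<zeta>) = \<rho> ^ l * cmod (\<zeta> / (1 + \<zeta> / of_real (t l)))"
    unfolding g_def norm_mult norm_of_real using \<rho> by simp
  ultimately show ?thesis by simp
qed

lemma summable_g:
  assumes "\<zeta> \<in> sector"
  shows "summable (\<lambda>l. g l \<zeta>)" "summable (\<lambda>l. cmod (g l \<zeta>))"
proof -
  show "summable (\<lambda>l. cmod (g l \<zeta>))"
    by (rule summable_comparison_test'[where g = "\<lambda>l. 2 * (\<rho> ^ l * t l)" and N = 0])
       (use norm_g_le[OF assms] b_t_summable[of 0] in \<open>auto intro: summable_mult\<close>)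
  then show "summable (\<lambda>l. g l \<zeta>)" by (rule summable_norm_cancel)
qed

lemma norm_\<Psi>_le:
  assumes "\<zeta> \<in> sector"
  shows "cmod (\<Psi> \<zeta>) \<le> 16"
proof -
  have "cmod (\<Psi> \<zeta>) \<le> (\<Sum>l. cmod (g l \<zeta>))" unfolding \<Psi>_def by (intro summable_norm summable_g assms)
  also have "\<dots> \<le> (\<Sum>l. 2 * (\<rho> ^ (0 + l) * t (0 + l)))"
    using b_t_summable[of 0] norm_g_le[OF assms]
    by (intro suminf_le summable_g[OF assms] summable_mult) auto
  also have "\<dots> = 2 * (\<Sum>l. \<rho> ^ (0 + l) * t (0 + l))" by (intro suminf_mult b_t_summable)
  also have "\<dots> \<le> 2 * (2 * (\<rho> ^ 0 * t 0))" by (intro mult_left_mono b_t_suminf_le) auto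
  finally show ?thesis by simp
qed

lemma Re_\<Psi>: "\<zeta> \<in> sector \<Longrightarrow> Re (\<Psi> \<zeta>) = (\<Sum>l. Re (g l \<zeta>))" "\<zeta> \<in> sector \<Longrightarrow> summable (\<lambda>l. Re (g l \<zeta>))"
  unfolding \<Psi>_def using summable_g by (auto simp: Re_suminf summable_Re)

lemma Re_of_real_mult: "Re (of_real r * w) = r * Re w"
  by simp

lemma Re_g: "Re (g l \<zeta>) = \<rho> ^ l * ((Re \<zeta> + (cmod \<zeta>)\<^sup>2 / t l) / (cmod (1 + \<zeta> / of_real (t l)))\<^sup>2)"
proof -
  have "\<zeta> / (1 + \<zeta> / of_real (t l)) =
      \<zeta> * cnj (1 + \<zeta> / of_real (t l)) / of_real ((cmod (1 + \<zeta> / of_real (t l)))\<^sup>2)"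
    by (rule complex_div_cnj)
  then have "Re (\<zeta> / (1 + \<zeta> / of_real (t l))) =
      Re (\<zeta> * cnj (1 + \<zeta> / of_real (t l))) / (cmod (1 + \<zeta> / of_real (t l)))\<^sup>2"
    by (simp only: Re_divide_of_real)
  also have "Re (\<zeta> * cnj (1 + \<zeta> / of_real (t l))) = Re \<zeta> + (cmod \<zeta>)\<^sup>2 / t l"
    using t_pos[of l] unfolding cmod_power2 by (simp add: power2_eq_square field_simps)
  finally show ?thesis unfolding g_def Re_of_real_mult by simp
qed

lemma \<Psi>_holomorphic: "\<Psi> holomorphic_on sector"
proof (rule holomorphic_uniform_sequence[OF open_sector])
  show "(\<lambda>\<zeta>. \<Sum>l<n. g l \<zeta>) holomorphic_on sector" for n
    unfolding g_def by (intro holomorphic_intros) (auto simp: sector_nz)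
  have "uniform_limit sector (\<lambda>n \<zeta>. \<Sum>l<n. g l \<zeta>) \<Psi> sequentially"
    unfolding \<Psi>_def[abs_def]
    by (rule Weierstrass_m_test[where M = "\<lambda>l. 2 * (\<rho> ^ l * t l)"])
       (use norm_g_le b_t_summable[of 0] in \<open>auto intro: summable_mult\<close>)
  moreover fix x assume "x \<in> sector"
  then obtain d where "0 < d" "cball x d \<subseteq> sector" using open_sector open_contains_cball by blast
  ultimately show "\<exists>d>0. cball x d \<subseteq> sector \<and> uniform_limit (cball x d) (\<lambda>n \<zeta>. \<Sum>l<n. g l \<zeta>) \<Psi> sequentially"
    using uniform_limit_on_subset by blast
qed

lemma Re_\<Psi>_pos:
  assumes "Re \<zeta> > 0"
  shows "Re (\<Psi> \<zeta>) > 0"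
proof -
  have s: "\<zeta> \<in> sector" by (rule Re_pos_sector[OF assms])
  have "Re (g l \<zeta>) > 0" for l
    unfolding Re_g using assms sector_nz[OF s t_pos[of l]] t_pos[of l] \<rho>
    by (intro mult_pos_pos divide_pos_pos add_pos_nonneg divide_nonneg_pos) auto
  then show ?thesis unfolding Re_\<Psi>(1)[OF s] by (intro suminf_pos Re_\<Psi>(2)[OF s])
qed

text \<open>In what follows \<open>\<zeta> = 1 - z\<close> may lie slightly outside the right half-plane.\<close>

lemma W_le_1: "1 - z \<in> sector \<Longrightarrow> cmod (W z) \<le> 1"
  using norm_\<Psi>_le[of "1 - z"] by (simp add: W_def norm_divide)

text \<open>Both come from |1 + W|^2 - |1 - W|^2 = 4 Re W; the estimate also uses |W| <= 1.\<close>

lemma one_minus_\<phi>_sq: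
  assumes "1 - z \<in> sector" "Re (W z) > 0"
  shows "Re (W z) \<le> 1 - (cmod (\<phi> z))\<^sup>2" "1 - (cmod (\<phi> z))\<^sup>2 = 4 * Re (W z) / (cmod (1 + W z))\<^sup>2"
proof -
  have nz: "1 + W z \<noteq> 0" using assms(2) by (auto simp: complex_eq_iff)
  have "(cmod (\<phi> z))\<^sup>2 = (cmod (1 - W z))\<^sup>2 / (cmod (1 + W z))\<^sup>2"
    by (simp add: \<phi>_def norm_divide power_divide)
  moreover have "(cmod (1 + W z))\<^sup>2 - (cmod (1 - W z))\<^sup>2 = 4 * Re (W z)"
    unfolding cmod_power2 by (simp add: power2_eq_square algebra_simps)
  then have "(cmod (1 - W z))\<^sup>2 = (cmod (1 + W z))\<^sup>2 - 4 * Re (W z)" by simp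
  ultimately show eq: "1 - (cmod (\<phi> z))\<^sup>2 = 4 * Re (W z) / (cmod (1 + W z))\<^sup>2"
    using nz by (simp add: diff_divide_distrib)
  have "cmod (1 + W z) \<le> 2"
    using norm_triangle_ineq[of 1 "W z"] W_le_1[OF assms(1)] by simp
  then have "(cmod (1 + W z))\<^sup>2 \<le> 2\<^sup>2" by (intro power_mono) auto
  then have "4 * Re (W z) / 4 \<le> 4 * Re (W z) / (cmod (1 + W z))\<^sup>2"
    using assms nz by (intro divide_left_mono) auto
  then show "Re (W z) \<le> 1 - (cmod (\<phi> z))\<^sup>2" unfolding eq by simp
qed

section \<open>The symbol as a self-map of the disc\<close>

lemma \<phi>_holomorphic:
  assumes "\<And>z. z \<in> S \<Longrightarrow> 1 - z \<in> sector" "\<And>z. z \<in> S \<Longrightarrow> Re (W z) > 0"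
  shows "\<phi> holomorphic_on S"
proof -
  have "(\<lambda>z. \<Psi> (1 - z)) holomorphic_on S"
    using holomorphic_on_compose_gen[of "\<lambda>z. 1 - z" S \<Psi> sector, OF _ \<Psi>_holomorphic] assms(1)
    by (simp add: o_def image_subset_iff holomorphic_on_diff)
  moreover have "1 + W z \<noteq> 0" if "z \<in> S" for z
    using assms(2)[OF that] by (auto simp: complex_eq_iff)
  ultimately show ?thesis
    unfolding \<phi>_def[abs_def] W_def by (intro holomorphic_intros) auto
qed

lemma disc_Re_pos: "cmod z < 1 \<Longrightarrow> Re (1 - z) > 0"
  using complex_Re_le_cmod[of z] by simp

lemma Re_W_pos: "cmod z < 1 \<Longrightarrow> Re (W z) > 0"
  using Re_\<Psi>_pos[of "1 - z"] disc_Re_pos by (simp add: W_def)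

sublocale disc_self_map \<phi>
proof
  show "\<phi> holomorphic_on ball 0 1"
    by (rule \<phi>_holomorphic) (auto intro: Re_pos_sector Re_W_pos disc_Re_pos)
  fix z :: complex assume "cmod z < 1"
  then have "0 < 1 - (cmod (\<phi> z))\<^sup>2"
    using one_minus_\<phi>_sq(1)[OF Re_pos_sector[OF disc_Re_pos]] Re_W_pos[of z] by fastforce
  then show "cmod (\<phi> z) < 1" by (simp add: abs_square_less_1)
qed

lemma sum_powers_le: "(\<Sum>l\<le>m. \<rho> ^ l) \<le> \<rho> / (\<rho> - 1) * \<rho> ^ m"
proof -
  have "(\<Sum>l\<le>m. \<rho> ^ l) = (\<rho> ^ Suc m - 1) / (\<rho> - 1)"
    using geometric_sum[of \<rho> "Suc m"] \<rho> by (simp add: lessThan_Suc_atMost)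
  also have "\<dots> \<le> \<rho> ^ Suc m / (\<rho> - 1)" using \<rho> by (intro divide_right_mono) auto
  finally show ?thesis by simp
qed

text \<open>At the real point \<zeta> = t i all terms are positive and the term with index i alone
  equals \<rho>^i t i / 2. The decay \<rho>^(-i) of the upper bound originates here.\<close>

lemma near_1_factor_le:
  assumes "i \<ge> 1"
  shows "8 * t i / (1 - cmod (\<phi> (of_real (1 - t i)))) \<le> 256 / \<rho> ^ i"
proof -
  let ?\<tau> = "t i" let ?\<zeta> = "of_real (t i) :: complex" let ?z = "of_real (1 - t i) :: complex"
  have "cmod ?z = \<bar>1 - t i\<bar>" by (rule norm_of_real)
  then have z: "1 - ?z = ?\<zeta>" "cmod ?z < 1" using t_1_le[OF assms] t_pos[of i] by auto
  have s: "?\<zeta> \<in> sector" by (rule Re_pos_sector) simp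
  have real_g: "g l ?\<zeta> = of_real (\<rho> ^ l * (t i / (1 + t i / t l)))" for l by (simp add: g_def)
  have "Im (\<Psi> ?\<zeta>) = (\<Sum>l. Im (g l ?\<zeta>))"
    unfolding \<Psi>_def by (rule Im_suminf[OF summable_g(1)[OF s]])
  then have Im0: "Im (W ?z) = 0" by (simp add: W_def z(1) real_g)
  have "\<rho> ^ i * t i / 2 = (\<Sum>l\<in>{i}. Re (g l ?\<zeta>))" using t_pos[of i] by (simp add: real_g)
  also have "\<dots> \<le> Re (\<Psi> ?\<zeta>)"
    unfolding Re_\<Psi>(1)[OF s] using \<rho> t_pos
    by (intro sum_le_suminf Re_\<Psi>(2)[OF s]) (auto simp: real_g less_imp_le intro!: mult_nonneg_nonneg divide_nonneg_pos add_pos_pos divide_pos_pos)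
  finally have W_ge: "\<rho> ^ i * t i / 32 \<le> Re (W ?z)" by (simp add: W_def z(1) mult.commute)
  define w where "w = Re (W ?z)"
  have Ww: "W ?z = of_real w" using Im0 by (simp add: w_def complex_eq_iff)
  have w: "0 < w" "w \<le> 1"
    using Re_W_pos[OF z(2)] W_le_1[of ?z] s z(1) unfolding Ww by (auto simp: w_def)
  have "\<phi> ?z = of_real ((1 - w) / (1 + w))" unfolding \<phi>_def Ww by simp
  then have "cmod (\<phi> ?z) = \<bar>(1 - w) / (1 + w)\<bar>" by (simp only: norm_of_real)
  also have "\<dots> = (1 - w) / (1 + w)" using w by simp
  also have "\<dots> \<le> 1 - w"
    using w mult_left_mono[of 1 "1 + w" "1 - w"] by (simp add: divide_le_eq)
  finally have "\<rho> ^ i * t i / 32 \<le> 1 - cmod (\<phi> ?z)" using W_ge by (simp add: w_def)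
  then have "8 * t i / (1 - cmod (\<phi> ?z)) \<le> 8 * t i / (\<rho> ^ i * t i / 32)"
    using \<rho> less_imp_le[OF t_pos[of i]] self_map[OF z(2)] by (intro divide_left_mono mult_pos_pos) auto
  also have "\<dots> = 256 / \<rho> ^ i" using less_imp_neq[OF t_pos[of i]] by (simp add: field_simps)
  finally show ?thesis .
qed

text \<open>Measures, in units of 1 / N, how far beyond the imaginary axis positivity is preserved.
  It makes the total loss in \<open>Re_\<Psi>_ge_aux\<close> equal to 3/16, half of the gain 3/8
  obtained there.\<close>

definition c :: real where "c = 9 / 64 * ((\<rho> - 1) / \<rho>)"

lemma c_bounds: "0 < c" "c \<le> 1/4" "4/3 * c * (\<rho> / (\<rho> - 1)) = 3/16"
proof -
  have "(\<rho> - 1) / \<rho> \<le> 1" using \<rho> by simp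
  then have "9/64 * ((\<rho> - 1) / \<rho>) \<le> 9/64 * 1" by (intro mult_left_mono) auto
  then show "c \<le> 1/4" unfolding c_def by linarith
  show "0 < c" using \<rho> by (simp add: c_def)
  have "4/3 * (9/64 * x) * y = 3/16 * (x * y)" for x y :: real by simp
  then have "4/3 * c * (\<rho> / (\<rho> - 1)) = 3/16 * ((\<rho> - 1) / \<rho> * (\<rho> / (\<rho> - 1)))"
    by (simp only: c_def)
  also have "(\<rho> - 1) / \<rho> * (\<rho> / (\<rho> - 1)) = 1" using \<rho> by simp
  finally show "4/3 * c * (\<rho> / (\<rho> - 1)) = 3/16" by simp
qed

text \<open>The negative contribution of \<open>Re \<zeta>\<close> comes from the terms with \<open>t l \<ge> \<bar>\<zeta>\<bar>\<close>; it is absorbed by the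
  two terms adjacent to \<open>\<bar>\<zeta>\<bar>\<close>, whose sum is at least of size \<open>\<bar>\<zeta>\<bar> / N m\<close> by the AM-GM inequality.\<close>

lemma Re_\<Psi>_ge_aux:
  assumes \<zeta>: "t (Suc m) \<le> cmod \<zeta>" "cmod \<zeta> \<le> t m" "Re \<zeta> > - (c / N m) * cmod \<zeta>"
  shows "3/16 * cmod \<zeta> / N m \<le> Re (\<Psi> \<zeta>)"
proof -
  define s where "s = cmod \<zeta>"
  define x where "x = Re \<zeta>"
  have s: "0 < s" using \<zeta>(1) t_pos[of "Suc m"] unfolding s_def by linarith
  have cN: "0 \<le> c / N m" "c / N m \<le> 1/4"
  proof -
    show "0 \<le> c / N m" using c_bounds N_ge[of m] by simp
    have "c / N m \<le> c / 1" using c_bounds N_ge[of m] by (intro divide_left_mono) auto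
    also have "\<dots> \<le> 1/4" using c_bounds(2) by simp
    finally show "c / N m \<le> 1/4" .
  qed
  have x: "x > - (c / N m) * s" using \<zeta>(3) by (simp add: x_def s_def)
  have "(c / N m) * s \<le> (1/4) * s" using cN s by (intro mult_right_mono) auto
  with x have x4: "x > - s / 4" by linarith
  then have sec: "\<zeta> \<in> sector" by (simp add: sector_def x_def s_def)
  define d where "d l = (cmod (1 + \<zeta> / of_real (t l)))\<^sup>2" for l
  have d: "3/4 * (1 + s\<^sup>2 / (t l)\<^sup>2) \<le> d l" "d l \<le> 2 * (1 + s\<^sup>2 / (t l)\<^sup>2)" "3/4 \<le> d l" for l
  proof -
    show 1: "3/4 * (1 + s\<^sup>2 / (t l)\<^sup>2) \<le> d l"
      using norm_sq_1_plus_ge[of "t l" \<zeta>] x4 by (simp add: d_def s_def x_def)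
    show "d l \<le> 2 * (1 + s\<^sup>2 / (t l)\<^sup>2)"
      using norm_sq_1_plus_le[of "t l" \<zeta>] by (simp add: d_def s_def)
    show "3/4 \<le> d l" by (rule order_trans[OF _ 1]) simp
  qed
  have Rg: "Re (g l \<zeta>) = \<rho> ^ l * ((x + s\<^sup>2 / t l) / d l)" for l
    by (simp add: Re_g x_def s_def d_def)
  define n where "n = (c / N m) * s"
  have n: "0 \<le> n" "x \<ge> - n" using mult_nonneg_nonneg[OF cN(1) less_imp_le[OF s]] x by (simp_all add: n_def)
  \<comment> \<open>The factor 4/3 is the reciprocal of the lower bound 3/4 for
    \<open>d l\<close>.\<close>
  have neg: "- (4/3) * n \<le> x / d l" for l
  proof -
    have dl: "0 < d l" using d(3)[of l] by linarith
    have "4/3 * n * (3/4) \<le> 4/3 * n * d l" using n d(3)[of l] by (intro mult_left_mono) auto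
    then have "- (4/3) * n * d l \<le> x" using n by linarith
    then show ?thesis using dl by (simp add: le_divide_eq)
  qed
  have low: "Re (g l \<zeta>) \<ge> - (4/3) * n * \<rho> ^ l" for l
  proof -
    have "x / d l \<le> (x + s\<^sup>2 / t l) / d l" using d(3)[of l] t_pos[of l] by (intro divide_right_mono) auto
    with neg[of l] have "- (4/3) * n \<le> (x + s\<^sup>2 / t l) / d l" by linarith
    from mult_left_mono[OF this, of "\<rho> ^ l"] show ?thesis using \<rho> by (simp add: Rg mult_ac)
  qed
  have at_m: "Re (g m \<zeta>) \<ge> - (4/3) * n * \<rho> ^ m + \<rho> ^ m * (s\<^sup>2 / (4 * t m))"
  proof -
    have "s\<^sup>2 / (t m)\<^sup>2 \<le> 1" using \<zeta>(2) s t_pos[of m] by (simp add: s_def power_mono)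
    then have "2 * (1 + s\<^sup>2 / (t m)\<^sup>2) \<le> 4" by argo
    with d(2)[of m] have "d m \<le> 4" by (rule order_trans)
    then have "s\<^sup>2 / t m / 4 \<le> s\<^sup>2 / t m / d m"
      using d(3)[of m] t_pos[of m] by (intro divide_left_mono) auto
    with neg[of m] have "- (4/3) * n + s\<^sup>2 / (4 * t m) \<le> (x + s\<^sup>2 / t m) / d m"
      by (simp add: add_divide_distrib mult.commute)
    from mult_left_mono[OF this, of "\<rho> ^ m"] show ?thesis using \<rho> by (simp add: Rg algebra_simps)
  qed
  have num: "x + s\<^sup>2 / t l \<ge> 3/4 * (s\<^sup>2 / t l)" if "l > m" for l
  proof -
    have "t l \<le> s" using t_antimono[of "Suc m" l] \<zeta>(1) that by (simp add: s_def)
    then have "s * t l \<le> s * s" using s by (intro mult_left_mono) auto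
    then have "s \<le> s\<^sup>2 / t l" using t_pos[of l] by (simp add: le_divide_eq power2_eq_square)
    with x4 show ?thesis by linarith
  qed
  have high: "Re (g l \<zeta>) \<ge> 0" if "l > m" for l
  proof -
    have "0 \<le> x + s\<^sup>2 / t l" by (rule order_trans[OF _ num[OF that]]) simp
    then show ?thesis unfolding Rg using \<rho> d(3)[of l]
      by (intro mult_nonneg_nonneg divide_nonneg_nonneg) auto
  qed
  have at_Sm: "Re (g (Suc m) \<zeta>) \<ge> \<rho> ^ m * (3/16 * t (Suc m))"
  proof -
    let ?t = "t (Suc m)"
    have "1 \<le> s\<^sup>2 / ?t\<^sup>2" using \<zeta>(1) t_pos[of "Suc m"] by (simp add: s_def power_mono)
    then have "2 * (1 + s\<^sup>2 / ?t\<^sup>2) \<le> 4 * (s\<^sup>2 / ?t\<^sup>2)" by argo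
    with d(2)[of "Suc m"] have "d (Suc m) \<le> 4 * (s\<^sup>2 / ?t\<^sup>2)" by (rule order_trans)
    moreover have nm: "3/4 * (s\<^sup>2 / ?t) \<le> x + s\<^sup>2 / ?t" by (rule num) simp
    moreover have "0 \<le> x + s\<^sup>2 / ?t" by (rule order_trans[OF _ nm]) simp
    moreover have "0 < d (Suc m)" using d(3)[of "Suc m"] by simp
    ultimately have "3/4 * (s\<^sup>2 / ?t) / (4 * (s\<^sup>2 / ?t\<^sup>2)) \<le> (x + s\<^sup>2 / ?t) / d (Suc m)"
      by (intro frac_le)
    moreover have "3/4 * (s\<^sup>2 / ?t) / (4 * (s\<^sup>2 / ?t\<^sup>2)) = 3/16 * ?t"
      using s t_pos[of "Suc m"] by (simp add: field_simps power2_eq_square)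
    ultimately have "3/16 * ?t \<le> (x + s\<^sup>2 / ?t) / d (Suc m)" by metis
    then have "\<rho> ^ Suc m * (3/16 * ?t) \<le> Re (g (Suc m) \<zeta>)"
      unfolding Rg by (rule mult_left_mono) (use \<rho> in simp)
    moreover have "\<rho> ^ m * (3/16 * ?t) \<le> \<rho> ^ Suc m * (3/16 * ?t)"
      using \<rho> t_pos[of "Suc m"] by (intro mult_right_mono power_increasing) auto
    ultimately show ?thesis by linarith
  qed
  have "(\<Sum>l\<le>m. - (4/3) * n * \<rho> ^ l) + \<rho> ^ m * (s\<^sup>2 / (4 * t m)) \<le> (\<Sum>l\<le>m. Re (g l \<zeta>))"
  proof -
    have "(\<Sum>l<m. - (4/3) * n * \<rho> ^ l) \<le> (\<Sum>l<m. Re (g l \<zeta>))" by (intro sum_mono low)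
    with at_m show ?thesis by (simp add: lessThan_Suc_atMost[symmetric])
  qed
  \<comment> \<open>The losses form a geometric sum dominated by its last term; by the choice of
    \<open>c\<close> they amount to at most half of the gain derived next.\<close>
  moreover have "(\<Sum>l\<le>m. - (4/3) * n * \<rho> ^ l) \<ge> - (3/16) * (\<rho> ^ m * (s / N m))"
  proof -
    have *: "4/3 * (c / y * s) * (r * p) = 4/3 * c * r * (p * (s / y))" for y r p :: real by simp
    have "4/3 * n * (\<Sum>l\<le>m. \<rho> ^ l) \<le> 4/3 * n * (\<rho> / (\<rho> - 1) * \<rho> ^ m)"
      using n by (intro mult_left_mono sum_powers_le) auto
    also have "\<dots> = 3/16 * (\<rho> ^ m * (s / N m))" unfolding n_def * c_bounds(3) ..
    finally have "- (3/16 * (\<rho> ^ m * (s / N m))) \<le> - (4/3 * n * (\<Sum>l\<le>m. \<rho> ^ l))" by simp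
    also have "\<dots> = (\<Sum>l\<le>m. - (4/3) * n * \<rho> ^ l)" by (simp add: sum_distrib_left sum_negf)
    finally show ?thesis by simp
  qed
  moreover have "3/8 * (\<rho> ^ m * (s / N m)) \<le> \<rho> ^ m * (s\<^sup>2 / (4 * t m)) + \<rho> ^ m * (3/16 * t (Suc m))"
  proof -
    define a where "a = s / t m"
    define b where "b = 1 / N m"
    have e: "t m * a\<^sup>2 = s\<^sup>2 / t m" "t m * b\<^sup>2 = t (Suc m)" "t m * (a * b) = s / N m"
      by (simp_all add: a_def b_def t.simps(2) power2_eq_square)
    have "2 * (a * b) \<le> a\<^sup>2 + b\<^sup>2" using sum_squares_bound[of a b] by (simp add: mult.assoc)
    then have "t m * (2 * (a * b)) \<le> t m * (a\<^sup>2 + b\<^sup>2)" by (intro mult_left_mono) auto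
    then have "2 * (t m * (a * b)) \<le> t m * a\<^sup>2 + t m * b\<^sup>2" by (simp only: distrib_left mult.left_commute)
    then have h: "2 * (s / N m) \<le> s\<^sup>2 / t m + t (Suc m)" unfolding e .
    have gen: "3/8 * q \<le> u / 4 + 3/16 * v" if "2 * q \<le> u + v" "0 \<le> u" for q u v :: real
      using that by linarith
    have "3/8 * (s / N m) \<le> (s\<^sup>2 / t m) / 4 + 3/16 * t (Suc m)"
      by (rule gen[OF h]) simp
    then have "\<rho> ^ m * (3/8 * (s / N m)) \<le> \<rho> ^ m * ((s\<^sup>2 / t m) / 4 + 3/16 * t (Suc m))"
      by (rule mult_left_mono) (use \<rho> in simp)
    also have "\<dots> = \<rho> ^ m * (s\<^sup>2 / (4 * t m)) + \<rho> ^ m * (3/16 * t (Suc m))"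
      by (simp add: distrib_left mult.commute)
    finally show ?thesis by (simp only: mult.left_commute)
  qed
  moreover have "3/16 * X \<le> S + G" if "L + U \<le> S" "L \<ge> - (3/16) * X" "3/8 * X \<le> U + V" "V \<le> G"
    for X S G L U V :: real using that by linarith
  ultimately have "3/16 * (\<rho> ^ m * (s / N m)) \<le> (\<Sum>l\<le>m. Re (g l \<zeta>)) + Re (g (Suc m) \<zeta>)"
    using at_Sm by blast
  also have "\<dots> = (\<Sum>l<Suc (Suc m). Re (g l \<zeta>))" by (simp add: lessThan_Suc_atMost)
  also have "\<dots> \<le> Re (\<Psi> \<zeta>)"
    unfolding Re_\<Psi>(1)[OF sec] using high by (intro sum_le_suminf Re_\<Psi>(2)[OF sec]) auto
  finally have "3/16 * (\<rho> ^ m * (s / N m)) \<le> Re (\<Psi> \<zeta>)" .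
  moreover have "1 * (s / N m) \<le> \<rho> ^ m * (s / N m)"
    using \<rho> s N_ge[of m] by (intro mult_right_mono) auto
  then have "3/16 * s / N m \<le> 3/16 * (\<rho> ^ m * (s / N m))" by simp
  ultimately show ?thesis unfolding s_def by (rule order_trans[rotated])
qed

text \<open>Apply \<open>Re_\<Psi>_ge_aux\<close> in the block that contains |\<zeta>|. Its index is
  at most i, and N is increasing, so the constants for i are the worse ones.\<close>

lemma Re_\<Psi>_ge:
  assumes \<zeta>: "t i \<le> cmod \<zeta>" "cmod \<zeta> \<le> 4" "Re \<zeta> > - (c / N i) * cmod \<zeta>"
  shows "3/16 * cmod \<zeta> / N i \<le> Re (\<Psi> \<zeta>)" "\<zeta> \<in> sector"
proof -
  have s: "0 < cmod \<zeta>" using \<zeta>(1) t_pos[of i] by linarith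
  have "c / N i \<le> c / 1" using c_bounds N_ge[of i] by (intro divide_left_mono) auto
  also have "\<dots> \<le> 1/4" using c_bounds(2) by simp
  finally have "c / N i * cmod \<zeta> \<le> 1/4 * cmod \<zeta>" by (intro mult_right_mono) auto
  moreover have "- (c / N i) * cmod \<zeta> = - (c / N i * cmod \<zeta>)" by (rule minus_mult_left[symmetric])
  ultimately have "- (cmod \<zeta> / 4) < Re \<zeta>" using \<zeta>(3) by linarith
  then show "\<zeta> \<in> sector" by (simp add: sector_def)
  \<comment> \<open>The upper end of this block comes from minimality, or from
    \<open>t 0 = 4\<close> if m is 0.\<close>
  define m where "m = (LEAST m. t (Suc m) \<le> cmod \<zeta>)"
  have ex: "t (Suc i) \<le> cmod \<zeta>" using \<zeta>(1) t_antimono[of i "Suc i"] by simp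
  then have 1: "t (Suc m) \<le> cmod \<zeta>" unfolding m_def by (rule LeastI)
  have mi: "m \<le> i" unfolding m_def by (rule Least_le) (rule ex)
  have 2: "cmod \<zeta> \<le> t m"
  proof (cases m)
    case (Suc k)
    then show ?thesis using not_less_Least[of k "\<lambda>m. t (Suc m) \<le> cmod \<zeta>"] by (simp add: m_def)
  qed (use \<zeta>(2) in simp)
  have Nmi: "N m \<le> N i" by (rule N_mono[OF mi])
  have "c / N i \<le> c / N m" using c_bounds Nmi N_ge[of m] by (intro divide_left_mono) auto
  then have "c / N i * cmod \<zeta> \<le> c / N m * cmod \<zeta>" by (intro mult_right_mono) auto
  then have "- (c / N m) * cmod \<zeta> < Re \<zeta>" using \<zeta>(3) by simp
  from Re_\<Psi>_ge_aux[OF 1 2 this] have "3/16 * cmod \<zeta> / N m \<le> Re (\<Psi> \<zeta>)" .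
  moreover have "3/16 * cmod \<zeta> / N i \<le> 3/16 * cmod \<zeta> / N m"
    using Nmi N_ge[of m] by (intro divide_left_mono) auto
  ultimately show "3/16 * cmod \<zeta> / N i \<le> Re (\<Psi> \<zeta>)" by linarith
qed

text \<open>Near 1 the factor 256 / \<rho>^i becomes small; away from 1 the bound
  \<open>Re_\<Psi>_ge\<close> keeps \<open>\<phi>\<close> in a smaller disc.\<close>

lemma compact_comp_op_\<phi>: "compact_op (comp_op \<phi>)"
proof (rule compact_comp_op)
  fix \<eta> :: real assume "\<eta> > 0"
  obtain i where "256 / \<eta> < \<rho> ^ i" using real_arch_pow[OF \<rho>] by blast
  also have "\<rho> ^ i \<le> \<rho> ^ Suc i" using \<rho> by (intro power_increasing) auto
  finally have i: "256 / \<rho> ^ Suc i \<le> \<eta>" using \<open>\<eta> > 0\<close> \<rho> by (simp add: field_simps)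
  define R where "R = 3/16 * t (Suc i) / N (Suc i) / 16"
  have "R > 0" unfolding R_def using t_pos N_ge by (intro divide_pos_pos mult_pos_pos) auto
  have "cmod (\<phi> z) \<le> sqrt (1 - R)" if z: "cmod z < 1" "t (Suc i) \<le> cmod (1 - z)" for z
  proof -
    have 1: "cmod (1 - z) \<le> 4" using norm_triangle_ineq4[of 1 z] z by simp
    have "0 \<le> c / N (Suc i) * cmod (1 - z)" using c_bounds N_ge[of "Suc i"] by simp
    then have 2: "Re (1 - z) > - (c / N (Suc i)) * cmod (1 - z)" using disc_Re_pos[OF z(1)] by linarith
    have "3/16 * t (Suc i) / N (Suc i) \<le> 3/16 * cmod (1 - z) / N (Suc i)"
      using z N_ge[of "Suc i"] by (intro divide_right_mono) auto
    also have "\<dots> \<le> Re (\<Psi> (1 - z))" by (rule Re_\<Psi>_ge(1)[OF z(2) 1 2])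
    finally have "R \<le> Re (W z)" by (simp add: W_def R_def)
    also have "\<dots> \<le> 1 - (cmod (\<phi> z))\<^sup>2"
      by (rule one_minus_\<phi>_sq[OF Re_pos_sector[OF disc_Re_pos[OF z(1)]] Re_W_pos[OF z(1)]])
    finally show ?thesis by (intro real_le_rsqrt) simp
  qed
  moreover have "sqrt (1 - R) < 1" using \<open>R > 0\<close> by simp
  moreover have "8 * t (Suc i) / (1 - cmod (\<phi> (of_real (1 - t (Suc i))))) \<le> \<eta>"
    using near_1_factor_le[of "Suc i"] i by simp
  moreover have "t (Suc i) \<le> 1" using t_1_le[of "Suc i"] by simp
  ultimately show "\<exists>\<tau> \<rho>. 0 < \<tau> \<and> \<tau> \<le> 1 \<and> 8 * \<tau> / (1 - cmod (\<phi> (of_real (1 - \<tau>)))) \<le> \<eta> \<and>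
      \<rho> < 1 \<and> (\<forall>z. cmod z < 1 \<longrightarrow> \<tau> \<le> cmod (1 - z) \<longrightarrow> cmod (\<phi> z) \<le> \<rho>)"
    using t_pos[of "Suc i"] by blast
qed

end

section \<open>Lower bound for the singular numbers\<close>

text \<open>Schur's test for the Gram matrix without its diagonal: \<open>E\<close> bounds the
  absolute row sums and hence the quadratic form \<open>R\<close>.\<close>

lemma almost_orthogonal_bounds:
  fixes v :: "nat \<Rightarrow> hardy2" and c :: "nat \<Rightarrow> complex"
  assumes off: "\<And>i. i \<le> n \<Longrightarrow> (\<Sum>j\<in>{..n}-{i}. cmod (hinner (v i) (v j))) \<le> E"
  defines "f \<equiv> \<Sum>j\<le>n. hscale (c j) (v j)"
  shows "(\<And>i. i \<le> n \<Longrightarrow> (norm (v i))\<^sup>2 \<le> D) \<Longrightarrow> (norm f)\<^sup>2 \<le> (D + E) * (\<Sum>j\<le>n. (cmod (c j))\<^sup>2)"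
    and "(\<And>i. i \<le> n \<Longrightarrow> D \<le> (norm (v i))\<^sup>2) \<Longrightarrow> (D - E) * (\<Sum>j\<le>n. (cmod (c j))\<^sup>2) \<le> (norm f)\<^sup>2"
proof -
  define H where "H i j = (if i = j then 0 else hinner (v i) (v j))" for i j
  have H_sym: "cmod (H i j) = cmod (H j i)" for i j
    using hinner_commute[of "v i" "v j"] by (simp add: H_def)
  have H_sum: "(\<Sum>j\<le>n. cmod (H i j)) \<le> E" if "i \<le> n" for i
  proof -
    have "(\<Sum>j\<le>n. cmod (H i j)) = (\<Sum>j\<in>{..n}-{i}. cmod (hinner (v i) (v j)))"
      by (rule sum.mono_neutral_cong_right) (auto simp: H_def)
    then show ?thesis using off[OF that] by simp
  qed
  define R where "R = (\<Sum>i\<le>n. \<Sum>j\<le>n. c i * (cnj (c j) * H i j))"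
  have "hinner f f = (\<Sum>i\<le>n. c i * hinner (v i) f)"
    by (subst f_def) (simp add: hinner_sum_left hinner_scale_left)
  also have "\<dots> = (\<Sum>i\<le>n. c i * (\<Sum>j\<le>n. cnj (c j) * hinner (v i) (v j)))"
    by (simp add: f_def hinner_sum_right hinner_scale_right)
  also have "\<dots> = (\<Sum>i\<le>n. c i * (\<Sum>j\<le>n. cnj (c j) * H i j + (if i = j then cnj (c i) * hinner (v i) (v i) else 0)))"
    by (intro sum.cong refl arg_cong2[where f = times]) (auto simp: H_def)
  also have "\<dots> = R + (\<Sum>i\<le>n. c i * (cnj (c i) * hinner (v i) (v i)))"
    by (simp add: R_def sum.distrib distrib_left sum_distrib_left)
  also have "(\<Sum>i\<le>n. c i * (cnj (c i) * hinner (v i) (v i))) =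
      of_real (\<Sum>i\<le>n. (cmod (c i))\<^sup>2 * (norm (v i))\<^sup>2)"
    unfolding hinner_self_norm of_real_sum of_real_mult complex_norm_square by (simp add: mult_ac)
  finally have eq: "of_real ((norm f)\<^sup>2) = R + of_real (\<Sum>i\<le>n. (cmod (c i))\<^sup>2 * (norm (v i))\<^sup>2)"
    unfolding hinner_self_norm .
  define S where "S = (\<Sum>i\<le>n. (cmod (c i))\<^sup>2 * (norm (v i))\<^sup>2)"
  \<comment> \<open>AM-GM separates the two coefficients; as |H i j| is symmetric, the resulting
    halves coincide.\<close>
  have "cmod R \<le> (\<Sum>i\<le>n. \<Sum>j\<le>n. ((cmod (c i))\<^sup>2 + (cmod (c j))\<^sup>2) / 2 * cmod (H i j))"
    unfolding R_def
  proof (intro order_trans[OF norm_sum] sum_mono)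
    fix i j
    have "cmod (c i) * cmod (c j) \<le> ((cmod (c i))\<^sup>2 + (cmod (c j))\<^sup>2) / 2"
      using sum_squares_bound[of "cmod (c i)" "cmod (c j)"] by simp
    then show "cmod (c i * (cnj (c j) * H i j)) \<le> ((cmod (c i))\<^sup>2 + (cmod (c j))\<^sup>2) / 2 * cmod (H i j)"
      unfolding norm_mult complex_mod_cnj mult.assoc[symmetric] by (intro mult_right_mono) auto
  qed
  also have "\<dots> = (\<Sum>i\<le>n. \<Sum>j\<le>n. (cmod (c i))\<^sup>2 / 2 * cmod (H i j)) + (\<Sum>i\<le>n. \<Sum>j\<le>n. (cmod (c j))\<^sup>2 / 2 * cmod (H i j))"
    by (simp add: sum.distrib[symmetric] add_divide_distrib distrib_right)
  also have "(\<Sum>i\<le>n. \<Sum>j\<le>n. (cmod (c j))\<^sup>2 / 2 * cmod (H i j)) = (\<Sum>i\<le>n. \<Sum>j\<le>n. (cmod (c i))\<^sup>2 / 2 * cmod (H i j))"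
    by (subst sum.swap) (simp add: H_sym)
  also have "(\<Sum>i\<le>n. \<Sum>j\<le>n. (cmod (c i))\<^sup>2 / 2 * cmod (H i j)) + (\<Sum>i\<le>n. \<Sum>j\<le>n. (cmod (c i))\<^sup>2 / 2 * cmod (H i j))
      = (\<Sum>i\<le>n. (cmod (c i))\<^sup>2 * (\<Sum>j\<le>n. cmod (H i j)))"
    unfolding sum.distrib[symmetric] sum_distrib_left by (intro sum.cong refl) simp
  also have "\<dots> \<le> (\<Sum>i\<le>n. (cmod (c i))\<^sup>2 * E)" using H_sum by (intro sum_mono mult_left_mono) auto
  finally have R: "cmod R \<le> E * (\<Sum>j\<le>n. (cmod (c j))\<^sup>2)"
    by (simp add: sum_distrib_left mult.commute)
  have nf: "(norm f)\<^sup>2 = Re R + S"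
    using arg_cong[OF eq, of Re] by (simp only: S_def plus_complex.sel Re_complex_of_real)
  have "\<bar>Re R\<bar> \<le> E * (\<Sum>j\<le>n. (cmod (c j))\<^sup>2)" using abs_Re_le_cmod[of R] R by linarith
  then have R_le: "Re R \<le> E * (\<Sum>j\<le>n. (cmod (c j))\<^sup>2)"
    and R_ge: "- (E * (\<Sum>j\<le>n. (cmod (c j))\<^sup>2)) \<le> Re R" by linarith+
  show "(norm f)\<^sup>2 \<le> (D + E) * (\<Sum>j\<le>n. (cmod (c j))\<^sup>2)" if "\<And>i. i \<le> n \<Longrightarrow> (norm (v i))\<^sup>2 \<le> D"
  proof -
    have "S \<le> D * (\<Sum>j\<le>n. (cmod (c j))\<^sup>2)"
      unfolding S_def sum_distrib_left using that by (intro sum_mono) (simp add: mult.commute[of D] mult_left_mono)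
    with R_le show ?thesis unfolding nf distrib_right by linarith
  qed
  show "(D - E) * (\<Sum>j\<le>n. (cmod (c j))\<^sup>2) \<le> (norm f)\<^sup>2" if "\<And>i. i \<le> n \<Longrightarrow> D \<le> (norm (v i))\<^sup>2"
  proof -
    have "D * (\<Sum>j\<le>n. (cmod (c j))\<^sup>2) \<le> S"
      unfolding S_def sum_distrib_left using that by (intro sum_mono) (simp add: mult.commute[of D] mult_left_mono)
    with R_ge show ?thesis unfolding nf left_diff_distrib by linarith
  qed
qed

text \<open>The indices to the left and to the right of i contribute one partial harmonic sum
  each.\<close>

lemma sum_inverse_dist_le:
  assumes "i \<le> n"
  shows "(\<Sum>j\<in>{..n}-{i}. 1 / \<bar>real i - real j\<bar>) \<le> 2 * (\<Sum>k=1..n. 1 / real k)"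
proof -
  have "(\<Sum>j\<in>{..n}-{i}. 1 / \<bar>real i - real j\<bar>) =
      (\<Sum>j\<in>{..<i}. 1 / \<bar>real i - real j\<bar>) + (\<Sum>j\<in>{i<..n}. 1 / \<bar>real i - real j\<bar>)"
    using assms by (subst sum.union_disjoint[symmetric]) (auto intro!: sum.cong)
  also have "(\<Sum>j\<in>{..<i}. 1 / \<bar>real i - real j\<bar>) = (\<Sum>k=1..i. 1 / real k)"
    by (rule sum.reindex_bij_witness[of _ "\<lambda>k. i - k" "\<lambda>j. i - j"]) (auto simp: of_nat_diff)
  also have "(\<Sum>j\<in>{i<..n}. 1 / \<bar>real i - real j\<bar>) = (\<Sum>k=1..n-i. 1 / real k)"
    by (rule sum.reindex_bij_witness[of _ "\<lambda>k. i + k" "\<lambda>j. j - i"]) (auto simp: of_nat_diff)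
  also have "(\<Sum>k=1..i. 1 / real k) \<le> (\<Sum>k=1..n. 1 / real k)"
    using assms by (intro sum_mono2) auto
  also have "(\<Sum>k=1..n-i. 1 / real k) \<le> (\<Sum>k=1..n. 1 / real k)"
    by (intro sum_mono2) auto
  finally show ?thesis by simp
qed

text \<open>Each dyadic block has 2^m terms below 2^(-m). The resulting m + 1 is the logarithm that
  cancels in \<open>sum_off_diagonal\<close>.\<close>

lemma harmonic_power2_le: "(\<Sum>k=1..2 ^ m. 1 / real k) \<le> real m + 1"
proof (induction m)
  case (Suc m)
  have "(\<Sum>k=1..2 ^ Suc m. 1 / real k) = (\<Sum>k=1..2 ^ m. 1 / real k) + (\<Sum>k\<in>{2 ^ m<..2 ^ Suc m}. 1 / real k)"
    by (subst sum.union_disjoint[symmetric]) (auto intro!: sum.cong)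
  also have "(\<Sum>k\<in>{2 ^ m<..2 ^ Suc m}. 1 / real k) \<le> (\<Sum>k\<in>{2 ^ m<..2 ^ Suc m :: nat}. 1 / 2 ^ m)"
  proof (intro sum_mono divide_left_mono)
    fix k :: nat assume "k \<in> {2 ^ m<..2 ^ Suc m}"
    then have "2 ^ m < k" by simp
    then have "real (2 ^ m) < real k" by (simp only: of_nat_less_iff)
    then show "2 ^ m \<le> real k" "0 < real k * 2 ^ m" by (auto intro!: mult_pos_pos simp: less_le_trans[OF _ less_imp_le])
  qed auto
  also have "(\<Sum>k\<in>{2 ^ m<..2 ^ Suc m :: nat}. 1 / 2 ^ m :: real) = 1" by simp
  finally show ?case using Suc by simp
qed simp

context lacunary_symbol begin

text \<open>Tested against f, both sides give \<open>hfun f (\<phi> a)\<close>.\<close>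

lemma hadjoint_hker:
  assumes "bounded_hop (comp_op \<phi>) C" "cmod a < 1"
  shows "hadjoint (comp_op \<phi>) (hker a) = hker (\<phi> a)"
proof -
  interpret bounded_hop "comp_op \<phi>" C by fact
  show ?thesis
  proof (rule hinner_eqI)
    fix f
    show "hinner f (hadjoint (comp_op \<phi>) (hker a)) = hinner f (hker (\<phi> a))"
      using assms(2) self_map[OF assms(2)]
      by (simp add: hinner_adjoint[symmetric] hinner_hker hfun_comp_op)
  qed
qed

section \<open>Kernels at the points of one block\<close>

lemma hinner_hker_hker:
  "cmod a < 1 \<Longrightarrow> cmod b < 1 \<Longrightarrow> hinner (hker a) (hker b) = 1 / (1 - cnj a * b)"
  by (simp add: hinner_hker hfun_hker)

text \<open>\<open>y\<close> is the geometric mean of \<open>t i\<close> and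
  \<open>t (Suc i)\<close>: at that distance from 1 the real contributions of the terms i and i + 1,
  of order \<rho>^i y^2 / t i and \<rho>^(i + 1) t (i + 1), balance up to a constant. The points
  have depth \<open>x\<close> and spacing y / 2^i = K (i + 1) x, so they are well separated relative
  to their depth.\<close>

context
  fixes i :: nat and x y :: real and \<zeta> z :: "nat \<Rightarrow> complex"
  assumes i: "i \<ge> 1"
  defines "x \<equiv> t (Suc i)" and "y \<equiv> t i / N i"
    and "\<zeta> \<equiv> \<lambda>j. Complex x (y * (1 + real j / 2 ^ i))" and "z \<equiv> \<lambda>j. 1 - \<zeta> j"
begin

lemma xy: "0 < x" "x \<le> 1/16" "t i \<le> 1/16" "y = N i * x" "y\<^sup>2 = t i * x" "0 < y" "x \<le> y" "y\<^sup>2 / t i = x"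
proof -
  show "0 < x" "x \<le> 1/16" "t i \<le> 1/16" using t_1_le[OF i] t_1_le[of "Suc i"] by (simp_all add: x_def)
  show y: "y = N i * x" using N_ge[of i] by (simp add: x_def y_def t.simps(2) power2_eq_square)
  show "y\<^sup>2 = t i * x" by (simp add: x_def y_def t.simps(2) power_divide power2_eq_square)
  then show "y\<^sup>2 / t i = x" by simp
  show "0 < y" using N_ge[of i] by (simp add: y_def)
  have "1 * x \<le> N i * x" using N_ge[of i] \<open>0 < x\<close> by (intro mult_right_mono) auto
  then show "x \<le> y" using y by simp
qed

lemma \<zeta>: "Re (\<zeta> j) = x" "y \<le> Im (\<zeta> j)" "j \<le> 2 ^ i \<Longrightarrow> Im (\<zeta> j) \<le> 2 * y"
  "Im (\<zeta> j) - Im (\<zeta> k) = y / 2 ^ i * (real j - real k)"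
proof -
  show "Re (\<zeta> j) = x" by (simp add: \<zeta>_def)
  show "y \<le> Im (\<zeta> j)" using xy by (simp add: \<zeta>_def)
  show "Im (\<zeta> j) - Im (\<zeta> k) = y / 2 ^ i * (real j - real k)" by (simp add: \<zeta>_def field_simps)
  assume "j \<le> 2 ^ i"
  then have "real j \<le> real (2 ^ i)" by (simp only: of_nat_le_iff)
  then have "real j / 2 ^ i \<le> 1" by (simp add: divide_le_eq)
  then have "y * (1 + real j / 2 ^ i) \<le> y * 2" using xy by (intro mult_left_mono) auto
  then show "Im (\<zeta> j) \<le> 2 * y" by (simp add: \<zeta>_def)
qed

lemma norm_\<zeta>: "y \<le> cmod (\<zeta> j)" "j \<le> 2 ^ i \<Longrightarrow> (cmod (\<zeta> j))\<^sup>2 \<le> x\<^sup>2 + 4 * y\<^sup>2" "j \<le> 2 ^ i \<Longrightarrow> (cmod (\<zeta> j))\<^sup>2 \<le> 5 * y\<^sup>2"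
  "j \<le> 2 ^ i \<Longrightarrow> cmod (\<zeta> j) \<le> 3 * y"
proof -
  show "y \<le> cmod (\<zeta> j)" using abs_Im_le_cmod[of "\<zeta> j"] \<zeta>(2)[of j] by linarith
  assume j: "j \<le> 2 ^ i"
  have "(Im (\<zeta> j))\<^sup>2 \<le> (2 * y)\<^sup>2" using \<zeta>(2)[of j] \<zeta>(3)[OF j] xy(6) by (intro power_mono) auto
  then show 1: "(cmod (\<zeta> j))\<^sup>2 \<le> x\<^sup>2 + 4 * y\<^sup>2" by (simp add: cmod_power2 \<zeta>(1) power_mult_distrib)
  have "x\<^sup>2 \<le> y\<^sup>2" using xy by (intro power_mono) auto
  with 1 show 5: "(cmod (\<zeta> j))\<^sup>2 \<le> 5 * y\<^sup>2" by simp
  have "5 * y\<^sup>2 \<le> (3 * y)\<^sup>2" by (simp add: power_mult_distrib)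
  with 5 have "(cmod (\<zeta> j))\<^sup>2 \<le> (3 * y)\<^sup>2" by linarith
  then show "cmod (\<zeta> j) \<le> 3 * y" using xy by (intro power2_le_imp_le[of "cmod (\<zeta> j)"]) auto
qed

text \<open>Here 1 - |z|^2 = 2 x - |\<zeta>|^2, and |\<zeta>|^2 <= x^2 + 4 y^2 is below x because
  y^2 = t i x and both \<open>x\<close> and \<open>t i\<close> are at most 1/16.\<close>

lemma norm_z:
  assumes "j \<le> 2 ^ i"
  shows "x \<le> 1 - (cmod (z j))\<^sup>2" "cmod (z j) < 1"
proof -
  have "(cmod (z j))\<^sup>2 = 1 - 2 * x + (cmod (\<zeta> j))\<^sup>2"
    unfolding cmod_power2 z_def by (simp add: \<zeta>(1)[symmetric] power2_eq_square algebra_simps)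
  moreover have "(cmod (\<zeta> j))\<^sup>2 \<le> x * x + 4 * (t i * x)"
    using norm_\<zeta>(2)[OF assms] xy(5) by (simp add: power2_eq_square)
  moreover have "x * x \<le> 1/16 * x" "t i * x \<le> 1/16 * x" using xy by (intro mult_right_mono; simp)+
  ultimately show 1: "x \<le> 1 - (cmod (z j))\<^sup>2" using xy by linarith
  then have "(cmod (z j))\<^sup>2 < 1" using xy by linarith
  then show "cmod (z j) < 1" by (simp add: abs_square_less_1)
qed

text \<open>The harmonic sum produces i + 1, and the reciprocal spacing 2^i / y = 1 / (K (i + 1) x)
  removes it.\<close>

lemma sum_off_diagonal:
  assumes "j \<le> 2 ^ i" "0 \<le> r" "\<And>k. k \<le> 2 ^ i \<Longrightarrow> k \<noteq> j \<Longrightarrow> u k \<le> r * (1 / (y / 2 ^ i * \<bar>real j - real k\<bar>))"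
  shows "(\<Sum>k\<in>{..2 ^ i}-{j}. u k) \<le> 2 * r / (K * x)"
proof -
  have "(\<Sum>k\<in>{..2 ^ i}-{j}. u k) \<le> (\<Sum>k\<in>{..2 ^ i}-{j}. r * (2 ^ i / y) * (1 / \<bar>real j - real k\<bar>))"
    using assms(3) by (intro sum_mono) (simp add: mult.assoc)
  also have "\<dots> = r * (2 ^ i / y) * (\<Sum>k\<in>{..2 ^ i}-{j}. 1 / \<bar>real j - real k\<bar>)"
    by (simp only: sum_distrib_left)
  also have "\<dots> \<le> r * (2 ^ i / y) * (2 * (real i + 1))"
    using assms(2) xy order_trans[OF sum_inverse_dist_le[OF assms(1)], of "2 * (real i + 1)"] harmonic_power2_le[of i]
    by (intro mult_left_mono) auto
  also have "\<dots> = 2 * r / (K * x)"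
    using xy K_ge by (simp add: xy(4) N_def field_simps)
  finally show ?thesis .
qed

lemma kernels_z_le:
  assumes "j \<le> 2 ^ i"
  shows "(norm (hker (z j)))\<^sup>2 \<le> 1 / x"
    and "(\<Sum>k\<in>{..2 ^ i}-{j}. cmod (hinner (hker (z j)) (hker (z k)))) \<le> 1 / x"
proof -
  show "(norm (hker (z j)))\<^sup>2 \<le> 1 / x"
    unfolding norm_hker_sq[OF norm_z(2)[OF assms]] using norm_z[OF assms] xy by (intro divide_left_mono) auto
  have "(\<Sum>k\<in>{..2 ^ i}-{j}. cmod (hinner (hker (z j)) (hker (z k)))) \<le> 2 * 2 / (K * x)"
  proof (rule sum_off_diagonal[OF assms])
    fix k :: nat assume k: "k \<le> 2 ^ i" "k \<noteq> j"
    \<comment> \<open>The imaginary part alone gives the separation: all points have real part 1 -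
      x, so it is proportional to k - j.\<close>
    have "Im (1 - cnj (z j) * z k) = (1 - x) * (Im (\<zeta> k) - Im (\<zeta> j))"
      by (simp add: z_def \<zeta>(1) algebra_simps)
    also have "\<bar>\<dots>\<bar> = (1 - x) * (y / 2 ^ i * \<bar>real j - real k\<bar>)"
      using xy by (simp add: \<zeta>(4) abs_mult abs_minus_commute)
    finally have "(1 - x) * (y / 2 ^ i * \<bar>real j - real k\<bar>) \<le> cmod (1 - cnj (z j) * z k)"
      using abs_Im_le_cmod[of "1 - cnj (z j) * z k"] by simp
    moreover have pos: "0 < y / 2 ^ i * \<bar>real j - real k\<bar>" using xy k by simp
    moreover have "1/2 * (y / 2 ^ i * \<bar>real j - real k\<bar>) \<le> (1 - x) * (y / 2 ^ i * \<bar>real j - real k\<bar>)"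
      using xy pos by (intro mult_right_mono) auto
    ultimately have le: "1/2 * (y / 2 ^ i * \<bar>real j - real k\<bar>) \<le> cmod (1 - cnj (z j) * z k)" by linarith
    have "cmod (hinner (hker (z j)) (hker (z k))) = 1 / cmod (1 - cnj (z j) * z k)"
      by (simp add: hinner_hker_hker[OF norm_z(2)[OF assms] norm_z(2)[OF k(1)]] norm_divide)
    also have "\<dots> \<le> 1 / (1/2 * (y / 2 ^ i * \<bar>real j - real k\<bar>))"
    proof (rule divide_left_mono[OF le])
      have "0 < 1/2 * (y / 2 ^ i * \<bar>real j - real k\<bar>)" using pos by simp
      then show "0 < cmod (1 - cnj (z j) * z k) * (1/2 * (y / 2 ^ i * \<bar>real j - real k\<bar>))"
        using less_le_trans[OF _ le] by (intro mult_pos_pos[of "cmod (1 - cnj (z j) * z k)"])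
    qed simp
    finally show "cmod (hinner (hker (z j)) (hker (z k))) \<le> 2 * (1 / (y / 2 ^ i * \<bar>real j - real k\<bar>))"
      by (simp add: mult.assoc)
  qed simp
  also have "\<dots> \<le> 1 / x" using K_ge xy by (simp add: field_simps)
  finally show "(\<Sum>k\<in>{..2 ^ i}-{j}. cmod (hinner (hker (z j)) (hker (z k)))) \<le> 1 / x" .
qed

lemma \<zeta>_sector: "\<zeta> j \<in> sector"
  using xy \<zeta>(1)[of j] by (intro Re_pos_sector) simp

lemma one_plus_norm_ge: "1 \<le> cmod (1 + \<zeta> j / of_real (t l))" "y / t l \<le> cmod (1 + \<zeta> j / of_real (t l))"
  "cmod (\<zeta> j) / t l \<le> cmod (1 + \<zeta> j / of_real (t l))"
proof -
  have R: "Re (1 + \<zeta> j / of_real (t l)) = 1 + x / t l" by (simp add: \<zeta>(1))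
  have "0 \<le> x / t l" using xy by simp
  then show "1 \<le> cmod (1 + \<zeta> j / of_real (t l))"
    using abs_Re_le_cmod[of "1 + \<zeta> j / of_real (t l)"] unfolding R by linarith
  have sq: "(cmod (1 + \<zeta> j / of_real (t l)))\<^sup>2 \<ge> (cmod (\<zeta> j) / t l)\<^sup>2"
    unfolding norm_sq_1_plus[OF t_pos] using \<zeta>(1)[of j] xy by (simp add: power_divide)
  then show 3: "cmod (\<zeta> j) / t l \<le> cmod (1 + \<zeta> j / of_real (t l))"
    by (rule power2_le_imp_le) simp
  have "y / t l \<le> cmod (\<zeta> j) / t l" using norm_\<zeta>(1) by (intro divide_right_mono) auto
  with 3 show "y / t l \<le> cmod (1 + \<zeta> j / of_real (t l))" by linarith
qed

lemma g_diff:
  "g l (\<zeta> j) - g l (\<zeta> k) = (\<zeta> j - \<zeta> k) * (of_real (\<rho> ^ l) / ((1 + \<zeta> j / of_real (t l)) * (1 + \<zeta> k / of_real (t l))))"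
proof -
  have nz: "1 + \<zeta> j / of_real (t l) \<noteq> 0" "1 + \<zeta> k / of_real (t l) \<noteq> 0"
    using sector_nz[OF \<zeta>_sector t_pos] by auto
  have "\<zeta> j / (1 + \<zeta> j / of_real (t l)) - \<zeta> k / (1 + \<zeta> k / of_real (t l)) =
      (\<zeta> j * (1 + \<zeta> k / of_real (t l)) - \<zeta> k * (1 + \<zeta> j / of_real (t l))) /
      ((1 + \<zeta> j / of_real (t l)) * (1 + \<zeta> k / of_real (t l)))"
    using nz by (subst diff_frac_eq) (simp_all add: mult_ac)
  also have "\<zeta> j * (1 + \<zeta> k / of_real (t l)) - \<zeta> k * (1 + \<zeta> j / of_real (t l)) = \<zeta> j - \<zeta> k"
    by (simp add: algebra_simps)
  finally show ?thesis unfolding g_def right_diff_distrib[symmetric] by simp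
qed

lemma Re_inverse_ge:
  fixes q :: complex
  assumes "cmod (q - 1) \<le> 1/4"
  shows "1/4 \<le> Re (1 / q)"
proof -
  have r: "Re q \<ge> 3/4" using abs_Re_le_cmod[of "q - 1"] assms by simp
  have "cmod q \<le> 5/4" using norm_triangle_ineq[of "q - 1" 1] assms by simp
  then have "(cmod q)\<^sup>2 \<le> (5/4)\<^sup>2" by (intro power_mono) auto
  then have q2: "(cmod q)\<^sup>2 \<le> 3" by (simp add: power2_eq_square)
  have "q \<noteq> 0" using r by auto
  then have "0 < (cmod q)\<^sup>2" by simp
  have "1/4 * (cmod q)\<^sup>2 \<le> Re q" using q2 r by linarith
  then have "1/4 \<le> Re q / (cmod q)\<^sup>2" using \<open>0 < (cmod q)\<^sup>2\<close> by (simp add: le_divide_eq)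
  also have "\<dots> = Re (1 / q)" by (simp add: Re_divide cmod_power2)
  finally show ?thesis .
qed

text \<open>As \<zeta> j - \<zeta> k is purely imaginary, the real part of the divided difference
  \<open>P\<close> of \<open>\<Psi>\<close> decides. Its terms up to i have real part at least
  \<rho>^l / 4 and cannot cancel; the saturated terms beyond i lower the sum by at most \<rho>^i /
  8.\<close>

lemma Im_\<Psi>_diff:
  assumes jk: "j \<le> 2 ^ i" "k \<le> 2 ^ i"
  shows "\<rho> ^ i / 8 * (y / 2 ^ i * \<bar>real j - real k\<bar>) \<le> \<bar>Im (\<Psi> (\<zeta> j)) - Im (\<Psi> (\<zeta> k))\<bar>"
proof (cases "j = k")
  case False
  define q where "q l = (1 + \<zeta> j / of_real (t l)) * (1 + \<zeta> k / of_real (t l))" for l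
  define p where "p l = of_real (\<rho> ^ l) / q l" for l
  have gp: "g l (\<zeta> j) - g l (\<zeta> k) = (\<zeta> j - \<zeta> k) * p l" for l
    unfolding p_def q_def by (rule g_diff)
  have "\<zeta> j \<noteq> \<zeta> k" using \<zeta>(4)[of j k] False xy by auto
  have "summable (\<lambda>l. (\<zeta> j - \<zeta> k) * p l)"
    unfolding gp[symmetric] by (intro summable_diff summable_g \<zeta>_sector)
  then have sp: "summable p" using \<open>\<zeta> j \<noteq> \<zeta> k\<close> by (simp add: summable_cmult_iff)
  define P where "P = (\<Sum>l. p l)"
  have diff: "\<Psi> (\<zeta> j) - \<Psi> (\<zeta> k) = (\<zeta> j - \<zeta> k) * P"
    unfolding \<Psi>_def P_def suminf_mult[OF sp, symmetric] gp[symmetric]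
    by (intro suminf_diff summable_g \<zeta>_sector)
  have small: "1/4 \<le> Re (1 / q l)" if "l \<le> i" for l
  proof (rule Re_inverse_ge)
    have u: "cmod (\<zeta> m / of_real (t l)) \<le> 1/10" if "m \<le> 2 ^ i" for m
    proof -
      have "cmod (\<zeta> m / of_real (t l)) = cmod (\<zeta> m) / t l" by (simp add: norm_divide)
      also have "\<dots> \<le> 3 * y / t i"
        using norm_\<zeta>(4)[OF that] t_antimono[OF \<open>l \<le> i\<close>] xy(6) by (intro frac_le) auto
      also have "\<dots> = 3 / N i" by (simp add: y_def)
      also have "\<dots> \<le> 3 / 30" using N_ge[of i] by (intro divide_left_mono) auto
      finally show ?thesis by simp
    qed
    define a where "a = \<zeta> j / of_real (t l)"
    define b where "b = \<zeta> k / of_real (t l)"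
    have ab: "cmod a \<le> 1/10" "cmod b \<le> 1/10" using u jk by (auto simp: a_def b_def)
    have "cmod (a * b) \<le> 1/10 * (1/10)" unfolding norm_mult using ab by (intro mult_mono) auto
    moreover have "q l - 1 = a + b + a * b" by (simp add: q_def a_def b_def algebra_simps)
    moreover have "cmod (a + b + a * b) \<le> cmod a + cmod b + cmod (a * b)"
      using norm_triangle_ineq[of "a + b" "a * b"] norm_triangle_ineq[of a b] by linarith
    ultimately show "cmod (q l - 1) \<le> 1/4" using ab by simp
  qed
  have Rp: "Re (p l) = \<rho> ^ l * Re (1 / q l)" for l
    using Re_of_real_mult[of "\<rho> ^ l" "1 / q l"] by (simp add: p_def)
  \<comment> \<open>Beyond i both factors of \<open>q l\<close> have modulus at least y / t l, and
    \<open>t l \<le> x\<close> turns (t l)^2 / y^2 into the summable \<open>t l\<close> times x /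
    y^2.\<close>
  have tail: "- (\<rho> ^ (Suc i + m) * t (Suc i + m) * (x / y\<^sup>2)) \<le> Re (p (m + Suc i))" for m
  proof -
    let ?l = "Suc i + m"
    have sq: "0 < (y / t ?l) * (y / t ?l)" using xy(6) by (intro mult_pos_pos divide_pos_pos) auto
    have le: "(y / t ?l) * (y / t ?l) \<le> cmod (q ?l)"
      unfolding q_def norm_mult using one_plus_norm_ge(2) xy by (intro mult_mono) auto
    have "\<rho> ^ ?l / cmod (q ?l) \<le> \<rho> ^ ?l / ((y / t ?l) * (y / t ?l))"
      by (rule divide_left_mono[OF le _ mult_pos_pos[OF less_le_trans[OF sq le] sq]]) (use \<rho> in simp)
    also have "\<dots> = \<rho> ^ ?l * t ?l * (t ?l / y\<^sup>2)" by (simp add: power2_eq_square)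
    also have "\<dots> \<le> \<rho> ^ ?l * t ?l * (x / y\<^sup>2)"
      unfolding x_def using \<rho> by (intro mult_left_mono divide_right_mono t_antimono) auto
    also have "\<rho> ^ ?l / cmod (q ?l) = cmod (p ?l)"
      unfolding p_def norm_divide norm_of_real using \<rho> by simp
    finally have "cmod (p ?l) \<le> \<rho> ^ ?l * t ?l * (x / y\<^sup>2)" .
    then show ?thesis using abs_Re_le_cmod[of "p ?l"] by (simp add: add.commute)
  qed
  have "Re P = (\<Sum>l. Re (p l))" unfolding P_def by (rule Re_suminf[OF sp])
  also have "\<dots> = (\<Sum>m. Re (p (m + Suc i))) + (\<Sum>l<Suc i. Re (p l))"
    by (rule suminf_split_initial_segment) (rule summable_Re[OF sp])
  finally have ReP: "Re P = (\<Sum>m. Re (p (m + Suc i))) + (\<Sum>l<Suc i. Re (p l))" .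
  have "\<rho> ^ i / 4 \<le> (\<Sum>l\<in>{i}. Re (p l))"
    using mult_left_mono[OF small[of i], of "\<rho> ^ i"] \<rho> by (simp add: Rp)
  also have "\<dots> \<le> (\<Sum>l<Suc i. Re (p l))"
  proof (rule sum_mono2)
    fix l assume "l \<in> {..<Suc i} - {i}"
    then have "0 \<le> Re (1 / q l)" using small[of l] by (intro order_trans[OF _ small[of l]]) auto
    then show "0 \<le> Re (p l)" unfolding Rp using \<rho> by (intro mult_nonneg_nonneg) auto
  qed auto
  finally have first: "\<rho> ^ i / 4 \<le> (\<Sum>l<Suc i. Re (p l))" .
  have "- (\<rho> ^ i / 8) \<le> - (2 * (\<rho> ^ Suc i * t (Suc i)) * (x / y\<^sup>2))"
  proof -
    have "2 * (\<rho> ^ Suc i * t (Suc i)) * (x / y\<^sup>2) = \<rho> ^ i * (2 * \<rho> / (N i)\<^sup>2)"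
      using xy(1) N_ge(3)[of i] unfolding x_def[symmetric] xy(4) by (simp add: power2_eq_square)
    also have "\<dots> \<le> \<rho> ^ i * (1 / 8)"
      using N_sq_ge(1)[of i] N_ge(3)[of i] \<rho> by (intro mult_left_mono) (auto simp: divide_le_eq)
    finally show ?thesis by simp
  qed
  also have "\<dots> \<le> - ((\<Sum>m. \<rho> ^ (Suc i + m) * t (Suc i + m)) * (x / y\<^sup>2))"
    using b_t_suminf_le[of "Suc i"] xy unfolding neg_le_iff_le by (intro mult_right_mono) auto
  also have "\<dots> = (\<Sum>m. - (\<rho> ^ (Suc i + m) * t (Suc i + m) * (x / y\<^sup>2)))"
    by (simp only: suminf_minus[OF summable_mult2[OF b_t_summable]] suminf_mult2[OF b_t_summable])
  also have "\<dots> \<le> (\<Sum>m. Re (p (m + Suc i)))"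
    by (intro suminf_le tail summable_minus summable_mult2 b_t_summable summable_ignore_initial_segment summable_Re sp)
  finally have ReP8: "\<rho> ^ i / 8 \<le> Re P" using first ReP by linarith
  have "\<Psi> (\<zeta> j) - \<Psi> (\<zeta> k) = (\<zeta> j - \<zeta> k) * P" by (rule diff)
  moreover have "\<zeta> j - \<zeta> k = \<i> * of_real (Im (\<zeta> j) - Im (\<zeta> k))"
    by (simp add: complex_eq_iff \<zeta>(1))
  ultimately have "Im (\<Psi> (\<zeta> j) - \<Psi> (\<zeta> k)) = (Im (\<zeta> j) - Im (\<zeta> k)) * Re P" by simp
  then have "\<bar>Im (\<Psi> (\<zeta> j)) - Im (\<Psi> (\<zeta> k))\<bar> = (y / 2 ^ i * \<bar>real j - real k\<bar>) * \<bar>Re P\<bar>"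
    using xy by (simp add: \<zeta>(4) abs_mult)
  moreover have "(y / 2 ^ i * \<bar>real j - real k\<bar>) * (\<rho> ^ i / 8) \<le> (y / 2 ^ i * \<bar>real j - real k\<bar>) * \<bar>Re P\<bar>"
    using ReP8 xy by (intro mult_left_mono) auto
  ultimately show ?thesis by (simp only: mult.commute)
qed simp

text \<open>For l up to i, |\<zeta>|^2 / t l <= 5 y^2 / t i = 5 x bounds the term by 6 \<rho>^l x;
  every later term is at most twice its saturation level.\<close>

lemma Re_\<Psi>_le:
  assumes "j \<le> 2 ^ i"
  shows "Re (\<Psi> (\<zeta> j)) \<le> A * \<rho> ^ i * x"
proof -
  define d where "d l = (cmod (1 + \<zeta> j / of_real (t l)))\<^sup>2" for l
  have d: "1 \<le> d l" "(cmod (\<zeta> j) / t l)\<^sup>2 \<le> d l" "(y / t l)\<^sup>2 \<le> d l" for l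
  proof -
    have "1\<^sup>2 \<le> d l" unfolding d_def by (intro power_mono one_plus_norm_ge) auto
    then show "1 \<le> d l" by simp
    show "(cmod (\<zeta> j) / t l)\<^sup>2 \<le> d l" unfolding d_def by (intro power_mono one_plus_norm_ge) auto
    show "(y / t l)\<^sup>2 \<le> d l" unfolding d_def using xy by (intro power_mono one_plus_norm_ge) auto
  qed
  have Rg: "Re (g l (\<zeta> j)) = \<rho> ^ l * ((x + (cmod (\<zeta> j))\<^sup>2 / t l) / d l)" for l
    by (simp add: Re_g d_def \<zeta>(1))
  have low: "Re (g l (\<zeta> j)) \<le> \<rho> ^ l * (6 * x)" if "l \<le> i" for l
  proof -
    have "(cmod (\<zeta> j))\<^sup>2 / t l \<le> 5 * y\<^sup>2 / t i"
      using norm_\<zeta>(3)[OF assms] t_antimono[OF that] by (intro frac_le) auto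
    also have "\<dots> = 5 * x" using xy(8) by (metis times_divide_eq_right)
    finally have "x + (cmod (\<zeta> j))\<^sup>2 / t l \<le> 6 * x" by simp
    moreover have "0 \<le> x + (cmod (\<zeta> j))\<^sup>2 / t l" using xy by simp
    ultimately have "(x + (cmod (\<zeta> j))\<^sup>2 / t l) / d l \<le> (6 * x) / 1"
      using d(1)[of l] by (intro frac_le) auto
    then show ?thesis unfolding Rg using \<rho> by (intro mult_left_mono) auto
  qed
  have high: "Re (g (m + Suc i) (\<zeta> j)) \<le> 2 * (\<rho> ^ (Suc i + m) * t (Suc i + m))" for m
  proof -
    let ?l = "Suc i + m"
    have "x / d ?l \<le> t ?l"
    proof -
      have "x / d ?l \<le> x / (y / t ?l)\<^sup>2"
        using d(1)[of ?l] d(3)[of ?l] xy by (intro divide_left_mono mult_pos_pos) (auto intro: less_le_trans[of 0 1])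
      also have "\<dots> = x * t ?l / y\<^sup>2 * t ?l" by (simp add: power2_eq_square)
      also have "\<dots> \<le> 1 * t ?l"
      proof (intro mult_right_mono)
        have "t ?l \<le> x" unfolding x_def by (intro t_antimono) simp
        then have "t ?l \<le> y" using xy(7) by linarith
        then have "x * t ?l \<le> y * y" using xy(1,6,7) by (intro mult_mono) auto
        then show "x * t ?l / y\<^sup>2 \<le> 1" using xy by (simp add: power2_eq_square)
      qed simp
      finally show ?thesis by simp
    qed
    moreover have "(cmod (\<zeta> j))\<^sup>2 / t ?l / d ?l \<le> t ?l"
    proof -
      have "(cmod (\<zeta> j))\<^sup>2 / t ?l = (cmod (\<zeta> j) / t ?l)\<^sup>2 * t ?l" by (simp add: power2_eq_square)
      also have "\<dots> \<le> d ?l * t ?l" by (intro mult_right_mono d) simp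
      finally show ?thesis using d(1)[of ?l] by (simp add: divide_le_eq mult.commute)
    qed
    ultimately have "(x + (cmod (\<zeta> j))\<^sup>2 / t ?l) / d ?l \<le> 2 * t ?l"
      by (simp only: add_divide_distrib)
    from mult_left_mono[OF this, of "\<rho> ^ ?l"] show ?thesis
      using \<rho> unfolding Rg add.commute[of m] by (simp add: mult_ac)
  qed
  have "Re (\<Psi> (\<zeta> j)) = (\<Sum>m. Re (g (m + Suc i) (\<zeta> j))) + (\<Sum>l<Suc i. Re (g l (\<zeta> j)))"
    unfolding Re_\<Psi>(1)[OF \<zeta>_sector] by (intro suminf_split_initial_segment Re_\<Psi>(2) \<zeta>_sector)
  also have "(\<Sum>m. Re (g (m + Suc i) (\<zeta> j))) \<le> (\<Sum>m. 2 * (\<rho> ^ (Suc i + m) * t (Suc i + m)))"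
    by (intro suminf_le high summable_mult b_t_summable summable_ignore_initial_segment Re_\<Psi>(2) \<zeta>_sector)
  also have "\<dots> = 2 * (\<Sum>m. \<rho> ^ (Suc i + m) * t (Suc i + m))" by (rule suminf_mult[OF b_t_summable])
  also have "\<dots> \<le> 2 * (2 * (\<rho> ^ Suc i * t (Suc i)))" by (intro mult_left_mono b_t_suminf_le) simp
  also have "(\<Sum>l<Suc i. Re (g l (\<zeta> j))) \<le> (\<Sum>l<Suc i. \<rho> ^ l * (6 * x))"
    by (intro sum_mono low) simp
  also have "\<dots> = 6 * x * (\<Sum>l\<le>i. \<rho> ^ l)" unfolding sum_distrib_left lessThan_Suc_atMost by (simp only: mult.commute)
  also have "\<dots> \<le> 6 * x * (\<rho> / (\<rho> - 1) * \<rho> ^ i)" using xy by (intro mult_left_mono sum_powers_le) auto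
  finally have "Re (\<Psi> (\<zeta> j)) \<le> 2 * (2 * (\<rho> ^ Suc i * t (Suc i))) + 6 * x * (\<rho> / (\<rho> - 1) * \<rho> ^ i)" by simp
  also have "\<dots> = A * \<rho> ^ i * x" proof -
    have "2 * (2 * (\<rho> * P * x)) + 6 * x * (r * P) = (6 * r + 4 * \<rho>) * P * x" for r P
      by (simp add: algebra_simps)
    from this[of "\<rho> ^ i" "\<rho> / (\<rho> - 1)"] show ?thesis
      unfolding x_def[symmetric] A_def by simp
  qed
  finally show ?thesis .
qed

text \<open>For values u, v of \<open>W\<close>, the Cayley transform gives 1 - cnj (\<phi> (z j))
  \<phi> (z k) = 2 (cnj u + v) / ((1 + cnj u) (1 + v)). On the diagonal \<open>Re_\<Psi>_le\<close>
  makes this small; off the diagonal the imaginary part of cnj u + v is bounded below by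
  \<open>Im_\<Psi>_diff\<close>.\<close>

lemma kernels_\<phi>_ge:
  assumes "j \<le> 2 ^ i"
  shows "4 / (A * \<rho> ^ i * x) \<le> (norm (hker (\<phi> (z j))))\<^sup>2"
    and "(\<Sum>k\<in>{..2 ^ i}-{j}. cmod (hinner (hker (\<phi> (z j))) (hker (\<phi> (z k))))) \<le> 2 / (A * \<rho> ^ i * x)"
proof -
  have W: "W (z k) = \<Psi> (\<zeta> k) / 16" for k by (simp add: W_def z_def)
  have sec: "1 - z k \<in> sector" for k using \<zeta>_sector by (simp add: z_def)
  have ReW: "0 < Re (W (z k))" if "k \<le> 2 ^ i" for k by (rule Re_W_pos[OF norm_z(2)[OF that]])
  have W1: "1 \<le> cmod (1 + W (z k))" "cmod (1 + W (z k)) \<le> 2" if "k \<le> 2 ^ i" for k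
  proof -
    show "1 \<le> cmod (1 + W (z k))"
      using ReW[OF that] abs_Re_le_cmod[of "1 + W (z k)"] by simp
    show "cmod (1 + W (z k)) \<le> 2"
      using norm_triangle_ineq[of 1 "W (z k)"] W_le_1[OF sec] by (smt (verit) norm_one)
  qed
  have \<phi>1: "cmod (\<phi> (z k)) < 1" if "k \<le> 2 ^ i" for k by (intro self_map norm_z(2) that)
  have Apos: "0 < A * \<rho> ^ i * x" using A_ge \<rho> xy by simp
  have "1 - (cmod (\<phi> (z j)))\<^sup>2 = 4 * Re (W (z j)) / (cmod (1 + W (z j)))\<^sup>2"
    by (rule one_minus_\<phi>_sq(2)[OF sec ReW[OF assms]])
  also have "\<dots> \<le> 4 * Re (W (z j)) / 1"
    using W1(1)[OF assms] ReW[OF assms] by (intro divide_left_mono) auto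
  also have "\<dots> \<le> A * \<rho> ^ i * x / 4" using Re_\<Psi>_le[OF assms] by (simp add: W)
  finally have "1 / (A * \<rho> ^ i * x / 4) \<le> 1 / (1 - (cmod (\<phi> (z j)))\<^sup>2)"
    using \<phi>1[OF assms] Apos by (intro divide_left_mono mult_pos_pos) (auto simp: abs_square_less_1)
  then show "4 / (A * \<rho> ^ i * x) \<le> (norm (hker (\<phi> (z j))))\<^sup>2"
    by (simp add: norm_hker_sq[OF \<phi>1[OF assms]])
  have "(\<Sum>k\<in>{..2 ^ i}-{j}. cmod (hinner (hker (\<phi> (z j))) (hker (\<phi> (z k))))) \<le> 2 * (256 / \<rho> ^ i) / (K * x)"
  proof (rule sum_off_diagonal[OF assms])
    fix k :: nat assume k: "k \<le> 2 ^ i" "k \<noteq> j"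
    define u where "u = W (z j)"
    define v where "v = W (z k)"
    have u: "1 \<le> cmod (1 + u)" "cmod (1 + u) \<le> 2" using W1[OF assms] by (auto simp: u_def)
    have v: "1 \<le> cmod (1 + v)" "cmod (1 + v) \<le> 2" using W1[OF k(1)] by (auto simp: v_def)
    have nz: "1 + u \<noteq> 0" "1 + v \<noteq> 0" using u(1) v(1) by auto
    then have nzc: "1 + cnj u \<noteq> 0" using complex_cnj_zero_iff[of "1 + u"] by simp
    have "cnj (\<phi> (z j)) * \<phi> (z k) = ((1 - cnj u) * (1 - v)) / ((1 + cnj u) * (1 + v))"
      by (simp add: \<phi>_def u_def v_def)
    then have "1 - cnj (\<phi> (z j)) * \<phi> (z k) = ((1 + cnj u) * (1 + v) - (1 - cnj u) * (1 - v)) / ((1 + cnj u) * (1 + v))"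
      using nz nzc by (simp add: diff_divide_distrib)
    also have "(1 + cnj u) * (1 + v) - (1 - cnj u) * (1 - v) = 2 * (cnj u + v)" by (simp add: algebra_simps)
    finally have eq: "cmod (1 - cnj (\<phi> (z j)) * \<phi> (z k)) = 2 * cmod (cnj u + v) / (cmod (1 + u) * cmod (1 + v))"
      using complex_mod_cnj[of "1 + u"]
      by (simp only: norm_divide norm_mult norm_numeral complex_cnj_add complex_cnj_one)
    define r where "r = y / 2 ^ i * \<bar>real j - real k\<bar>"
    have r: "0 < r" using xy k by (simp add: r_def)
    have "\<rho> ^ i / 8 * r \<le> \<bar>Im (\<Psi> (\<zeta> j)) - Im (\<Psi> (\<zeta> k))\<bar>"
      unfolding r_def by (rule Im_\<Psi>_diff[OF assms k(1)])
    also have "\<dots> = 16 * \<bar>Im (cnj u + v)\<bar>"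
    proof -
      have "16 * Im (cnj u + v) = - (Im (\<Psi> (\<zeta> j)) - Im (\<Psi> (\<zeta> k)))" by (simp add: u_def v_def W)
      then show ?thesis by linarith
    qed
    also have "\<dots> \<le> 16 * cmod (cnj u + v)" using abs_Im_le_cmod[of "cnj u + v"] by simp
    finally have uv: "\<rho> ^ i * r / 64 \<le> 2 * cmod (cnj u + v)" by simp
    have pr: "0 < \<rho> ^ i * r" using \<rho> r by simp
    \<comment> \<open>This factor 4 turns the constant 64 into the 256 that enters
      \<open>K\<close>.\<close>
    have "cmod (1 + u) * cmod (1 + v) \<le> 2 * 2" using u v by (intro mult_mono) auto
    then have "\<rho> ^ i * r / 64 / 4 \<le> 2 * cmod (cnj u + v) / (cmod (1 + u) * cmod (1 + v))"
      using uv pr nz by (intro frac_le) (auto intro: mult_pos_pos)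
    then have le: "\<rho> ^ i * r / 256 \<le> cmod (1 - cnj (\<phi> (z j)) * \<phi> (z k))" unfolding eq by simp
    have "cmod (hinner (hker (\<phi> (z j))) (hker (\<phi> (z k)))) = 1 / cmod (1 - cnj (\<phi> (z j)) * \<phi> (z k))"
      by (simp add: hinner_hker_hker[OF \<phi>1[OF assms] \<phi>1[OF k(1)]] norm_divide)
    also have "\<dots> \<le> 1 / (\<rho> ^ i * r / 256)"
    proof (intro divide_left_mono mult_pos_pos)
      show "0 < \<rho> ^ i * r / 256" using pr by simp
      then show "0 < cmod (1 - cnj (\<phi> (z j)) * \<phi> (z k))" using le by (rule less_le_trans)
    qed (use le in auto)
    also have "\<dots> = 256 / \<rho> ^ i * (1 / r)" by simp
    finally show "cmod (hinner (hker (\<phi> (z j))) (hker (\<phi> (z k)))) \<le> 256 / \<rho> ^ i * (1 / (y / 2 ^ i * \<bar>real j - real k\<bar>))"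
      unfolding r_def .
  qed (use \<rho> in simp)
  also have "\<dots> = 2 / (A * \<rho> ^ i * x)" by (simp add: K_def mult_ac)
  finally show "(\<Sum>k\<in>{..2 ^ i}-{j}. cmod (hinner (hker (\<phi> (z j))) (hker (\<phi> (z k))))) \<le> 2 / (A * \<rho> ^ i * x)" .
qed

text \<open>The Gram bounds are 2 / x for the kernels and 2 / (A \<rho>^i x) for their images under
  the adjoint; \<open>s_ge\<close> takes the square root of the quotient.\<close>

lemma singular_value_ge:
  assumes "singular_system (comp_op \<phi>) C e"
  shows "sqrt (1 / (A * \<rho> ^ i)) \<le> singular_system.s (comp_op \<phi>) e (2 ^ i)"
proof -
  interpret singular_system "comp_op \<phi>" C e by fact
  define F where "F c = (\<Sum>j\<le>2 ^ i. hscale (c j) (hker (z j)))" for c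
  have adj: "hadjoint (comp_op \<phi>) (F c) = (\<Sum>j\<le>2 ^ i. hscale (c j) (hker (\<phi> (z j))))" for c
  proof (rule hinner_eqI)
    fix f
    show "hinner f (hadjoint (comp_op \<phi>) (F c)) = hinner f (\<Sum>j\<le>2 ^ i. hscale (c j) (hker (\<phi> (z j))))"
      unfolding hinner_adjoint[symmetric] F_def hinner_sum_right hinner_scale_right
      by (intro sum.cong refl arg_cong2[where f = times])
         (simp add: hinner_adjoint hadjoint_hker[OF bounded_hop_axioms norm_z(2)])
  qed
  define B where "B = A * \<rho> ^ i"
  have B: "0 < B" using A_ge \<rho> by (simp add: B_def)
  have up: "(norm (F c))\<^sup>2 \<le> (1 / x + 1 / x) * (\<Sum>j\<le>2 ^ i. (cmod (c j))\<^sup>2)" for c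
    unfolding F_def by (intro almost_orthogonal_bounds(1) kernels_z_le)
  have lo: "(4 / (B * x) - 2 / (B * x)) * (\<Sum>j\<le>2 ^ i. (cmod (c j))\<^sup>2) \<le> (norm (hadjoint (comp_op \<phi>) (F c)))\<^sup>2" for c
    unfolding adj B_def by (intro almost_orthogonal_bounds(2) kernels_\<phi>_ge)
  show ?thesis
  proof (rule s_ge[of "2 ^ i" "\<lambda>j. hker (z j)"])
    fix c :: "nat \<Rightarrow> complex" assume "\<exists>j\<le>2 ^ i. c j \<noteq> 0"
    then obtain j where "j \<le> 2 ^ i" "c j \<noteq> 0" by blast
    then have c_pos: "0 < (\<Sum>j\<le>2 ^ i. (cmod (c j))\<^sup>2)" by (intro sum_pos2[of _ j]) auto
    have "4 / (B * x) - 2 / (B * x) = 2 / (B * x)" by (simp add: diff_divide_distrib[symmetric])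
    then have "0 < 4 / (B * x) - 2 / (B * x)" using B xy(1) by simp
    from less_le_trans[OF mult_pos_pos[OF this c_pos] lo]
    have "0 < (norm (hadjoint (comp_op \<phi>) (F c)))\<^sup>2" .
    then have "F c \<noteq> 0" by (metis adjoint_zero less_irrefl norm_zero zero_power2)
    then show "(\<Sum>j\<le>2 ^ i. hscale (c j) (hker (z j))) \<noteq> 0" unfolding F_def .
  next
    fix c :: "nat \<Rightarrow> complex"
    have "1 / B * (norm (F c))\<^sup>2 \<le> 1 / B * ((1 / x + 1 / x) * (\<Sum>j\<le>2 ^ i. (cmod (c j))\<^sup>2))"
      using up B by (intro mult_left_mono) auto
    also have "\<dots> = (4 / (B * x) - 2 / (B * x)) * (\<Sum>j\<le>2 ^ i. (cmod (c j))\<^sup>2)"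
      by (simp add: diff_divide_distrib[symmetric])
    also note lo[of c]
    finally have "(sqrt (1 / B) * norm (F c))\<^sup>2 \<le> (norm (hadjoint (comp_op \<phi>) (F c)))\<^sup>2"
      using B by (simp add: power_mult_distrib)
    then have "sqrt (1 / B) * norm (F c) \<le> norm (hadjoint (comp_op \<phi>) (F c))"
      by (rule power2_le_imp_le) simp
    then show "sqrt (1 / (A * \<rho> ^ i)) * norm (\<Sum>j\<le>2 ^ i. hscale (c j) (hker (z j)))
      \<le> norm (hadjoint (comp_op \<phi>) (\<Sum>j\<le>2 ^ i. hscale (c j) (hker (z j))))"
      by (simp only: F_def B_def)
  qed
qed

end

end

section \<open>Upper bound for the singular numbers\<close>

text \<open>Cauchy condensation along an arbitrary index sequence: on the block from
  \<open>k i\<close> to \<open>k (Suc i)\<close> every term is at most \<open>v i\<close>.\<close>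

lemma summable_by_blocks:
  fixes u :: "nat \<Rightarrow> real" and k :: "nat \<Rightarrow> nat"
  assumes u: "decseq u" "\<And>n. 0 \<le> u n"
    and k: "incseq k" "\<And>i. i \<le> k i" and v: "\<And>i. u (k i) \<le> v i"
    and sum: "summable (\<lambda>i. real (k (Suc i)) * v i)"
  shows "summable u"
proof -
  have v_nonneg: "0 \<le> v i" for i using order_trans[OF u(2) v] .
  define S where "S = (\<Sum>i. real (k (Suc i)) * v i)"
  have block: "(\<Sum>n<k m. u n) \<le> real (k 0) * u 0 + (\<Sum>i<m. real (k (Suc i)) * v i)" for m
  proof (induction m)
    case 0
    have "(\<Sum>n<k 0. u n) \<le> (\<Sum>n<k 0. u 0)" using decseqD[OF u(1)] by (intro sum_mono) simp
    then show ?case by simp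
  next
    case (Suc m)
    have kk: "k m \<le> k (Suc m)" using k(1) by (simp add: incseq_SucD)
    have split: "{..<k (Suc m)} = {..<k m} \<union> {k m..<k (Suc m)}" using kk by auto
    have "(\<Sum>n<k (Suc m). u n) = (\<Sum>n<k m. u n) + (\<Sum>n=k m..<k (Suc m). u n)"
      unfolding split by (rule sum.union_disjoint) auto
    also have "(\<Sum>n=k m..<k (Suc m). u n) \<le> (\<Sum>n=k m..<k (Suc m). u (k m))"
      using decseqD[OF u(1)] by (intro sum_mono) simp
    also have "\<dots> = real (k (Suc m) - k m) * u (k m)" by simp
    also have "\<dots> \<le> real (k (Suc m)) * v m" using v[of m] u(2) by (intro mult_mono) auto
    finally show ?case using Suc by simp
  qed
  show ?thesis
  proof (rule summableI_nonneg_bounded[OF u(2)])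
    fix n
    have "(\<Sum>i<n. u i) \<le> (\<Sum>i<k n. u i)" using k(2)[of n] u(2) by (intro sum_mono2) auto
    also note block[of n]
    also have "(\<Sum>i<n. real (k (Suc i)) * v i) \<le> S"
      unfolding S_def using v_nonneg by (intro sum_le_suminf sum) auto
    finally show "(\<Sum>i<n. u i) \<le> real (k 0) * u 0 + S" by simp
  qed
qed

lemma summable_poly_geometric:
  fixes x :: real
  assumes "0 < x" "x < 1"
  shows "summable (\<lambda>n. (real n + 1) ^ d * x ^ n)"
proof -
  have "((\<lambda>n. ((real n + 2) / (real n + 1)) ^ d * x) \<longlongrightarrow> 1 ^ d * x) sequentially"
    by (intro tendsto_intros) real_asymp
  then have "\<forall>\<^sub>F n in sequentially. ((real n + 2) / (real n + 1)) ^ d * x < (1 + x) / 2"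
    using assms by (intro order_tendstoD(2)) auto
  then obtain M where M: "\<And>n. n \<ge> M \<Longrightarrow> ((real n + 2) / (real n + 1)) ^ d * x < (1 + x) / 2"
    by (auto simp: eventually_sequentially)
  show ?thesis
  proof (rule summable_ratio_test)
    show "(1 + x) / 2 < 1" using assms by simp
    fix n assume "M \<le> n"
    have "(real (Suc n) + 1) ^ d * x ^ Suc n = (((real n + 2) / (real n + 1)) ^ d * x) * ((real n + 1) ^ d * x ^ n)"
      by (simp add: power_divide add.commute)
    also have "\<dots> \<le> (1 + x) / 2 * ((real n + 1) ^ d * x ^ n)"
      using M[OF \<open>M \<le> n\<close>] assms by (intro mult_right_mono) auto
    finally show "norm ((real (Suc n) + 1) ^ d * x ^ Suc n) \<le> (1 + x) / 2 * norm ((real n + 1) ^ d * x ^ n)"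
      using assms by (simp add: abs_mult)
  qed
qed

lemma hfun_add: "hfun (f + g) w = hfun f w + hfun g w"
  and hfun_scale: "hfun (hscale a f) w = a * hfun f w"
  and hfun_zero: "hfun 0 w = 0"
  by (simp_all add: plus_hardy2.rep_eq hscale.rep_eq zero_hardy2.rep_eq)

text \<open>The linearity required by \<open>s_le_finite\<close>. The point may lie on the unit
  circle, as long as \<open>\<phi>\<close> maps an open neighbourhood \<open>S\<close> of it into
  the disc.\<close>

lemma higher_deriv_comp_sum:
  assumes \<phi>: "\<phi> holomorphic_on S" "\<And>z. z \<in> S \<Longrightarrow> cmod (\<phi> z) < 1" and S: "open S" "z \<in> S"
    and "finite J"
  shows "(deriv ^^ n) (\<lambda>z. hfun (\<Sum>j\<in>J. hscale (a j) (e j)) (\<phi> z)) z =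
    (\<Sum>j\<in>J. a j * (deriv ^^ n) (\<lambda>z. hfun (e j) (\<phi> z)) z)"
  using \<open>finite J\<close>
proof (induction J rule: finite_induct)
  case empty
  have "(deriv ^^ n) (\<lambda>z. 0::complex) z = 0"
    by (cases n) (simp_all add: higher_deriv_const del: funpow.simps)
  then show ?case by (simp add: hfun_zero)
next
  case (insert j J)
  have "\<phi> ` S \<subseteq> ball 0 1" using \<phi>(2) by auto
  then have hol: "(\<lambda>z. hfun f (\<phi> z)) holomorphic_on S" for f
    using holomorphic_on_compose_gen[OF \<phi>(1) hfun_holomorphic] by (simp add: o_def)
  have "(deriv ^^ n) (\<lambda>z. a j * hfun (e j) (\<phi> z) + hfun (\<Sum>j\<in>J. hscale (a j) (e j)) (\<phi> z)) z =
      (deriv ^^ n) (\<lambda>z. a j * hfun (e j) (\<phi> z)) z + (deriv ^^ n) (\<lambda>z. hfun (\<Sum>j\<in>J. hscale (a j) (e j)) (\<phi> z)) z"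
    by (intro higher_deriv_add[OF _ _ S] hol holomorphic_intros)
  also have "(deriv ^^ n) (\<lambda>z. a j * hfun (e j) (\<phi> z)) z = a j * (deriv ^^ n) (\<lambda>z. hfun (e j) (\<phi> z)) z"
    by (intro higher_deriv_cmult[OF _ S(2,1)] hol)
  finally show ?case using insert by (simp add: hfun_add hfun_scale)
qed

text \<open>Cauchy's estimates on radius R/2 bound the n-th Taylor term at distance R/4 by B 2^(-n),
  and the first L terms vanish.\<close>

lemma zero_of_high_order_small:
  assumes u: "u holomorphic_on ball w R" "R > 0" and B: "\<And>z. z \<in> ball w R \<Longrightarrow> cmod (u z) \<le> B"
    and zero: "\<And>n. n < L \<Longrightarrow> (deriv ^^ n) u w = 0" and z: "dist w z \<le> R / 4"
  shows "cmod (u z) \<le> 2 * B * (1/2) ^ L"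
proof -
  define a where "a n = (deriv ^^ n) u w / fact n" for n
  have B0: "0 \<le> B" using B[of w] u(2) by (intro order_trans[OF norm_ge_zero B[of w]]) simp
  have a: "cmod (a n) \<le> B / (R/2) ^ n" for n
  proof -
    have sub: "cball w (R/2) \<subseteq> ball w R" using u(2) by auto
    have "cmod ((deriv ^^ n) u w) \<le> fact n * B / (R/2) ^ n"
    proof (rule Cauchy_inequality)
      show "u holomorphic_on ball w (R/2)" using u by (auto intro: holomorphic_on_subset)
      show "continuous_on (cball w (R/2)) u"
        using holomorphic_on_imp_continuous_on[OF u(1)] sub by (rule continuous_on_subset)
      show "cmod (u x) \<le> B" if "cmod (w - x) = R/2" for x
        using that u(2) by (intro B) (simp add: dist_norm)
    qed (use u(2) in simp)
    then have "cmod ((deriv ^^ n) u w) / fact n \<le> fact n * B / (R/2) ^ n / fact n"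
      by (intro divide_right_mono) auto
    then show ?thesis by (simp add: a_def norm_divide)
  qed
  have a_zero: "a n = 0" if "n < L" for n using zero[OF that] by (simp add: a_def)
  have "z \<in> ball w R" using z u(2) by simp
  from holomorphic_power_series[OF u(1) this]
  have sums: "(\<lambda>n. a n * (z - w) ^ n) sums u z" by (simp add: a_def)
  have term_le: "cmod (a n * (z - w) ^ n) \<le> B * (1/2) ^ n" for n
  proof -
    have "cmod (a n * (z - w) ^ n) \<le> B / (R/2) ^ n * (R/4) ^ n"
      unfolding norm_mult norm_power using z u(2) B0 a
      by (intro mult_mono power_mono) (auto simp: dist_norm norm_minus_commute)
    also have "(R/4) ^ n = (R/2) ^ n * (1/2) ^ n" by (simp flip: power_mult_distrib)
    also have "B / (R/2) ^ n * ((R/2) ^ n * (1/2) ^ n) = B * (1/2) ^ n" using u(2) by simp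
    finally show ?thesis .
  qed
  have summ: "summable (\<lambda>n. cmod (a n * (z - w) ^ n))"
    by (rule summable_comparison_test'[where g = "\<lambda>n. B * (1/2) ^ n" and N = 0])
       (use term_le in \<open>auto intro!: summable_mult simp: summable_geometric\<close>)
  have "cmod (u z) \<le> (\<Sum>n. cmod (a n * (z - w) ^ n))"
    using summable_norm[OF summ] sums by (simp add: sums_iff)
  also have "\<dots> = (\<Sum>n. cmod (a (n + L) * (z - w) ^ (n + L))) + (\<Sum>n<L. cmod (a n * (z - w) ^ n))"
    by (rule suminf_split_initial_segment[OF summ])
  also have "(\<Sum>n<L. cmod (a n * (z - w) ^ n)) = 0" by (intro sum.neutral) (auto simp: a_zero)
  also have "(\<Sum>n. cmod (a (n + L) * (z - w) ^ (n + L))) \<le> (\<Sum>n. B * (1/2) ^ (n + L))"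
    by (intro suminf_le term_le summable_ignore_initial_segment[OF summ] summable_mult
        summable_ignore_initial_segment[OF summable_geometric]) auto
  also have "\<dots> = 2 * B * (1/2) ^ L"
    using suminf_mult[of "\<lambda>n. (1/2::real) ^ n" "B * (1/2) ^ L"]
    by (simp add: power_add summable_geometric suminf_geometric mult_ac)
  finally show ?thesis by simp
qed

context singular_system begin

text \<open>\<open>s_le\<close> reindexed by a finite set of conditions; monotonicity of
  \<open>s\<close> admits any k above their number.\<close>

lemma s_le_finite:
  fixes v :: "'i \<Rightarrow> hardy2 \<Rightarrow> complex"
  assumes "D \<ge> 0" "finite I" "card I \<le> k"
    and lin: "\<And>\<alpha> (J :: nat set) (c :: nat \<Rightarrow> complex). \<alpha> \<in> I \<Longrightarrow> finite J \<Longrightarrow>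
      v \<alpha> (\<Sum>j\<in>J. hscale (c j) (e j)) = (\<Sum>j\<in>J. c j * v \<alpha> (e j))"
    and le: "\<And>f. (\<And>\<alpha>. \<alpha> \<in> I \<Longrightarrow> v \<alpha> f = 0) \<Longrightarrow> norm (T f) \<le> D * norm f"
  shows "s k \<le> D"
proof -
  obtain h where h: "bij_betw h {..<card I} I"
    using ex_bij_betw_nat_finite[OF assms(2)] by (auto simp: atLeast0LessThan)
  then have hI: "h j \<in> I" if "j < card I" for j using that by (auto simp: bij_betw_def)
  have "s (card I) \<le> D"
  proof (rule s_le[OF assms(1), of _ "\<lambda>j. v (h j)"])
    show "v (h i) (\<Sum>j\<le>card I. hscale (c j) (e j)) = (\<Sum>j\<le>card I. c j * v (h i) (e j))"
      if "i < card I" for i c by (rule lin[OF hI[OF that]]) simp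
    fix f assume z: "\<And>j. j < card I \<Longrightarrow> v (h j) f = 0"
    show "norm (T f) \<le> D * norm f"
    proof (rule le)
      fix \<alpha> assume "\<alpha> \<in> I"
      then obtain j where "j < card I" "\<alpha> = h j" using h by (auto simp: bij_betw_def)
      then show "v \<alpha> f = 0" using z by simp
    qed
  qed
  then show ?thesis using decseqD[OF decseq_s assms(3)] by linarith
qed

end

context lacunary_symbol begin

text \<open>Inversion maps \<open>1 - z\<close>, for \<open>z\<close> on the unit circle, to the line \<open>Re = 1/2\<close>. The centres below correspond
  to the points \<open>1/2 \<plusminus> \<i> ((1 + \<delta>)^b - 1) / 2\<close>, so that they form a net of the circle whose mesh is
  proportional to the distance from \<open>1\<close>.\<close>

definition node :: "real \<Rightarrow> bool \<Rightarrow> nat \<Rightarrow> complex" where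
  "node \<delta> \<sigma> b = 1 / Complex (1/2) ((if \<sigma> then 1 else -1) * (((1 + \<delta>) ^ b - 1) / 2))"

text \<open>\<open>\<delta>\<close> is the relative mesh of the net. The disc of radius 16 \<delta>
  |d| about a net point overshoots the half-plane by less than 64 \<delta> |\<zeta>| = c |\<zeta>| /
  N (i + 1), as \<open>Re_\<Psi>_ge\<close> permits; the index is i + 1 because these discs may
  reach below \<open>t i\<close>. \<open>M\<close> steps carry the net beyond height 1 / t i in the
  inverted coordinate.\<close>

context
  fixes i :: nat and \<delta> :: real and M :: nat
  assumes i: "i \<ge> 1"
  defines "\<delta> \<equiv> c / (64 * N (Suc i))" and "M \<equiv> LEAST m. (1 + \<delta>) ^ m > 4 / t i"
begin

lemma \<delta>: "0 < \<delta>" "64 * \<delta> = c / N (Suc i)" "\<delta> \<le> 1/64"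
proof -
  show "0 < \<delta>" using c_bounds N_ge[of "Suc i"] by (simp add: \<delta>_def)
  show "64 * \<delta> = c / N (Suc i)" by (simp add: \<delta>_def)
  have "c / (64 * N (Suc i)) \<le> 1 / 64"
    using c_bounds N_ge[of "Suc i"] by (intro frac_le) auto
  then show "\<delta> \<le> 1/64" by (simp add: \<delta>_def)
qed

lemma M: "(1 + \<delta>) ^ M > 4 / t i" "b < M \<Longrightarrow> (1 + \<delta>) ^ b \<le> 4 / t i"
proof -
  have "\<exists>m. 4 / t i < (1 + \<delta>) ^ m" using \<delta> by (intro real_arch_pow) simp
  then show "(1 + \<delta>) ^ M > 4 / t i" unfolding M_def by (rule LeastI_ex)
  show "(1 + \<delta>) ^ b \<le> 4 / t i" if "b < M"
    using not_less_Least[of b "\<lambda>m. (1 + \<delta>) ^ m > 4 / t i"] that by (simp add: M_def)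
qed

lemma node_bounds:
  assumes "b < M"
  shows "Re (node \<delta> \<sigma> b) \<ge> 0" "t i / 2 \<le> cmod (node \<delta> \<sigma> b)" "cmod (node \<delta> \<sigma> b) \<le> 2"
proof -
  define v where "v = (if \<sigma> then 1 else -1) * (((1 + \<delta>) ^ b - 1) / 2)"
  define p where "p = Complex (1/2) v"
  have node: "node \<delta> \<sigma> b = 1 / p" by (simp add: node_def p_def v_def)
  have "1 \<le> (1 + \<delta>) ^ b" using \<delta> by simp
  then have v: "\<bar>v\<bar> = ((1 + \<delta>) ^ b - 1) / 2" by (auto simp: v_def)
  have p: "1/2 \<le> cmod p" using abs_Re_le_cmod[of p] by (simp add: p_def)
  have "cmod p \<le> 1/2 + \<bar>v\<bar>" using cmod_le[of p] by (simp add: p_def)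
  also have "\<dots> \<le> 2 / t i" unfolding v
  proof -
    have "4 / t i = 2 * (2 / t i)" by simp
    then show "1/2 + ((1 + \<delta>) ^ b - 1) / 2 \<le> 2 / t i" using M(2)[OF assms] by argo
  qed
  finally have p2: "cmod p \<le> 2 / t i" .
  show "Re (node \<delta> \<sigma> b) \<ge> 0" by (simp add: node Re_divide p_def)
  have "t i / 2 = 1 / (2 / t i)" by simp
  also have "\<dots> \<le> 1 / cmod p" using p p2 by (intro divide_left_mono mult_pos_pos) auto
  finally show "t i / 2 \<le> cmod (node \<delta> \<sigma> b)" by (simp add: node norm_divide)
  have "1 / cmod p \<le> 1 / (1/2)" using p by (intro divide_left_mono mult_pos_pos) auto
  then show "cmod (node \<delta> \<sigma> b) \<le> 2" by (simp add: node norm_divide)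
qed

lemma disc_around_node:
  assumes "b < M" and z: "z \<in> ball (1 - node \<delta> \<sigma> b) (16 * \<delta> * cmod (node \<delta> \<sigma> b))"
  shows "1 - z \<in> sector" "3/256 * t (Suc i) / N (Suc i) \<le> Re (W z)"
proof -
  define d where "d = node \<delta> \<sigma> b"
  define \<zeta> where "\<zeta> = 1 - z"
  note nb = node_bounds[OF assms(1), of \<sigma>, folded d_def]
  have dist: "cmod (\<zeta> - d) < 16 * \<delta> * cmod d"
    using z by (simp add: d_def \<zeta>_def dist_norm algebra_simps)
  have d_pos: "0 < cmod d" using nb(2) t_pos[of i] by linarith
  have "16 * \<delta> * cmod d \<le> 1/4 * cmod d" using \<delta>(3) by (intro mult_right_mono) auto
  with dist have dist4: "cmod (\<zeta> - d) \<le> 1/4 * cmod d" by linarith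
  have ge: "3/4 * cmod d \<le> cmod \<zeta>"
    using norm_triangle_ineq4[of \<zeta> "\<zeta> - d"] dist4 by simp
  have le: "cmod \<zeta> \<le> 4"
    using norm_triangle_ineq[of "\<zeta> - d" d] dist4 nb(3) by simp
  \<comment> \<open>The disc stays above 3/4 of t i / 2, and \<open>t (Suc i)\<close> is at most t i
    / 64.\<close>
  have t: "t (Suc i) \<le> cmod \<zeta>" using ge nb(2) t_Suc_le[of i] t_pos[of i] by linarith
  have "cmod d \<le> 2 * cmod \<zeta>" using ge d_pos by linarith
  then have "16 * \<delta> * cmod d \<le> 16 * \<delta> * (2 * cmod \<zeta>)"
    using \<delta>(1) by (intro mult_left_mono) auto
  also have "\<dots> < 64 * \<delta> * cmod \<zeta>" using \<delta>(1) ge d_pos by (auto intro!: mult_strict_right_mono)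
  finally have "cmod (\<zeta> - d) < c / N (Suc i) * cmod \<zeta>" using dist \<delta>(2) by simp
  moreover have "Re \<zeta> = Re d + Re (\<zeta> - d)" by simp
  ultimately have Re: "- (c / N (Suc i)) * cmod \<zeta> < Re \<zeta>"
    using nb(1) abs_Re_le_cmod[of "\<zeta> - d"] unfolding minus_mult_left[symmetric] by linarith
  show "1 - z \<in> sector" using Re_\<Psi>_ge(2)[OF t le Re] by (simp add: \<zeta>_def)
  have "3/16 * t (Suc i) / N (Suc i) \<le> 3/16 * cmod \<zeta> / N (Suc i)"
    using t N_ge[of "Suc i"] by (intro divide_right_mono mult_left_mono) auto
  also have "\<dots> \<le> Re (\<Psi> \<zeta>)" by (rule Re_\<Psi>_ge(1)[OF t le Re])
  finally show "3/256 * t (Suc i) / N (Suc i) \<le> Re (W z)" by (simp add: W_def \<zeta>_def)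
qed

text \<open>Measured in the coordinate p = 1 / (1 - z), where Re p - 1/2 = (1 - |z|^2) / (2 |1 -
  z|^2) is at most \<delta> and the heights of the net grow geometrically. The identity \<zeta> - d
  = (1/d - p) \<zeta> d converts this into a distance relative to |d|.\<close>

lemma nodes_cover:
  assumes z: "cmod z < 1" "t i \<le> cmod (1 - z)" "1 - (cmod z)\<^sup>2 \<le> 2 * \<delta> * (t i)\<^sup>2"
  shows "\<exists>\<sigma> b. b < M \<and> dist (1 - node \<delta> \<sigma> b) z \<le> 4 * \<delta> * cmod (node \<delta> \<sigma> b)"
proof -
  define \<zeta> where "\<zeta> = 1 - z"
  define p where "p = 1 / \<zeta>"
  define s where "s = cmod \<zeta>"
  have s: "t i \<le> s" "0 < s" using z(2) less_le_trans[OF t_pos z(2)] by (simp_all add: s_def \<zeta>_def)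
  then have nz: "\<zeta> \<noteq> 0" by (auto simp: s_def)
  have "(cmod z)\<^sup>2 = 1 - 2 * Re \<zeta> + s\<^sup>2"
    unfolding s_def cmod_power2 \<zeta>_def by (simp add: power2_eq_square algebra_simps)
  then have Re\<zeta>: "Re \<zeta> = s\<^sup>2 / 2 + (1 - (cmod z)\<^sup>2) / 2" by (simp add: field_simps)
  have "Re p = Re \<zeta> / s\<^sup>2" by (simp add: p_def Re_divide s_def cmod_power2)
  also have "\<dots> = 1/2 + (1 - (cmod z)\<^sup>2) / 2 / s\<^sup>2" unfolding Re\<zeta> using s by (simp add: add_divide_distrib)
  finally have Rep: "Re p = 1/2 + (1 - (cmod z)\<^sup>2) / 2 / s\<^sup>2" .
  have \<eta>: "0 \<le> Re p - 1/2" "Re p - 1/2 \<le> \<delta>"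
  proof -
    have "(cmod z)\<^sup>2 \<le> 1" using z(1) by (simp add: abs_square_le_1)
    then show "0 \<le> Re p - 1/2" unfolding Rep using s by simp
    have "(1 - (cmod z)\<^sup>2) / 2 / s\<^sup>2 \<le> \<delta> * (t i)\<^sup>2 / (t i)\<^sup>2"
      using z(3) s \<open>(cmod z)\<^sup>2 \<le> 1\<close> \<delta>(1) by (intro frac_le power_mono) auto
    then show "Re p - 1/2 \<le> \<delta>" unfolding Rep by simp
  qed
  have ps: "cmod p = 1 / s" by (simp add: p_def s_def norm_divide)
  define v where "v = \<bar>Im p\<bar>"
  have "v \<le> 1 / s" using abs_Im_le_cmod[of p] by (simp add: v_def ps)
  also have "\<dots> \<le> 1 / t i" using s by (intro divide_left_mono) auto
  finally have v: "0 \<le> v" "v \<le> 1 / t i" by (auto simp: v_def)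
  define \<nu> where "\<nu> b = ((1 + \<delta>) ^ b - 1) / 2" for b
  have "v < \<nu> M"
  proof -
    have "1 \<le> 1 / t i" using t_1_le[OF i] by simp
    then show ?thesis using M(1) v(2) unfolding \<nu>_def by argo
  qed
  define m where "m = (LEAST m. v < \<nu> m)"
  have m1: "v < \<nu> m" unfolding m_def by (rule LeastI) fact
  have m2: "m \<le> M" unfolding m_def by (rule Least_le) fact
  have "m \<noteq> 0" using m1 v(1) by (auto simp: \<nu>_def intro: ccontr)
  then obtain b where b: "m = Suc b" by (cases m) auto
  have bM: "b < M" using m2 b by simp
  have b1: "\<nu> b \<le> v" using not_less_Least[of b "\<lambda>m. v < \<nu> m"] b by (simp add: m_def)
  \<comment> \<open>The spacing is \<delta> times \<nu> b + 1/2, hence positive already at height 0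
    and comparable with \<delta> |p| throughout.\<close>
  have "\<nu> (Suc b) - \<nu> b = \<delta> * (\<nu> b + 1/2)" by (simp add: \<nu>_def field_simps)
  moreover have "\<delta> * (\<nu> b + 1/2) \<le> \<delta> * (v + 1/2)" using b1 \<delta>(1) by (intro mult_left_mono) auto
  ultimately have vb: "\<bar>v - \<nu> b\<bar> \<le> \<delta> * (v + 1/2)"
    using m1 b1 unfolding b by linarith
  define \<sigma> where "\<sigma> \<longleftrightarrow> Im p \<ge> 0"
  define d where "d = node \<delta> \<sigma> b"
  have nu_nonneg: "0 \<le> \<nu> b" using \<delta>(1) by (simp add: \<nu>_def)
  have pd: "1 / d = Complex (1/2) ((if \<sigma> then 1 else -1) * \<nu> b)" by (simp add: d_def node_def \<nu>_def)
  have d_nz: "d \<noteq> 0"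
  proof
    assume "d = 0"
    with arg_cong[OF pd, of Re] show False by simp
  qed
  have "cmod (p - 1 / d) \<le> \<bar>Re (p - 1 / d)\<bar> + \<bar>Im (p - 1 / d)\<bar>" by (rule cmod_le)
  also have "\<bar>Re (p - 1 / d)\<bar> \<le> \<delta>" using \<eta> by (simp add: pd)
  also have "\<bar>Im (p - 1 / d)\<bar> = \<bar>v - \<nu> b\<bar>" by (auto simp: pd v_def \<sigma>_def)
  also note vb
  finally have pd_le: "cmod (p - 1 / d) \<le> \<delta> + \<delta> * (v + 1/2)" by simp
  have "(v + 1/2) * s \<le> 2"
  proof -
    have "1/2 \<le> cmod p" using abs_Re_le_cmod[of p] \<eta>(1) by linarith
    then have "v + 1/2 \<le> 2 * cmod p" using abs_Im_le_cmod[of p] by (simp add: v_def)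
    then have "(v + 1/2) * s \<le> 2 * cmod p * s" using s by (intro mult_right_mono) auto
    then show ?thesis using s by (simp add: ps)
  qed
  moreover have "s \<le> 2" using norm_triangle_ineq4[of 1 z] z(1) by (simp add: s_def \<zeta>_def)
  ultimately have "(1 + (v + 1/2)) * s \<le> 4" by (simp add: distrib_right)
  then have "\<delta> * ((1 + (v + 1/2)) * s) \<le> \<delta> * 4" using \<delta>(1) by (intro mult_left_mono) auto
  then have "(\<delta> + \<delta> * (v + 1/2)) * s \<le> 4 * \<delta>" by (simp add: algebra_simps)
  have "\<zeta> - d = (1 / d - p) * \<zeta> * d" using nz d_nz by (simp add: p_def field_simps)
  then have "cmod (\<zeta> - d) = cmod (p - 1 / d) * s * cmod d"
    by (simp only: norm_mult s_def norm_minus_commute[of p])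
  then have "dist (1 - d) z = cmod (p - 1 / d) * s * cmod d"
    by (simp add: dist_norm \<zeta>_def algebra_simps)
  also have "\<dots> \<le> (\<delta> + \<delta> * (v + 1/2)) * s * cmod d"
    using pd_le s by (intro mult_right_mono) auto
  also have "\<dots> \<le> 4 * \<delta> * cmod d" by (intro mult_right_mono) (fact, simp)
  finally show ?thesis using bM unfolding d_def by blast
qed

text \<open>The 2 M L conditions make \<open>hfun f \<circ> \<phi>\<close> vanish to order
  \<open>L\<close> at every net point. The hypothesis on \<open>L\<close> lets 4^(-L) outweigh the
  crude bound |f|^2 / \<Delta> for its square on the discs, leaving |f|^2 / \<rho>^i away from 1;
  the neighbourhood of 1 costs 256 / \<rho>^i, whence 257.\<close>

lemma singular_value_le:
  assumes sys: "singular_system (comp_op \<phi>) C e" and L: "4 * \<rho> ^ i * (256/3 * (N (Suc i) / t (Suc i))) \<le> 4 ^ L"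
    and k: "2 * M * L \<le> k"
  shows "singular_system.s (comp_op \<phi>) e k \<le> sqrt (257 / \<rho> ^ i)"
proof -
  interpret singular_system "comp_op \<phi>" C e by fact
  define I where "I = (UNIV :: bool set) \<times> {..<M} \<times> {..<L}"
  define V where "V = (\<lambda>(\<sigma>, b, n) f. (deriv ^^ n) (\<lambda>z. hfun f (\<phi> z)) (1 - node \<delta> \<sigma> b))"
  define R where "R \<sigma> b = 16 * \<delta> * cmod (node \<delta> \<sigma> b)" for \<sigma> b
  \<comment> \<open>A common lower bound for Re W, hence for 1 - |\<phi>|^2, on all discs around net
    points.\<close>
  define \<Delta> where "\<Delta> = 3/256 * t (Suc i) / N (Suc i)"
  have \<Delta>: "0 < \<Delta>" unfolding \<Delta>_def using N_ge[of "Suc i"] by simp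
  have R: "0 < R \<sigma> b" if "b < M" for \<sigma> b
  proof -
    have "0 < cmod (node \<delta> \<sigma> b)" using node_bounds(2)[OF that, of \<sigma>] t_pos[of i] by linarith
    then show ?thesis using \<delta>(1) by (simp add: R_def)
  qed
  have W_pos: "1 - z \<in> sector" "\<Delta> \<le> Re (W z)" "0 < Re (W z)"
    if "b < M" "z \<in> ball (1 - node \<delta> \<sigma> b) (R \<sigma> b)" for \<sigma> b z
    using disc_around_node[OF that(1) that(2)[unfolded R_def]] \<Delta> by (auto simp: \<Delta>_def)
  have hol: "\<phi> holomorphic_on ball (1 - node \<delta> \<sigma> b) (R \<sigma> b)" if "b < M" for \<sigma> b
    by (rule \<phi>_holomorphic) (use W_pos[OF that] in auto)
  have \<phi>_lt: "\<Delta> \<le> 1 - (cmod (\<phi> z))\<^sup>2" "cmod (\<phi> z) < 1"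
    if "b < M" "z \<in> ball (1 - node \<delta> \<sigma> b) (R \<sigma> b)" for \<sigma> b z
  proof -
    show 1: "\<Delta> \<le> 1 - (cmod (\<phi> z))\<^sup>2"
      using one_minus_\<phi>_sq(1)[OF W_pos(1)[OF that] W_pos(3)[OF that]] W_pos(2)[OF that] by linarith
    then have "(cmod (\<phi> z))\<^sup>2 < 1" using \<Delta> by linarith
    then show "cmod (\<phi> z) < 1" by (simp add: abs_square_less_1)
  qed
  show ?thesis
  proof (rule s_le_finite[of _ I _ V])
    show "0 \<le> sqrt (257 / \<rho> ^ i)" using \<rho> by simp
    show "finite I" by (simp add: I_def)
    have "card I = 2 * M * L" by (simp add: I_def card_cartesian_product)
    with k show "card I \<le> k" by simp
  next
    fix \<alpha> and J :: "nat set" and a :: "nat \<Rightarrow> complex" assume "\<alpha> \<in> I" "finite J"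
    then obtain \<sigma> b n where \<alpha>: "\<alpha> = (\<sigma>, b, n)" "b < M" by (auto simp: I_def)
    show "V \<alpha> (\<Sum>j\<in>J. hscale (a j) (e j)) = (\<Sum>j\<in>J. a j * V \<alpha> (e j))"
      unfolding V_def \<alpha>(1) prod.case
      by (rule higher_deriv_comp_sum[OF hol[OF \<alpha>(2), of \<sigma>] \<phi>_lt(2)[OF \<alpha>(2), of _ \<sigma>] open_ball _ \<open>finite J\<close>])
         (simp_all add: R[OF \<alpha>(2)])
  next
    fix f assume zero: "\<And>\<alpha>. \<alpha> \<in> I \<Longrightarrow> V \<alpha> f = 0"
    define B where "B = norm f / sqrt \<Delta>"
    have B_sq: "B\<^sup>2 = (norm f)\<^sup>2 / \<Delta>" using \<Delta> by (simp add: B_def power_divide)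
    have B_nonneg: "0 \<le> B" using \<Delta> by (simp add: B_def)
    \<comment> \<open>Beyond this radius z is as close to the circle as \<open>nodes_cover\<close>
      demands; the \<open>min\<close> keeps the argument of the root nonnegative.\<close>
    have small: "(cmod (hfun f (\<phi> z)))\<^sup>2 \<le> (norm f)\<^sup>2 / \<rho> ^ i"
      if z: "sqrt (1 - min 1 (2 * \<delta> * (t i)\<^sup>2)) < cmod z" "cmod z < 1" "t i \<le> cmod (1 - z)" for z
    proof -
      have "1 - min 1 (2 * \<delta> * (t i)\<^sup>2) \<le> (cmod z)\<^sup>2"
        by (rule sqrt_le_D) (use z(1) in simp)
      then have "1 - (cmod z)\<^sup>2 \<le> 2 * \<delta> * (t i)\<^sup>2" by linarith
      from nodes_cover[OF z(2,3) this] obtain \<sigma> b where b: "b < M"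
        "dist (1 - node \<delta> \<sigma> b) z \<le> 4 * \<delta> * cmod (node \<delta> \<sigma> b)" by blast
      have "cmod (hfun f (\<phi> z)) \<le> 2 * B * (1/2) ^ L"
      proof (rule zero_of_high_order_small[where u = "\<lambda>z. hfun f (\<phi> z)"])
        have "\<phi> ` ball (1 - node \<delta> \<sigma> b) (R \<sigma> b) \<subseteq> ball 0 1" using \<phi>_lt(2)[OF b(1)] by auto
        from holomorphic_on_compose_gen[OF hol[OF b(1)] hfun_holomorphic this]
        show "(\<lambda>z. hfun f (\<phi> z)) holomorphic_on ball (1 - node \<delta> \<sigma> b) (R \<sigma> b)" by (simp add: o_def)
        show "0 < R \<sigma> b" by (rule R[OF b(1)])
        show "(deriv ^^ n) (\<lambda>z. hfun f (\<phi> z)) (1 - node \<delta> \<sigma> b) = 0" if "n < L" for n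
          using zero[of "(\<sigma>, b, n)"] b(1) that by (simp add: I_def V_def)
        show "dist (1 - node \<delta> \<sigma> b) z \<le> R \<sigma> b / 4" using b(2) by (simp add: R_def)
        fix z' assume z': "z' \<in> ball (1 - node \<delta> \<sigma> b) (R \<sigma> b)"
        have "(cmod (hfun f (\<phi> z')))\<^sup>2 \<le> (norm f)\<^sup>2 / (1 - (cmod (\<phi> z'))\<^sup>2)"
          by (rule hfun_norm_le[OF \<phi>_lt(2)[OF b(1) z']])
        also have "\<dots> \<le> (norm f)\<^sup>2 / \<Delta>"
          using mult_pos_pos[OF less_le_trans[OF \<Delta> \<phi>_lt(1)[OF b(1) z']] \<Delta>]
          by (intro divide_left_mono \<phi>_lt(1)[OF b(1) z']) auto
        also note B_sq[symmetric]
        finally show "cmod (hfun f (\<phi> z')) \<le> B" by (rule power2_le_imp_le) (rule B_nonneg)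
      qed
      then have "(cmod (hfun f (\<phi> z)))\<^sup>2 \<le> (2 * B * (1/2) ^ L)\<^sup>2" by (intro power_mono) auto
      also have "\<dots> = (norm f)\<^sup>2 * (4 / \<Delta> / 4 ^ L)"
      proof -
        have "((1/2 :: real) ^ L)\<^sup>2 = ((1/2)\<^sup>2) ^ L" by (simp only: power_mult[symmetric] mult.commute)
        also have "\<dots> = 1 / 4 ^ L" by (simp add: power2_eq_square power_one_over)
        finally show ?thesis by (simp add: power_mult_distrib B_sq)
      qed
      also have "\<dots> \<le> (norm f)\<^sup>2 * (1 / \<rho> ^ i)"
      proof (intro mult_left_mono)
        have "1 / \<Delta> = 256/3 * (N (Suc i) / t (Suc i))" by (simp add: \<Delta>_def)
        then have "4 * \<rho> ^ i * (1 / \<Delta>) \<le> 4 ^ L" using L by (simp only:)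
        moreover have "4 / \<Delta> * \<rho> ^ i = 4 * \<rho> ^ i * (1 / \<Delta>)" by simp
        ultimately have "4 / \<Delta> * \<rho> ^ i \<le> 4 ^ L" by (simp only:)
        moreover have "0 < \<rho> ^ i" using \<rho> by simp
        ultimately have "4 / \<Delta> \<le> 4 ^ L / \<rho> ^ i" by (simp only: pos_le_divide_eq)
        then have "4 / \<Delta> / 4 ^ L \<le> 4 ^ L / \<rho> ^ i / 4 ^ L" by (rule divide_right_mono) simp
        also have "\<dots> = 1 / \<rho> ^ i" by simp
        finally show "4 / \<Delta> / 4 ^ L \<le> 1 / \<rho> ^ i" .
      qed simp
      finally show ?thesis by simp
    qed
    have "(norm (comp_op \<phi> f))\<^sup>2 \<le> (norm f)\<^sup>2 / \<rho> ^ i + 8 * t i / (1 - cmod (\<phi> (of_real (1 - t i)))) * (norm f)\<^sup>2"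
    proof (rule norm_comp_op_le_near_1[OF _ _ _ _ small])
      show "0 < t i" "t i \<le> 1" using t_1_le[OF i] by auto
      show "0 \<le> (norm f)\<^sup>2 / \<rho> ^ i" using \<rho> by simp
      have "0 < min 1 (2 * \<delta> * (t i)\<^sup>2)" using \<delta>(1) by simp
      then show "sqrt (1 - min 1 (2 * \<delta> * (t i)\<^sup>2)) < 1" by simp
    qed
    also have "\<dots> \<le> (norm f)\<^sup>2 / \<rho> ^ i + 256 / \<rho> ^ i * (norm f)\<^sup>2"
      by (intro add_left_mono mult_right_mono near_1_factor_le[OF i]) simp
    also have "\<dots> = (sqrt (257 / \<rho> ^ i) * norm f)\<^sup>2"
      using \<rho> by (simp add: power_mult_distrib add_divide_distrib[symmetric])
    finally show "norm (comp_op \<phi> f) \<le> sqrt (257 / \<rho> ^ i) * norm f"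
      by (rule power2_le_imp_le) (use \<rho> in simp)
  qed
qed

text \<open>By Bernoulli's inequality, 1 / \<delta> steps, rounded up, at least double the power of
  1 + \<delta>; m doublings suffice.\<close>

lemma M_le:
  assumes "4 / t i < 2 ^ m"
  shows "M \<le> nat \<lceil>1 / \<delta>\<rceil> * m"
  unfolding M_def
proof (rule Least_le)
  let ?D = "nat \<lceil>1 / \<delta>\<rceil>"
  have "1 / \<delta> \<le> real ?D" by linarith
  then have "1 / \<delta> * \<delta> \<le> real ?D * \<delta>" using \<delta>(1) by (intro mult_right_mono) auto
  then have "1 \<le> real ?D * \<delta>" using \<delta>(1) by simp
  moreover have "1 + real ?D * \<delta> \<le> (1 + \<delta>) ^ ?D" using \<delta>(1) by (intro Bernoulli_inequality) simp
  ultimately have "2 \<le> (1 + \<delta>) ^ ?D" by linarith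
  then have "2 ^ m \<le> ((1 + \<delta>) ^ ?D) ^ m" by (intro power_mono) auto
  with assms show "4 / t i < (1 + \<delta>) ^ (?D * m)" by (simp add: power_mult)
qed

end

end

section \<open>Counting the conditions\<close>

context lacunary_symbol begin

lemma N_le_power2:
  assumes "K \<le> 2 ^ a"
  shows "N l \<le> 2 ^ (a + 2 * l)"
proof -
  have "l + 1 \<le> 2 ^ l" unfolding Suc_eq_plus1[symmetric] by (rule Suc_leI[OF less_exp])
  then have "real (l + 1) \<le> real (2 ^ l)" by (simp only: of_nat_le_iff)
  then have "K * real (l + 1) * 2 ^ l \<le> 2 ^ a * 2 ^ l * 2 ^ l"
    using assms K_ge by (intro mult_mono) auto
  also have "\<dots> = 2 ^ (a + 2 * l)" by (simp add: power_add mult_2)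
  finally show ?thesis by (simp add: N_def)
qed

text \<open>Each step multiplies 1 / t by (N l)^2, whose binary exponent is linear in l, so the
  accumulated exponent is quadratic.\<close>

lemma inverse_t_le_power2:
  assumes "K \<le> 2 ^ a"
  shows "4 / t l \<le> 2 ^ (2 * l * (a + 2 * l))"
proof (induction l)
  case (Suc l)
  have "4 / t (Suc l) = 4 / t l * (N l)\<^sup>2" by (simp add: t.simps(2))
  also have "\<dots> \<le> 2 ^ (2 * l * (a + 2 * l)) * (2 ^ (a + 2 * l))\<^sup>2"
    using Suc N_le_power2[OF assms, of l] N_ge[of l] by (intro mult_mono power_mono) auto
  also have "\<dots> = 2 ^ (2 * l * (a + 2 * l) + (a + 2 * l) * 2)" by (simp only: power_add power_mult)
  also have "\<dots> \<le> 2 ^ (2 * Suc l * (a + 2 * Suc l))" by (intro power_increasing) (auto simp: algebra_simps)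
  finally show ?case .
qed simp

text \<open>Of the factor (i + 1)^5, one power comes from N (i + 1) in 1 / \<delta>, two from the
  number of doublings in the net and two from the order of vanishing.\<close>

lemma singular_value_le_poly:
  assumes sys: "singular_system (comp_op \<phi>) C e"
  obtains Q where "Q \<ge> 1"
    "\<And>i. i \<ge> 1 \<Longrightarrow> singular_system.s (comp_op \<phi>) e (Q * (i + 1) ^ 5 * 2 ^ i) \<le> sqrt (257 / \<rho> ^ i)"
proof -
  obtain a where "K < 2 ^ a" using real_arch_pow[of 2 K] by auto
  then have a: "K \<le> 2 ^ a" by simp
  obtain r where "\<rho> < 2 ^ r" using real_arch_pow[of 2 \<rho>] by auto
  then have r: "\<rho> \<le> 2 ^ r" by simp
  define m where "m i = 2 * i * (a + 2 * i) + 1" for i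
  \<comment> \<open>The 9 covers the constant 256/3; the other summands are the binary exponents
    bounding N (i + 1), 4 / t (i + 1) and \<rho>^i.\<close>
  define L where "L i = 9 + a + 2 * (i + 1) + 2 * (i + 1) * (a + 2 * (i + 1)) + r * i" for i
  define D where "D i = nat \<lceil>1 / (c / (64 * N (Suc i)))\<rceil>" for i
  define q where "q = nat \<lceil>4 * (64 / c + 1) * K\<rceil>"
  define Q where "Q = 2 * q * (2 * a + 5) * (3 * a + 23 + r) + 1"
  have D: "D i \<le> q * (i + 1) * 2 ^ i" for i
  proof -
    have "1 / (c / (64 * N (Suc i))) = 64 / c * N (Suc i)" by simp
    moreover have "0 \<le> 64 / c * N (Suc i)" using c_bounds N_ge[of "Suc i"] by simp
    ultimately have "real (D i) \<le> 64 / c * N (Suc i) + 1" unfolding D_def by linarith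
    also have "\<dots> \<le> (64 / c + 1) * N (Suc i)" using N_ge(2)[of "Suc i"] by (simp add: distrib_right)
    also have "\<dots> = (64 / c + 1) * K * (real (i + 2) * 2 * 2 ^ i)" by (simp add: N_def)
    also have "\<dots> \<le> (64 / c + 1) * K * (real (2 * (i + 1)) * 2 * 2 ^ i)"
      using c_bounds K_ge by (intro mult_left_mono mult_right_mono) auto
    also have "\<dots> = (4 * (64 / c + 1) * K) * (real (i + 1) * 2 ^ i)"
    proof -
      have "u * K * (2 * v * 2 * w) = (4 * u * K) * (v * w)" for u v w by simp
      then show ?thesis by (simp only: of_nat_mult of_nat_numeral)
    qed
    also have "\<dots> \<le> real q * (real (i + 1) * 2 ^ i)"
      unfolding q_def by (intro mult_right_mono real_nat_ceiling_ge) simp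
    also have "\<dots> = real (q * (i + 1) * 2 ^ i)"
      by (simp only: of_nat_mult of_nat_power of_nat_numeral mult.assoc)
    finally show ?thesis by (simp only: of_nat_le_iff)
  qed
  have m: "m i \<le> (2 * a + 5) * (i + 1) ^ 2" for i
    by (simp add: m_def power2_eq_square algebra_simps)
  have L: "L i \<le> (3 * a + 23 + r) * (i + 1) ^ 2" for i
    by (simp add: L_def power2_eq_square algebra_simps)
  have "singular_system.s (comp_op \<phi>) e (Q * (i + 1) ^ 5 * 2 ^ i) \<le> sqrt (257 / \<rho> ^ i)" if i: "i \<ge> 1" for i
  proof (rule singular_value_le[OF i sys, of "L i"])
    let ?M = "LEAST m. 4 / t i < (1 + c / (64 * N (Suc i))) ^ m"
    have "(2 :: real) ^ (2 * i * (a + 2 * i)) < 2 ^ m i" unfolding m_def by (rule power_strict_increasing) auto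
    with inverse_t_le_power2[OF a, of i] have "4 / t i < 2 ^ m i" by (rule le_less_trans)
    from M_le[OF i this] have "?M \<le> D i * m i" by (simp add: D_def)
    also have "\<dots> \<le> (q * (i + 1) * 2 ^ i) * ((2 * a + 5) * (i + 1) ^ 2)" by (intro mult_mono D m) auto
    finally have "2 * ?M * L i \<le> 2 * ((q * (i + 1) * 2 ^ i) * ((2 * a + 5) * (i + 1) ^ 2)) * ((3 * a + 23 + r) * (i + 1) ^ 2)"
      using L by (intro mult_mono) auto
    also have "\<dots> = (2 * q * (2 * a + 5) * (3 * a + 23 + r)) * (i + 1) ^ 5 * 2 ^ i"
    proof -
      have "2 * ((q * x * y) * (u * x ^ 2)) * (v * x ^ 2) = (2 * q * u * v) * x ^ 5 * y" for x y u v :: nat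
        by algebra
      then show ?thesis .
    qed
    also have "\<dots> \<le> Q * (i + 1) ^ 5 * 2 ^ i" by (intro mult_right_mono) (auto simp: Q_def)
    finally show "2 * ?M * L i \<le> Q * (i + 1) ^ 5 * 2 ^ i" .
    have "4 * \<rho> ^ i * (256/3 * (N (Suc i) / t (Suc i))) = 256/3 * (\<rho> ^ i * (N (Suc i) * (4 / t (Suc i))))" by simp
    also have "\<dots> \<le> 2 ^ 9 * ((2 ^ r) ^ i * (2 ^ (a + 2 * Suc i) * 2 ^ (2 * Suc i * (a + 2 * Suc i))))"
      using r \<rho> N_ge[of "Suc i"] less_imp_le[OF t_pos[of "Suc i"]]
      by (intro mult_mono power_mono N_le_power2[OF a] inverse_t_le_power2[OF a]) auto
    also have "\<dots> = 2 ^ (9 + (r * i + ((a + 2 * Suc i) + 2 * Suc i * (a + 2 * Suc i))))"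
      by (simp only: power_add power_mult)
    also have "9 + (r * i + ((a + 2 * Suc i) + 2 * Suc i * (a + 2 * Suc i))) = L i"
      by (simp add: L_def)
    also have "(2 :: real) ^ L i \<le> 4 ^ L i" by (intro power_mono) auto
    finally show "4 * \<rho> ^ i * (256/3 * (N (Suc i) / t (Suc i))) \<le> 4 ^ L i" .
  qed
  then show ?thesis by (intro that[of Q]) (auto simp: Q_def)
qed

end

theorem theorem5p1:
  fixes p0 :: real
  assumes "p0 > 0"
  shows "\<exists>\<phi> :: complex \<Rightarrow> complex. \<phi> holomorphic_on ball 0 1 \<and> \<phi> \<in> ball 0 1 \<rightarrow> ball 0 1 \<and>
           (\<forall>p > p0. comp_op \<phi> \<in> schatten_class p) \<and> comp_op \<phi> \<notin> schatten_class p0"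
proof -
  define \<rho> :: real where "\<rho> = 2 powr (2 / p0)"
  interpret lacunary_symbol \<rho>
    by unfold_locales (use assms in \<open>simp add: \<rho>_def\<close>)
  obtain C e where sys: "singular_system (comp_op \<phi>) C e"
    using compact_op_singular_system[OF compact_comp_op_\<phi>] by blast
  interpret S: singular_system "comp_op \<phi>" C e by fact
  have \<rho>_powr: "(\<rho> ^ n) powr x = (2 powr (2 * x / p0)) ^ n" for n :: nat and x
    using \<rho> by (simp add: \<rho>_def powr_powr powr_realpow[symmetric] powr_power mult_ac)
  have "comp_op \<phi> \<in> schatten_class p" if "p > p0" for p
  proof -
    have p: "p > 0" using that assms by simp
    obtain Q where Q: "Q \<ge> 1" "\<And>i. i \<ge> 1 \<Longrightarrow> S.s (Q * (i + 1) ^ 5 * 2 ^ i) \<le> sqrt (257 / \<rho> ^ i)"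
      using singular_value_le_poly[OF sys] by blast
    \<comment> \<open>Shifted by one, because the upper bound is available for block indices from 1
      on.\<close>
    define k where "k i = Q * (i + 2) ^ 5 * 2 ^ Suc i" for i
    \<comment> \<open>A block contributes a polynomial times (2 / y)^i, and y > 2 exactly when p >
      p0.\<close>
    define y where "y = 2 powr (p / p0)"
    have "2 powr 1 < y" unfolding y_def using that assms by (intro powr_less_mono) auto
    then have y: "y > 2" by simp
    have "summable (\<lambda>n. S.s n powr p)"
    proof (rule summable_by_blocks[of _ k "\<lambda>i. 257 powr (p / 2) / y ^ Suc i"])
      show "decseq (\<lambda>n. S.s n powr p)"
        using decseqD[OF S.decseq_s] p by (intro decseq_SucI powr_mono2) auto
      show "0 \<le> S.s n powr p" for n by simp
      show "incseq k" unfolding k_def by (intro incseq_SucI mult_mono power_mono power_increasing) auto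
      show "i \<le> k i" for i
      proof -
        have "i < 2 ^ i" by (rule less_exp)
        then have "i \<le> 1 * 1 * 2 ^ Suc i" unfolding power_Suc by linarith
        also have "\<dots> \<le> Q * (i + 2) ^ 5 * 2 ^ Suc i" using Q(1) by (intro mult_mono) auto
        finally show ?thesis by (simp only: k_def)
      qed
      show "S.s (k i) powr p \<le> 257 powr (p / 2) / y ^ Suc i" for i
      proof -
        have "S.s (k i) \<le> sqrt (257 / \<rho> ^ Suc i)" using Q(2)[of "Suc i"] by (simp add: k_def)
        then have "S.s (k i) powr p \<le> sqrt (257 / \<rho> ^ Suc i) powr p" using p by (intro powr_mono2) auto
        also have "\<dots> = (257 / \<rho> ^ Suc i) powr (p / 2)"
          using \<rho> by (simp add: powr_half_sqrt[symmetric] powr_powr del: power_Suc)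
        also have "\<dots> = 257 powr (p / 2) / (\<rho> ^ Suc i) powr (p / 2)"
          by (rule powr_divide)
        also have "(\<rho> ^ Suc i) powr (p / 2) = y ^ Suc i" unfolding \<rho>_powr y_def by simp
        finally show ?thesis .
      qed
      \<comment> \<open>Written in i + 2, the exponent of 2 in \<open>k (Suc i)\<close>, so that the
        series is a tail of \<open>summable_poly_geometric\<close>.\<close>
      have "summable (\<lambda>i. real Q * 257 powr (p / 2) * y * ((real (i + 2) + 1) ^ 5 * (2 / y) ^ (i + 2)))"
        using y by (intro summable_mult summable_ignore_initial_segment[OF summable_poly_geometric[of "2 / y" 5]]) auto
      moreover have "real Q * 257 powr (p / 2) * y * ((real (i + 2) + 1) ^ 5 * (2 / y) ^ (i + 2)) =
          real (k (Suc i)) * (257 powr (p / 2) / y ^ Suc i)" for i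
        using y by (simp add: k_def power_divide add_ac)
      ultimately show "summable (\<lambda>i. real (k (Suc i)) * (257 powr (p / 2) / y ^ Suc i))" by (simp only:)
    qed
    then show ?thesis
      unfolding schatten_class_def using compact_comp_op_\<phi> S.singular_numbers_s by blast
  qed
  moreover have "comp_op \<phi> \<notin> schatten_class p0"
  proof
    assume "comp_op \<phi> \<in> schatten_class p0"
    then obtain s' where s': "singular_numbers (comp_op \<phi>) s'" "summable (\<lambda>n. s' n powr p0)"
      by (auto simp: schatten_class_def)
    \<comment> \<open>Membership may be witnessed by any list; uniqueness identifies it with the
      constructed one.\<close>
    have "s' = S.s" by (rule singular_numbers_unique[OF s'(1) S.singular_numbers_s])
    with s'(2) have "summable (\<lambda>n. S.s n powr p0)" by simp
    moreover have "S.s (Suc m) powr p0 \<le> S.s m powr p0" for m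
      using decseqD[OF S.decseq_s, of m "Suc m"] assms by (intro powr_mono2) auto
    \<comment> \<open>Cauchy condensation: the lower bound at the indices 2^n keeps these terms
      above (1 / A)^(p0/2), so they cannot tend to 0.\<close>
    ultimately have "summable (\<lambda>n. 2 ^ n * S.s (2 ^ n) powr p0)"
      by (subst condensation_test[symmetric]) auto
    then have lim: "(\<lambda>n. 2 ^ n * S.s (2 ^ n) powr p0) \<longlonglongrightarrow> 0" by (rule summable_LIMSEQ_zero)
    have "(1 / A) powr (p0 / 2) \<le> 2 ^ n * S.s (2 ^ n) powr p0" if "n \<ge> 1" for n
    proof -
      have "(1 / (A * \<rho> ^ n)) powr (p0 / 2) = sqrt (1 / (A * \<rho> ^ n)) powr p0"
        using \<rho> A_ge by (simp add: powr_half_sqrt[symmetric] powr_powr)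
      also have "\<dots> \<le> S.s (2 ^ n) powr p0"
        using singular_value_ge[OF that sys] \<rho> A_ge assms by (intro powr_mono2) auto
      finally have "(1 / (A * \<rho> ^ n)) powr (p0 / 2) \<le> S.s (2 ^ n) powr p0" .
      moreover have "(1 / (A * \<rho> ^ n)) powr (p0 / 2) = (1 / A / \<rho> ^ n) powr (p0 / 2)" by simp
      moreover have "(1 / A / \<rho> ^ n) powr (p0 / 2) = (1 / A) powr (p0 / 2) / (\<rho> ^ n) powr (p0 / 2)"
        by (rule powr_divide)
      moreover have "(\<rho> ^ n) powr (p0 / 2) = 2 ^ n"
      proof -
        have "2 * (p0 / 2) / p0 = 1" using assms by simp
        then show ?thesis unfolding \<rho>_powr by simp
      qed
      ultimately have "(1 / A) powr (p0 / 2) / 2 ^ n \<le> S.s (2 ^ n) powr p0" by metis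
      then show ?thesis by (simp add: pos_divide_le_eq mult.commute)
    qed
    then have "(1 / A) powr (p0 / 2) \<le> 0"
      by (intro LIMSEQ_le_const[OF lim]) blast
    then show False using A_ge by simp
  qed
  ultimately show ?thesis
    using hol self_map by (intro exI[of _ \<phi>]) (auto simp: Pi_def)
qed

end
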